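(* Consider the problem of simultaneously evaluating $m$ linear threshold formulas with integer coefficients, the $k$-th being $\sum_{i=1}^n a_{k_i}x_i\ge\theta_k$, on a common unknown input $x$. (a) There is a polynomial-time algorithm for this problem whose expected cost is within a factor $O(\log(mD_{avg}))$ of optimal, where $D_{avg}$ is the average over $k\in\{1,\dots,m\}$ of $\sum_{i=1}^n|a_{k_i}|$; moreover, in the special case where each of the formulas is an OR formula (a disjunction of variables) and each variable appears in at most $r$ of them, this algorithm achieves approximation factor $2(\ln(\beta_{max}r)+1)$, where $\beta_{max}$ is the maximum number of variables in any of the OR formulas. (b) There is also a polynomial-time algorithm for this problem whose expected cost is within a factor $D_{max}$ of optimal, where $D_{max}=\max_{k\in\{1,\dots,m\}}\sum_{i=1}^n|a_{k_i}|$.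
   Context: Each formula $\sum_i a_{k_i}x_i\ge\theta_k$ (integers $a_{k_i},\theta_k$) represents $f_k:\{0,1\}^n\to\{0,1\}$ with $f_k(x)=1$ iff the inequality holds; an OR formula $x_{i_1}\vee\dots\vee x_{i_s}$ is the threshold formula $x_{i_1}+\dots+x_{i_s}\ge1$. Simultaneous evaluation: input also includes $p\in(0,1)^n$ and costs $c_i\ge0$; an unknown $x\in\{0,1\}^n$ is drawn from the product distribution with $\Pr[x_i=1]=p_i$; $x_i$ is learned only by testing $i$ at cost $c_i$. A strategy adaptively tests variables until the observed partial assignment $b\in\{0,1,*\}^n$ is, for every $k$, a $0$-certificate or $1$-certificate of $f_k$ (i.e. $f_k$ is constant on all $a\in\{0,1\}^n$ agreeing with $b$ on its non-$*$ coordinates), then outputs $f_1(x),\dots,f_m(x)$. Its cost is the expected total testing cost; an optimal strategy minimizes it, and a factor-$\alpha$ approximation has expected cost at most $\alpha$ times optimal. *)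

theory Defs
  imports
    "HOL-Probability.Probability"
    "HOL-Library.Landau_Symbols"
    "HOL-Library.Log_Nat"
    "HOL-Computational_Algebra.Polynomial"
begin

section \<open>Simultaneous evaluation of linear threshold formulas\<close>

text \<open>
  Variables and formulas are indexed from 0: variable \<open>i < nvars I\<close>, formula \<open>k < nforms I\<close>;
  the values of the four function fields beyond these bounds are irrelevant. Probabilities and
  costs are rational because an instance is the input of an algorithm whose running time is
  measured in the bit length of that input.
\<close>

record ltf_instance =
  nvars :: nat
  nforms :: nat
  coef :: "nat \<Rightarrow> nat \<Rightarrow> int"
  thr :: "nat \<Rightarrow> int"
  prob :: "nat \<Rightarrow> rat"
  cost :: "nat \<Rightarrow> rat"

definition wf_instance :: "ltf_instance \<Rightarrow> bool" where
  "wf_instance I \<longleftrightarrow> nforms I \<ge> 1 \<and> (\<forall>i<nvars I. 0 < prob I i \<and> prob I i < 1 \<and> cost I i \<ge> 0)"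

definition formula_value :: "ltf_instance \<Rightarrow> nat \<Rightarrow> (nat \<Rightarrow> bool) \<Rightarrow> bool" where
  "formula_value I k a \<longleftrightarrow> (\<Sum>i<nvars I. coef I k i * of_bool (a i)) \<ge> thr I k"

definition D :: "ltf_instance \<Rightarrow> nat \<Rightarrow> int" where
  "D I k = (\<Sum>i<nvars I. \<bar>coef I k i\<bar>)"

definition D_avg :: "ltf_instance \<Rightarrow> real" where
  "D_avg I = (\<Sum>k<nforms I. real_of_int (D I k)) / real (nforms I)"

definition D_max :: "ltf_instance \<Rightarrow> int" where
  "D_max I = Max (D I ` {..<nforms I})"

definition formula_vars :: "ltf_instance \<Rightarrow> nat \<Rightarrow> nat set" where
  "formula_vars I k = {i. i < nvars I \<and> coef I k i \<noteq> 0}"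

definition or_formula :: "ltf_instance \<Rightarrow> nat \<Rightarrow> bool" where
  "or_formula I k \<longleftrightarrow>
     (\<forall>i<nvars I. coef I k i \<in> {0, 1}) \<and> thr I k = 1 \<and> formula_vars I k \<noteq> {}"

definition occurrences :: "ltf_instance \<Rightarrow> nat \<Rightarrow> nat" where
  "occurrences I i = card {k. k < nforms I \<and> i \<in> formula_vars I k}"

definition beta_max :: "ltf_instance \<Rightarrow> nat" where
  "beta_max I = Max ((\<lambda>k. card (formula_vars I k)) ` {..<nforms I})"

subsection \<open>Certificates and strategies\<close>

text \<open>A partial assignment is a map \<open>b :: nat \<rightharpoonup> bool\<close>; \<open>b i = None\<close> stands for \<open>*\<close>.\<close>

definition certificate :: "((nat \<Rightarrow> bool) \<Rightarrow> bool) \<Rightarrow> bool \<Rightarrow> (nat \<rightharpoonup> bool) \<Rightarrow> bool" where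
  "certificate f v b \<longleftrightarrow> (\<forall>a. b \<subseteq>\<^sub>m (\<lambda>i. Some (a i)) \<longrightarrow> f a = v)"

definition all_determined :: "ltf_instance \<Rightarrow> (nat \<rightharpoonup> bool) \<Rightarrow> bool" where
  "all_determined I b \<longleftrightarrow>
     (\<forall>k<nforms I. certificate (formula_value I k) False b \<or> certificate (formula_value I k) True b)"

text \<open>
  An adaptive strategy is a decision tree: \<open>Test i S0 S1\<close> tests variable \<open>i\<close> and goes on with
  \<open>S0\<close> if \<open>x i\<close> is 0 and with \<open>S1\<close> if it is 1.
\<close>

datatype strategy = Stop | Test nat strategy strategy

fun evaluates_from :: "ltf_instance \<Rightarrow> (nat \<rightharpoonup> bool) \<Rightarrow> strategy \<Rightarrow> bool" where
  "evaluates_from I b Stop \<longleftrightarrow> all_determined I b"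
| "evaluates_from I b (Test i S0 S1) \<longleftrightarrow>
     \<not> all_determined I b \<and> i < nvars I \<and> b i = None \<and>
     evaluates_from I (b(i \<mapsto> False)) S0 \<and> evaluates_from I (b(i \<mapsto> True)) S1"

definition evaluates :: "ltf_instance \<Rightarrow> strategy \<Rightarrow> bool" where
  "evaluates I S \<longleftrightarrow> evaluates_from I Map.empty S"

fun tests :: "strategy \<Rightarrow> (nat \<Rightarrow> bool) \<Rightarrow> nat list" where
  "tests Stop x = []"
| "tests (Test i S0 S1) x = i # tests (if x i then S1 else S0) x"

definition input_pmf :: "ltf_instance \<Rightarrow> (nat \<Rightarrow> bool) pmf" where
  "input_pmf I = Pi_pmf {..<nvars I} False (\<lambda>i. bernoulli_pmf (real_of_rat (prob I i)))"

definition expected_cost :: "ltf_instance \<Rightarrow> strategy \<Rightarrow> real" where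
  "expected_cost I S =
     measure_pmf.expectation (input_pmf I) (\<lambda>x. \<Sum>i\<leftarrow>tests S x. real_of_rat (cost I i))"

text \<open>The infimum is a minimum, see \<open>optimal_strategy_exists\<close> below.\<close>

definition opt_cost :: "ltf_instance \<Rightarrow> real" where
  "opt_cost I = (INF S\<in>{S. evaluates I S}. expected_cost I S)"

lemma all_determined_total:
  assumes "\<forall>i<nvars I. b i \<noteq> None"
  shows "all_determined I b"
proof -
  have eq: "formula_value I k a = formula_value I k (\<lambda>i. the (b i))"
    if "b \<subseteq>\<^sub>m (\<lambda>i. Some (a i))" for a k
  proof -
    have "a i = the (b i)" if "i < nvars I" for i
    proof -
      have "i \<in> dom b" using assms \<open>i < nvars I\<close> by auto
      then have "b i = Some (a i)"
        using \<open>b \<subseteq>\<^sub>m (\<lambda>i. Some (a i))\<close> by (auto simp: map_le_def)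
      then show ?thesis by simp
    qed
    then have "(\<Sum>i<nvars I. coef I k i * of_bool (a i)) =
               (\<Sum>i<nvars I. coef I k i * of_bool (the (b i)))"
      by (intro sum.cong) auto
    then show ?thesis unfolding formula_value_def by simp
  qed
  then show ?thesis
    unfolding all_determined_def certificate_def by metis
qed

lemma finite_nonempty_strategies_from:
  "finite {S. evaluates_from I b S} \<and> {S. evaluates_from I b S} \<noteq> {}"
proof (induction "card {i. i < nvars I \<and> b i = None}" arbitrary: b rule: less_induct)
  case less
  let ?U = "{i. i < nvars I \<and> b i = None}"
  let ?E = "\<lambda>b. {S. evaluates_from I b S}"
  have fin: "finite ?U" by simp
  have IH: "finite (?E (b(i \<mapsto> v))) \<and> ?E (b(i \<mapsto> v)) \<noteq> {}" if "i \<in> ?U" for i v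
  proof (rule less)
    have "{j. j < nvars I \<and> (b(i \<mapsto> v)) j = None} \<subset> ?U"
      using that by (auto split: if_splits)
    then show "card {j. j < nvars I \<and> (b(i \<mapsto> v)) j = None} < card ?U"
      by (rule psubset_card_mono[OF fin])
  qed
  show ?case
  proof (cases "all_determined I b")
    case True
    have "S = Stop" if "evaluates_from I b S" for S
      using that True by (cases S) auto
    then have "?E b = {Stop}" using True by auto
    then show ?thesis by simp
  next
    case False
    have "S \<in> (\<Union>i\<in>?U. \<Union>S0\<in>?E (b(i \<mapsto> False)). Test i S0 ` ?E (b(i \<mapsto> True)))"
      if "evaluates_from I b S" for S
      using that False by (cases S) auto
    then have "?E b \<subseteq> (\<Union>i\<in>?U. \<Union>S0\<in>?E (b(i \<mapsto> False)). Test i S0 ` ?E (b(i \<mapsto> True)))"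
      by blast
    moreover have "finite (\<Union>i\<in>?U. \<Union>S0\<in>?E (b(i \<mapsto> False)). Test i S0 ` ?E (b(i \<mapsto> True)))"
      using fin IH by (intro finite_UN_I finite_imageI) auto
    ultimately have "finite (?E b)" by (rule finite_subset)
    moreover obtain i where i: "i < nvars I" "b i = None"
      using False all_determined_total by blast
    moreover obtain S0 where "evaluates_from I (b(i \<mapsto> False)) S0" using IH[of i False] i by auto
    moreover obtain S1 where "evaluates_from I (b(i \<mapsto> True)) S1" using IH[of i True] i by auto
    ultimately have "finite (?E b)" "evaluates_from I b (Test i S0 S1)" using False by auto
    then show ?thesis by blast
  qed
qed

lemma optimal_strategy_exists:
  "\<exists>S. evaluates I S \<and> expected_cost I S = opt_cost I \<and>
       (\<forall>S'. evaluates I S' \<longrightarrow> expected_cost I S \<le> expected_cost I S')"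
proof -
  let ?C = "expected_cost I ` {S. evaluates I S}"
  have fin: "finite ?C" "?C \<noteq> {}"
    using finite_nonempty_strategies_from[of I Map.empty] by (auto simp: evaluates_def)
  then have "opt_cost I = Min ?C"
    unfolding opt_cost_def by (rule cInf_eq_Min)
  then show ?thesis
    using Min_in[OF fin] Min_le[OF fin(1)] by fastforce
qed

section \<open>Polynomial-time algorithms\<close>

text \<open>
  Algorithms are written in a small while-language over binary trees with rational leaves, in the
  style of Jones's WHILE language. Constructing or inspecting a pair costs one step; an arithmetic
  operation is charged the bit length of its operands. With this logarithmic cost measure,
  polynomial time is the same as for Turing machines.
\<close>

datatype val = Num rat | Node val val

definition rat_bits :: "rat \<Rightarrow> nat" where
  "rat_bits r = (case quotient_of r of (a, b) \<Rightarrow> floorlog 2 (nat \<bar>a\<bar>) + floorlog 2 (nat b))"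

fun leaf_bits :: "val \<Rightarrow> nat" where
  "leaf_bits (Num r) = rat_bits r"
| "leaf_bits (Node _ _) = 0"

fun val_size :: "val \<Rightarrow> nat" where
  "val_size (Num r) = 1 + rat_bits r"
| "val_size (Node u v) = 1 + val_size u + val_size v"

datatype unop = Left | Right | IsNode

datatype binop = MkNode | Add | Sub | Mul | Div | Less

fun unop_val :: "unop \<Rightarrow> val \<Rightarrow> val" where
  "unop_val Left (Node u v) = u"
| "unop_val Right (Node u v) = v"
| "unop_val IsNode (Node u v) = Num 1"
| "unop_val _ (Num r) = Num 0"

fun binop_val :: "binop \<Rightarrow> val \<Rightarrow> val \<Rightarrow> val" where
  "binop_val MkNode u v = Node u v"
| "binop_val Add (Num a) (Num b) = Num (a + b)"
| "binop_val Sub (Num a) (Num b) = Num (a - b)"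
| "binop_val Mul (Num a) (Num b) = Num (a * b)"
| "binop_val Div (Num a) (Num b) = Num (a / b)"
| "binop_val Less (Num a) (Num b) = Num (of_bool (a < b))"
| "binop_val _ _ _ = Num 0"

fun binop_cost :: "binop \<Rightarrow> val \<Rightarrow> val \<Rightarrow> nat" where
  "binop_cost MkNode _ _ = 1"
| "binop_cost _ u v = 1 + leaf_bits u + leaf_bits v"

text \<open>
  Variables are de Bruijn indices into the environment. \<open>LetE e1 e2\<close> pushes the value of \<open>e1\<close>.
  \<open>WhileE c e\<close> keeps replacing the topmost entry of the environment by the value of \<open>e\<close> as long
  as \<open>c\<close> is not \<open>Num 0\<close>, and returns the final entry. \<open>TestE e\<close> tests the variable whose index is
  the value of \<open>e\<close>; it is the only access to the unknown assignment.
\<close>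

datatype exp =
    VarE nat
  | ConstE rat
  | UnE unop exp
  | BinE binop exp exp
  | LetE exp exp
  | IfE exp exp exp
  | WhileE exp exp
  | TestE exp

text \<open>
  \<open>run x \<rho> e v T t\<close>: on unknown assignment \<open>x\<close> and environment \<open>\<rho>\<close>, the expression \<open>e\<close>
  terminates with value \<open>v\<close> after \<open>t\<close> steps, having performed the tests \<open>T\<close>, in this order.
\<close>

inductive run :: "(nat \<Rightarrow> bool) \<Rightarrow> val list \<Rightarrow> exp \<Rightarrow> val \<Rightarrow> nat list \<Rightarrow> nat \<Rightarrow> bool"
  for x :: "nat \<Rightarrow> bool"
where
  VarE: "i < length \<rho> \<Longrightarrow> run x \<rho> (VarE i) (\<rho> ! i) [] 1"
| ConstE: "run x \<rho> (ConstE r) (Num r) [] 1"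
| UnE: "run x \<rho> e v T t \<Longrightarrow> run x \<rho> (UnE f e) (unop_val f v) T (t + 1)"
| BinE: "run x \<rho> e1 v1 T1 t1 \<Longrightarrow> run x \<rho> e2 v2 T2 t2 \<Longrightarrow>
    run x \<rho> (BinE f e1 e2) (binop_val f v1 v2) (T1 @ T2) (t1 + t2 + binop_cost f v1 v2)"
| LetE: "run x \<rho> e1 v1 T1 t1 \<Longrightarrow> run x (v1 # \<rho>) e2 v2 T2 t2 \<Longrightarrow>
    run x \<rho> (LetE e1 e2) v2 (T1 @ T2) (t1 + t2 + 1)"
| IfTrue: "run x \<rho> c u T1 t1 \<Longrightarrow> u \<noteq> Num 0 \<Longrightarrow> run x \<rho> e1 v T2 t2 \<Longrightarrow>
    run x \<rho> (IfE c e1 e2) v (T1 @ T2) (t1 + t2 + 1)"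
| IfFalse: "run x \<rho> c (Num 0) T1 t1 \<Longrightarrow> run x \<rho> e2 v T2 t2 \<Longrightarrow>
    run x \<rho> (IfE c e1 e2) v (T1 @ T2) (t1 + t2 + 1)"
| WhileTrue: "run x (v # \<rho>) c u T1 t1 \<Longrightarrow> u \<noteq> Num 0 \<Longrightarrow> run x (v # \<rho>) e v' T2 t2 \<Longrightarrow>
    run x (v' # \<rho>) (WhileE c e) w T3 t3 \<Longrightarrow>
    run x (v # \<rho>) (WhileE c e) w (T1 @ T2 @ T3) (t1 + t2 + t3 + 1)"
| WhileFalse: "run x (v # \<rho>) c (Num 0) T t \<Longrightarrow> run x (v # \<rho>) (WhileE c e) v T (t + 1)"
| TestE: "run x \<rho> e (Num (of_nat i)) T t \<Longrightarrow>
    run x \<rho> (TestE e) (Num (of_bool (x i))) (T @ [i]) (t + rat_bits (of_nat i) + 1)"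

inductive_cases run_VarE: "run x \<rho> (VarE i) v T t"
inductive_cases run_ConstE: "run x \<rho> (ConstE r) v T t"
inductive_cases run_UnE: "run x \<rho> (UnE f e) v T t"
inductive_cases run_BinE: "run x \<rho> (BinE f e1 e2) v T t"
inductive_cases run_LetE: "run x \<rho> (LetE e1 e2) v T t"
inductive_cases run_IfE: "run x \<rho> (IfE c e1 e2) v T t"
inductive_cases run_WhileE: "run x \<rho> (WhileE c e) v T t"
inductive_cases run_TestE: "run x \<rho> (TestE e) v T t"

lemma run_deterministic:
  "run x \<rho> e v T t \<Longrightarrow> run x \<rho> e v' T' t' \<Longrightarrow> v' = v \<and> T' = T \<and> t' = t"
proof (induction arbitrary: v' T' t' rule: run.induct)
  case VarE then show ?case by (auto elim: run_VarE)
next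
  case ConstE then show ?case by (auto elim: run_ConstE)
next
  case UnE from UnE.prems show ?case by (rule run_UnE) (auto dest: UnE.IH)
next
  case BinE from BinE.prems show ?case by (rule run_BinE) (auto dest: BinE.IH)
next
  case LetE from LetE.prems show ?case
    by (rule run_LetE) (use LetE.IH in \<open>metis Suc_eq_plus1\<close>)
next
  case IfTrue from IfTrue.prems show ?case
    by (rule run_IfE) (use IfTrue.IH IfTrue.hyps in \<open>metis Suc_eq_plus1\<close>)+
next
  case IfFalse from IfFalse.prems show ?case
    by (rule run_IfE) (use IfFalse.IH in \<open>metis Suc_eq_plus1\<close>)+
next
  case WhileTrue from WhileTrue.prems show ?case
    by (rule run_WhileE) (use WhileTrue.IH WhileTrue.hyps in \<open>metis list.inject Suc_eq_plus1\<close>)+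
next
  case WhileFalse from WhileFalse.prems show ?case
    by (rule run_WhileE) (use WhileFalse.IH in \<open>metis list.inject Suc_eq_plus1\<close>)+
next
  case (TestE \<rho> e i T t)
  from TestE.prems obtain j T'' t'' where *: "v' = Num (of_bool (x j))" "T' = T'' @ [j]"
      "t' = t'' + rat_bits (rat_of_nat j) + 1" "run x \<rho> e (Num (rat_of_nat j)) T'' t''"
    by (auto elim: run_TestE)
  from TestE.IH[OF *(4)] have "j = i" "T'' = T" "t'' = t" by auto
  then show ?case using * by simp
qed

fun encode_list :: "val list \<Rightarrow> val" where
  "encode_list [] = Num 0"
| "encode_list (v # vs) = Node v (encode_list vs)"

definition encode_instance :: "ltf_instance \<Rightarrow> val" where
  "encode_instance I = encode_list
     [Num (of_nat (nvars I)),
      Num (of_nat (nforms I)),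
      encode_list (map (\<lambda>k. encode_list (map (\<lambda>i. Num (of_int (coef I k i))) [0..<nvars I]))
                       [0..<nforms I]),
      encode_list (map (\<lambda>k. Num (of_int (thr I k))) [0..<nforms I]),
      encode_list (map (\<lambda>i. Num (prob I i)) [0..<nvars I]),
      encode_list (map (\<lambda>i. Num (cost I i)) [0..<nvars I])]"

definition encode_answer :: "ltf_instance \<Rightarrow> (nat \<Rightarrow> bool) \<Rightarrow> val" where
  "encode_answer I x = encode_list (map (\<lambda>k. Num (of_bool (formula_value I k x))) [0..<nforms I])"

text \<open>
  An algorithm is identified with the function \<open>A\<close> that maps an instance to the strategy followed
  on it. It is polynomial-time if one program, given the encoded instance and the possibility of
  testing variables, performs exactly the tests of \<open>A I\<close> on every unknown \<open>x\<close> and then outputs all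
  values \<open>f\<^sub>k(x)\<close>, in total time polynomial in the bit length of the instance.
\<close>

definition poly_time_algorithm :: "(ltf_instance \<Rightarrow> strategy) \<Rightarrow> bool" where
  "poly_time_algorithm A \<longleftrightarrow>
     (\<forall>I. wf_instance I \<longrightarrow> evaluates I (A I)) \<and>
     (\<exists>P. \<exists>q :: nat poly. \<forall>I x. wf_instance I \<longrightarrow>
        (\<exists>t \<le> poly q (val_size (encode_instance I)).
           run x [encode_instance I] P (encode_answer I x) (tests (A I) x) t))"

end

theory Submission
  imports Defs
begin

text \<open>
  For a partial assignment \<open>b\<close> let \<open>lo\<^sub>k(b)\<close> and \<open>hi\<^sub>k(b)\<close> be the least and the greatest value of the
  \<open>k\<close>-th linear form over all extensions of \<open>b\<close>. The residual
  \<open>\<Sum>\<^sub>k max 0 (\<theta>\<^sub>k - lo\<^sub>k(b)) * max 0 (hi\<^sub>k(b) - \<theta>\<^sub>k + 1)\<close> is a nonnegative integer, it vanishes iff all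
  formulas are determined, and its decrease under one more test only shrinks when \<open>b\<close> grows.

  For (a), greedily test a variable that minimises the price, i.e. its cost divided by the expected
  decrease of the residual. Prices do not decrease along a run. Weighting the price increases by the
  residual gives a quantity with expectation equal to the cost of the greedy strategy. On every input
  it is bounded by the sum, over the variables tested by any other strategy, of the price increases
  weighted by the decrease that this variable would cause. Such a sum is at most
  \<open>c\<^sub>i (1 + ln P) / Pr[x\<^sub>i]\<close>, where \<open>P\<close> bounds the decrease caused by a single test, and averaging over
  the two values of \<open>x\<^sub>i\<close>, which do not influence whether \<open>i\<close> is tested, gives the factor \<open>2 (1 + ln P)\<close>.
  Here \<open>P \<le> (\<Sum>\<^sub>k D\<^sub>k)\<^sup>2\<close> in general and \<open>P \<le> \<beta>\<^sub>m\<^sub>a\<^sub>x r\<close> for OR formulas.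

  For (b), every certificate of an undetermined formula must contain one of its untested variables.
  So lower the costs of these at most \<open>D\<^sub>m\<^sub>a\<^sub>x\<close> variables uniformly until one of them becomes free, and
  test that one: each unit of reduction costs at most \<open>D\<^sub>m\<^sub>a\<^sub>x\<close> and is paid for by every other strategy.
\<close>

subsection \<open>Bit lengths of rationals\<close>

text \<open>The claim is about programs with a step count, so an analysis of the two rules alone
  does not suffice. The cost bounds are proved for every decision tree that satisfies the predicate
  \<open>greedy_tree\<close> or \<open>local_ratio_tree\<close>, whatever its tie-breaking. The
  algorithm itself is by definition the unfolding of a program's loop, so its tests agree with those
  of the program by construction, and only the choice made in one iteration has to be matched with
  the predicate. Running times are composed from functions in \<open>ptime\<close>, which bound the
  size of the result besides the time. Size is the obstacle in iterations: repeated rational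
  arithmetic can double the bit length at every step. Sums are controlled by tracking numerators and
  denominators separately, the reduced costs of (b) by a common denominator fixed in advance.
  Integrality of the residual matters as well: a nonzero decrease is at least 1, which keeps the
  logarithms nonnegative.\<close>

lemma floorlog2_le_iff: "floorlog 2 x \<le> w \<longleftrightarrow> x < 2 ^ w"
  by (simp add: floorlog_le_iff)

lemma less_two_pow_floorlog: "x < 2 ^ floorlog 2 x"
  using floorlog2_le_iff by blast

lemma floorlog2_mult_le: "floorlog 2 (x * y) \<le> floorlog 2 x + floorlog 2 y"
  unfolding floorlog2_le_iff power_add
  by (intro mult_strict_mono less_two_pow_floorlog) auto

lemma floorlog2_add_le: "floorlog 2 (x + y) \<le> max (floorlog 2 x) (floorlog 2 y) + 1"
proof -
  have "x < 2 ^ max (floorlog 2 x) (floorlog 2 y)" "y < 2 ^ max (floorlog 2 x) (floorlog 2 y)"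
    by (auto intro: less_le_trans[OF less_two_pow_floorlog])
  then show ?thesis
    unfolding floorlog2_le_iff by simp
qed

lemma floorlog2_le_self: "floorlog 2 x \<le> x"
  unfolding floorlog2_le_iff by (rule less_exp)

text \<open>Numerator and denominator are measured separately because addition merely adds the
  denominator lengths. The bound for \<open>rat_bits\<close> of a sum doubles, which would be
  exponential along an iterated sum.\<close>

definition numer_bits :: "rat \<Rightarrow> nat" where
  "numer_bits r = floorlog 2 (nat \<bar>fst (quotient_of r)\<bar>)"

definition denom_bits :: "rat \<Rightarrow> nat" where
  "denom_bits r = floorlog 2 (nat (snd (quotient_of r)))"

lemma rat_bits_eq: "rat_bits r = numer_bits r + denom_bits r"
  by (simp add: rat_bits_def numer_bits_def denom_bits_def split_beta)

lemma rat_eq_quotient: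
  obtains a b where "r = of_int a / of_int b" "b > 0" "coprime a b"
    "numer_bits r = floorlog 2 (nat \<bar>a\<bar>)" "denom_bits r = floorlog 2 (nat \<bar>b\<bar>)"
proof -
  obtain a b where q: "quotient_of r = (a, b)" by fastforce
  show ?thesis
    using that[of a b] quotient_of_denom_pos[OF q] quotient_of_coprime[OF q] quotient_of_div[OF q] q
    by (simp add: numer_bits_def denom_bits_def)
qed

text \<open>Cross-multiplication and coprimality make the reduced numerator and denominator divisors
  of the given ones. Every fraction that represents \<open>r\<close> therefore bounds its lengths,
  and results of arithmetic need not be reduced.\<close>

lemma quotient_bits_le:
  assumes "r = of_int a / of_int b" "b \<noteq> 0"
  shows "numer_bits r \<le> floorlog 2 (nat \<bar>a\<bar>)" "denom_bits r \<le> floorlog 2 (nat \<bar>b\<bar>)"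
proof -
  obtain p s where q: "r = of_int p / of_int s" "s > 0" "coprime p s"
    "numer_bits r = floorlog 2 (nat \<bar>p\<bar>)" "denom_bits r = floorlog 2 (nat \<bar>s\<bar>)"
    by (rule rat_eq_quotient)
  have "of_int (p * b) = (of_int (a * s) :: rat)"
    using assms q(1,2) by (simp add: field_simps)
  then have eq: "p * b = a * s" by linarith
  have "s dvd b"
    using q(3) eq by (metis coprime_commute coprime_dvd_mult_right_iff dvd_triv_right)
  then have "\<bar>s\<bar> \<le> \<bar>b\<bar>" using assms(2) by (rule dvd_imp_le_int[rotated])
  then show "denom_bits r \<le> floorlog 2 (nat \<bar>b\<bar>)"
    unfolding q(5) by (intro floorlog_mono) simp
  have "p dvd a"
    using q(3) eq by (metis coprime_dvd_mult_left_iff dvd_triv_left)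
  then have "\<bar>p\<bar> \<le> \<bar>a\<bar>"
    using eq assms(2) by (cases "a = 0") (auto intro: dvd_imp_le_int)
  then show "numer_bits r \<le> floorlog 2 (nat \<bar>a\<bar>)"
    unfolding q(4) by (intro floorlog_mono) simp
qed

lemma nat_abs_mult: "nat \<bar>a * b\<bar> = nat \<bar>a\<bar> * nat \<bar>b\<bar>" for a b :: int
  by (simp add: abs_mult nat_mult_distrib)

lemma bits_add:
  "numer_bits (r + s) \<le> max (numer_bits r + denom_bits s) (numer_bits s + denom_bits r) + 1"
  "denom_bits (r + s) \<le> denom_bits r + denom_bits s"
proof -
  obtain a b where r: "r = of_int a / of_int b" "b > 0"
    "numer_bits r = floorlog 2 (nat \<bar>a\<bar>)" "denom_bits r = floorlog 2 (nat \<bar>b\<bar>)"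
    by (rule rat_eq_quotient)
  obtain c d where s: "s = of_int c / of_int d" "d > 0"
    "numer_bits s = floorlog 2 (nat \<bar>c\<bar>)" "denom_bits s = floorlog 2 (nat \<bar>d\<bar>)"
    by (rule rat_eq_quotient)
  have eq: "r + s = of_int (a * d + c * b) / of_int (b * d)" and nz: "b * d \<noteq> 0"
    using r(1,2) s(1,2) by (auto simp: field_simps)
  have "numer_bits (r + s) \<le> floorlog 2 (nat \<bar>a * d + c * b\<bar>)"
    by (rule quotient_bits_le(1)[OF eq nz])
  also have "\<dots> \<le> floorlog 2 (nat \<bar>a * d\<bar> + nat \<bar>c * b\<bar>)"
    by (intro floorlog_mono) linarith
  also have "\<dots> \<le> max (floorlog 2 (nat \<bar>a * d\<bar>)) (floorlog 2 (nat \<bar>c * b\<bar>)) + 1"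
    by (rule floorlog2_add_le)
  also have "\<dots> \<le> max (numer_bits r + denom_bits s) (numer_bits s + denom_bits r) + 1"
    unfolding r(3,4) s(3,4) nat_abs_mult
    by (intro add_right_mono max.mono floorlog2_mult_le)
  finally show "numer_bits (r + s) \<le> max (numer_bits r + denom_bits s) (numer_bits s + denom_bits r) + 1" .
  show "denom_bits (r + s) \<le> denom_bits r + denom_bits s"
    using quotient_bits_le(2)[OF eq nz] floorlog2_mult_le[of "nat \<bar>b\<bar>" "nat \<bar>d\<bar>"]
    unfolding r(4) s(4) nat_abs_mult by linarith
qed

lemma bits_uminus: "numer_bits (- r) = numer_bits r" "denom_bits (- r) = denom_bits r"
  by (simp_all add: numer_bits_def denom_bits_def rat_uminus_code split_beta)

lemma bits_mult:
  "numer_bits (r * s) \<le> numer_bits r + numer_bits s"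
  "denom_bits (r * s) \<le> denom_bits r + denom_bits s"
proof -
  obtain a b where r: "r = of_int a / of_int b" "b > 0"
    "numer_bits r = floorlog 2 (nat \<bar>a\<bar>)" "denom_bits r = floorlog 2 (nat \<bar>b\<bar>)"
    by (rule rat_eq_quotient)
  obtain c d where s: "s = of_int c / of_int d" "d > 0"
    "numer_bits s = floorlog 2 (nat \<bar>c\<bar>)" "denom_bits s = floorlog 2 (nat \<bar>d\<bar>)"
    by (rule rat_eq_quotient)
  have eq: "r * s = of_int (a * c) / of_int (b * d)" and nz: "b * d \<noteq> 0"
    using r(1,2) s(1,2) by (auto simp: field_simps)
  show "numer_bits (r * s) \<le> numer_bits r + numer_bits s"
    using quotient_bits_le(1)[OF eq nz] floorlog2_mult_le[of "nat \<bar>a\<bar>" "nat \<bar>c\<bar>"]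
    unfolding r(3) s(3) nat_abs_mult by linarith
  show "denom_bits (r * s) \<le> denom_bits r + denom_bits s"
    using quotient_bits_le(2)[OF eq nz] floorlog2_mult_le[of "nat \<bar>b\<bar>" "nat \<bar>d\<bar>"]
    unfolding r(4) s(4) nat_abs_mult by linarith
qed

lemma bits_0_1 [simp]: "numer_bits 0 = 0" "denom_bits 0 = 1" "numer_bits 1 = 1" "denom_bits 1 = 1"
  by (simp_all add: numer_bits_def denom_bits_def floorlog_def)

lemma denom_bits_pos: "denom_bits r \<ge> 1"
proof -
  obtain a b where "b > 0" "denom_bits r = floorlog 2 (nat \<bar>b\<bar>)"
    by (rule rat_eq_quotient[of r])
  then show ?thesis by (simp add: floorlog_def)
qed

lemma bits_inverse: "rat_bits (inverse r) \<le> rat_bits r + 1"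
proof -
  obtain a b where r: "r = of_int a / of_int b" "b > 0"
    "numer_bits r = floorlog 2 (nat \<bar>a\<bar>)" "denom_bits r = floorlog 2 (nat \<bar>b\<bar>)"
    by (rule rat_eq_quotient)
  show ?thesis
  proof (cases "a = 0")
    case True then show ?thesis using r(1) by (simp add: rat_bits_eq)
  next
    case False
    have "inverse r = of_int b / of_int a" using r(1) by simp
    from quotient_bits_le[OF this False] show ?thesis by (simp add: rat_bits_eq r(3,4))
  qed
qed

lemma rat_bits_arith:
  "rat_bits (r + s) \<le> 2 * (rat_bits r + rat_bits s) + 1"
  "rat_bits (r - s) \<le> 2 * (rat_bits r + rat_bits s) + 1"
  "rat_bits (r * s) \<le> rat_bits r + rat_bits s"
  "rat_bits (r / s) \<le> rat_bits r + rat_bits s + 1"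
  "rat_bits (of_bool P) \<le> 2"
  subgoal using bits_add[of r s] by (simp add: rat_bits_eq)
  subgoal using bits_add[of r "- s"] by (simp add: rat_bits_eq bits_uminus)
  subgoal using bits_mult[of r s] by (simp add: rat_bits_eq)
  subgoal using bits_mult[of r "inverse s"] bits_inverse[of s]
    by (simp add: rat_bits_eq divide_inverse)
  subgoal by (simp add: rat_bits_eq)
  done

lemma rat_bits_of_nat: "rat_bits (of_nat n) \<le> n + 1"
  using floorlog2_le_self[of n] quotient_bits_le[of "of_nat n" "int n" 1]
  by (simp add: rat_bits_eq floorlog_def)

subsection \<open>Polynomial-time computable functions on values\<close>

abbreviation vleft :: "val \<Rightarrow> val" where "vleft \<equiv> unop_val Left"
abbreviation vright :: "val \<Rightarrow> val" where "vright \<equiv> unop_val Right"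

text \<open>Total on values, with any number ending the list, so that time bounds hold on all inputs
  and not only on encodings.\<close>

fun decode_list :: "val \<Rightarrow> val list" where
  "decode_list (Num r) = []"
| "decode_list (Node u v) = u # decode_list v"

lemma decode_encode_list [simp]: "decode_list (encode_list xs) = xs"
  by (induction xs) auto

lemma val_size_pos [simp]: "val_size v > 0"
  by (cases v) auto

lemma val_size_ge_2: "val_size v \<ge> 2"
proof (cases v)
  case (Num r)
  then show ?thesis using denom_bits_pos[of r] by (simp add: rat_bits_eq)
next
  case (Node u w)
  then show ?thesis using val_size_pos[of u] val_size_pos[of w] by (simp del: val_size_pos)
qed

lemma leaf_bits_le: "leaf_bits v \<le> val_size v"
  by (cases v) auto

lemma val_size_encode_list: "val_size (encode_list xs) = 2 + (\<Sum>x\<leftarrow>xs. val_size x + 1)"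
  by (induction xs) (auto simp: rat_bits_eq)

lemma val_size_decode_list: "(\<Sum>x\<leftarrow>decode_list v. val_size x + 1) \<le> val_size v"
  by (induction v) auto

lemma length_decode_list_le: "length (decode_list v) \<le> val_size v"
  by (induction v) auto

lemma mem_decode_list_size: "u \<in> set (decode_list v) \<Longrightarrow> val_size u \<le> val_size v"
  by (induction v) auto

lemma val_size_encode_list_le:
  assumes "\<And>x. x \<in> set xs \<Longrightarrow> val_size x \<le> B"
  shows "val_size (encode_list xs) \<le> 2 + length xs * (B + 1)"
proof -
  have "(\<Sum>x\<leftarrow>xs. val_size x + 1) \<le> (\<Sum>x\<leftarrow>xs. B + 1)"
    using assms by (intro sum_list_mono) auto
  then show ?thesis by (simp add: val_size_encode_list sum_list_triv)
qed

lemma poly_nat_mono: "x \<le> y \<Longrightarrow> poly (q :: nat poly) x \<le> poly q y"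
  by (induction q) (auto intro: add_mono mult_mono)

section \<open>Polynomial bounds in the size of a value, and evaluation without tests\<close>

definition poly_bounded :: "(val \<Rightarrow> nat) \<Rightarrow> bool" where
  "poly_bounded g \<longleftrightarrow> (\<exists>q :: nat poly. \<forall>v. g v \<le> poly q (val_size v))"

named_theorems pb_intros

lemma poly_bounded_mono: "poly_bounded g \<Longrightarrow> (\<And>v. f v \<le> g v) \<Longrightarrow> poly_bounded f"
  unfolding poly_bounded_def by (meson le_trans)

lemma poly_bounded_const [pb_intros]: "poly_bounded (\<lambda>_. c)"
  unfolding poly_bounded_def by (rule exI[of _ "[:c:]"]) simp

lemma poly_bounded_size [pb_intros]: "poly_bounded val_size"
  unfolding poly_bounded_def by (rule exI[of _ "[:0, 1:]"]) simp

lemma poly_bounded_add [pb_intros]: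
  "poly_bounded f \<Longrightarrow> poly_bounded g \<Longrightarrow> poly_bounded (\<lambda>v. f v + g v)"
  unfolding poly_bounded_def by (metis add_mono poly_add)

lemma poly_bounded_mult [pb_intros]:
  "poly_bounded f \<Longrightarrow> poly_bounded g \<Longrightarrow> poly_bounded (\<lambda>v. f v * g v)"
  unfolding poly_bounded_def by (metis mult_mono poly_mult zero_le)

lemma poly_bounded_poly [pb_intros]:
  "poly_bounded f \<Longrightarrow> poly_bounded (\<lambda>v. poly q (f v))"
  unfolding poly_bounded_def by (metis poly_pcompose poly_nat_mono)

text \<open>The exact step count of \<open>run\<close> is relaxed to an upper bound, so that
  branches of different length can share one. The list of tests is empty because all computation
  between two tests is composed from such evaluations.\<close>

definition runs :: "(nat \<Rightarrow> bool) \<Rightarrow> val list \<Rightarrow> exp \<Rightarrow> val \<Rightarrow> nat \<Rightarrow> bool" where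
  "runs x \<rho> e v t \<longleftrightarrow> (\<exists>t'\<le>t. run x \<rho> e v [] t')"

lemma runs_mono: "runs x \<rho> e v t \<Longrightarrow> t \<le> t' \<Longrightarrow> runs x \<rho> e v t'"
  unfolding runs_def by (meson le_trans)

lemma runsI: "run x \<rho> e v [] t \<Longrightarrow> t \<le> t' \<Longrightarrow> runs x \<rho> e v t'"
  unfolding runs_def by blast

lemma runsE:
  assumes "runs x \<rho> e v t"
  obtains t' where "run x \<rho> e v [] t'" "t' \<le> t"
  using assms unfolding runs_def by blast

lemma runs_Var: "i < length \<rho> \<Longrightarrow> runs x \<rho> (VarE i) (\<rho> ! i) 1"
  by (rule runsI[OF run.VarE]) auto

lemma runs_Var0: "runs x (v # \<rho>) (VarE 0) v 1"
  using runs_Var[of 0 "v # \<rho>" x] by simp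

lemma runs_Const: "runs x \<rho> (ConstE r) (Num r) 1"
  by (rule runsI[OF run.ConstE]) auto

lemma runs_Un: "runs x \<rho> e v t \<Longrightarrow> runs x \<rho> (UnE f e) (unop_val f v) (t + 1)"
  by (elim runsE, rule runsI[OF run.UnE]) auto

lemma runs_Bin:
  assumes "runs x \<rho> e1 v1 t1" "runs x \<rho> e2 v2 t2"
  shows "runs x \<rho> (BinE f e1 e2) (binop_val f v1 v2) (t1 + t2 + binop_cost f v1 v2)"
  using assms by (elim runsE, intro runsI[OF run.BinE[where ?T1.0 = "[]" and ?T2.0 = "[]", simplified]]) auto

lemma runs_Node:
  assumes "runs x \<rho> e1 v1 t1" "runs x \<rho> e2 v2 t2"
  shows "runs x \<rho> (BinE MkNode e1 e2) (Node v1 v2) (t1 + t2 + 1)"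
  using runs_Bin[OF assms, of MkNode] by simp

lemma runs_Let:
  assumes "runs x \<rho> e1 v1 t1" "runs x (v1 # \<rho>) e2 v2 t2"
  shows "runs x \<rho> (LetE e1 e2) v2 (t1 + t2 + 1)"
  using assms by (elim runsE, intro runsI[OF run.LetE[where ?T1.0 = "[]" and ?T2.0 = "[]", simplified]]) auto

lemma runs_If:
  assumes "runs x \<rho> c u t1" "u \<noteq> Num 0 \<Longrightarrow> runs x \<rho> e1 v t2" "u = Num 0 \<Longrightarrow> runs x \<rho> e2 v t2"
  shows "runs x \<rho> (IfE c e1 e2) v (t1 + t2 + 1)"
proof (cases "u = Num 0")
  case True
  from assms(1) assms(3)[OF True] show ?thesis unfolding True
    by (elim runsE, intro runsI[OF run.IfFalse[where ?T1.0 = "[]" and ?T2.0 = "[]", simplified]]) auto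
next
  case False
  from assms(1) assms(2)[OF False] False show ?thesis
    by (elim runsE, intro runsI[OF run.IfTrue[where ?T1.0 = "[]" and ?T2.0 = "[]", simplified]]) auto
qed

lemma runs_While_step:
  assumes "runs x (v # \<rho>) c u t1" "u \<noteq> Num 0" "runs x (v # \<rho>) e v' t2"
    "runs x (v' # \<rho>) (WhileE c e) w t3"
  shows "runs x (v # \<rho>) (WhileE c e) w (t1 + t2 + t3 + 1)"
  using assms
  by (elim runsE, intro runsI[OF run.WhileTrue[where ?T1.0 = "[]" and ?T2.0 = "[]" and ?T3.0 = "[]", simplified]]) auto

lemma runs_While_stop:
  assumes "runs x (v # \<rho>) c (Num 0) t"
  shows "runs x (v # \<rho>) (WhileE c e) v (t + 1)"
  using assms by (elim runsE, intro runsI[OF run.WhileFalse]) auto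

text \<open>The bound on the size of the result does not follow from the bound on the running time,
  because copying a value costs one step whatever its size.\<close>

definition ptime :: "(val \<Rightarrow> val) \<Rightarrow> bool" where
  "ptime f \<longleftrightarrow> poly_bounded (\<lambda>v. val_size (f v)) \<and>
     (\<exists>e g. poly_bounded g \<and> (\<forall>x v \<rho>. runs x (v # \<rho>) e (f v) (g v)))"

lemma ptimeI:
  assumes "poly_bounded (\<lambda>v. val_size (f v))" "poly_bounded g"
    "\<And>x v \<rho>. runs x (v # \<rho>) e (f v) (g v)"
  shows "ptime f"
  using assms unfolding ptime_def by blast

lemma ptimeE:
  assumes "ptime f"
  obtains g e where "poly_bounded g" "\<And>x v \<rho>. runs x (v # \<rho>) e (f v) (g v)"
  using assms unfolding ptime_def by blast

lemma ptime_size [pb_intros]: "ptime f \<Longrightarrow> poly_bounded (\<lambda>v. val_size (f v))"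
  unfolding ptime_def by blast

lemma poly_bounded_compose:
  "poly_bounded g \<Longrightarrow> poly_bounded (\<lambda>v. val_size (f v)) \<Longrightarrow> poly_bounded (\<lambda>v. g (f v))"
  unfolding poly_bounded_def by (metis poly_pcompose poly_nat_mono le_trans)

named_theorems ptime_intros

lemma ptime_id [ptime_intros]: "ptime (\<lambda>v. v)"
  by (rule ptimeI[OF _ poly_bounded_const[of 1], of _ "VarE 0"])
    (use runs_Var0 in \<open>auto intro: pb_intros\<close>)

lemma ptime_const [ptime_intros]: "ptime (\<lambda>v. Num r)"
  by (rule ptimeI[OF _ poly_bounded_const[of 1], of _ "ConstE r"])
    (use runs_Const in \<open>auto intro: pb_intros\<close>)

lemma ptime_compose:
  assumes "ptime g" "ptime f"
  shows "ptime (\<lambda>v. g (f v))"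
proof -
  obtain e1 t1 where f: "poly_bounded t1" "\<And>x v \<rho>. runs x (v # \<rho>) e1 (f v) (t1 v)"
    by (rule ptimeE[OF assms(2)]) (rule that)
  obtain e2 t2 where g: "poly_bounded t2" "\<And>x v \<rho>. runs x (v # \<rho>) e2 (g v) (t2 v)"
    by (rule ptimeE[OF assms(1)]) (rule that)
  show ?thesis
  proof (rule ptimeI)
    show "runs x (v # \<rho>) (LetE e1 e2) (g (f v)) (t1 v + t2 (f v) + 1)" for x v \<rho>
      by (rule runs_Let[OF f(2) g(2)])
    show "poly_bounded (\<lambda>v. t1 v + t2 (f v) + 1)"
      using f(1) poly_bounded_compose[OF g(1) ptime_size[OF assms(2)]] by (intro pb_intros)
    show "poly_bounded (\<lambda>v. val_size (g (f v)))"
      by (rule poly_bounded_compose[OF ptime_size ptime_size]) fact+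
  qed
qed

lemma val_size_unop_le: "val_size (unop_val f v) \<le> val_size v + 3"
  by (cases v; cases f) (auto simp: rat_bits_eq)

lemma val_size_binop_le: "val_size (binop_val f u v) \<le> 2 * (val_size u + val_size v) + 4"
proof (cases "f \<noteq> MkNode \<and> (\<exists>r s. u = Num r \<and> v = Num s)")
  case True
  then obtain r s where rs: "u = Num r" "v = Num s" "f \<noteq> MkNode" by blast
  show ?thesis using rat_bits_arith(1-4)[of r s] rat_bits_arith(5)[of "r < s"] rs(3)
    by (cases f) (auto simp: rs(1,2))
next
  case False
  then show ?thesis
    by (cases f; cases u; cases v) (auto simp: rat_bits_eq)
qed

lemma ptime_unop [ptime_intros]:
  assumes "ptime f" shows "ptime (\<lambda>v. unop_val op (f v))"
proof -
  obtain e1 t1 where f: "poly_bounded t1" "\<And>x v \<rho>. runs x (v # \<rho>) e1 (f v) (t1 v)"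
    by (rule ptimeE[OF assms(1)]) (rule that)
  show ?thesis
  proof (rule ptimeI)
    show "runs x (v # \<rho>) (UnE op e1) (unop_val op (f v)) (t1 v + 1)" for x v \<rho>
      by (rule runs_Un[OF f(2)])
    show "poly_bounded (\<lambda>v. t1 v + 1)"
      using f(1) by (intro pb_intros)
    show "poly_bounded (\<lambda>v. val_size (unop_val op (f v)))"
      by (rule poly_bounded_mono[OF _ val_size_unop_le]) (intro pb_intros assms)
  qed
qed

lemma ptime_binop [ptime_intros]:
  assumes "ptime f" "ptime g"
  shows "ptime (\<lambda>v. binop_val op (f v) (g v))"
proof -
  obtain e1 t1 where f: "poly_bounded t1" "\<And>x v \<rho>. runs x (v # \<rho>) e1 (f v) (t1 v)"
    by (rule ptimeE[OF assms(1)]) (rule that)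
  obtain e2 t2 where g: "poly_bounded t2" "\<And>x v \<rho>. runs x (v # \<rho>) e2 (g v) (t2 v)"
    by (rule ptimeE[OF assms(2)]) (rule that)
  have cost: "binop_cost op u v \<le> 1 + val_size u + val_size v" for u v
    using leaf_bits_le[of u] leaf_bits_le[of v] by (cases op) auto
  show ?thesis
  proof (rule ptimeI)
    show "runs x (v # \<rho>) (BinE op e1 e2) (binop_val op (f v) (g v))
        (t1 v + t2 v + (1 + val_size (f v) + val_size (g v)))" for x v \<rho>
      by (rule runs_mono[OF runs_Bin[OF f(2) g(2)]]) (intro add_left_mono cost)
    show "poly_bounded (\<lambda>v. t1 v + t2 v + (1 + val_size (f v) + val_size (g v)))"
      using f(1) g(1) by (intro pb_intros assms)
    show "poly_bounded (\<lambda>v. val_size (binop_val op (f v) (g v)))"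
      by (rule poly_bounded_mono[OF _ val_size_binop_le]) (intro pb_intros assms)
  qed
qed

lemma ptime_Node [ptime_intros]: "ptime f \<Longrightarrow> ptime g \<Longrightarrow> ptime (\<lambda>v. Node (f v) (g v))"
  using ptime_binop[of f g MkNode] by simp

lemma ptime_if [ptime_intros]:
  assumes "ptime c" "ptime f" "ptime g"
  shows "ptime (\<lambda>v. if c v \<noteq> Num 0 then f v else g v)"
proof -
  obtain e0 t0 where c: "poly_bounded t0" "\<And>x v \<rho>. runs x (v # \<rho>) e0 (c v) (t0 v)"
    by (rule ptimeE[OF assms(1)]) (rule that)
  obtain e1 t1 where f: "poly_bounded t1" "\<And>x v \<rho>. runs x (v # \<rho>) e1 (f v) (t1 v)"
    by (rule ptimeE[OF assms(2)]) (rule that)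
  obtain e2 t2 where g: "poly_bounded t2" "\<And>x v \<rho>. runs x (v # \<rho>) e2 (g v) (t2 v)"
    by (rule ptimeE[OF assms(3)]) (rule that)
  show ?thesis
  proof (rule ptimeI)
    show "runs x (v # \<rho>) (IfE e0 e1 e2) (if c v \<noteq> Num 0 then f v else g v)
        (t0 v + (t1 v + t2 v) + 1)" for x v \<rho>
      by (rule runs_If[OF c(2)]) (auto intro: runs_mono[OF f(2)] runs_mono[OF g(2)])
    show "poly_bounded (\<lambda>v. t0 v + (t1 v + t2 v) + 1)"
      using c(1) f(1) g(1) by (intro pb_intros assms)
    have "poly_bounded (\<lambda>v. val_size (f v) + val_size (g v))" by (intro pb_intros assms)
    then show "poly_bounded (\<lambda>v. val_size (if c v \<noteq> Num 0 then f v else g v))"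
      by (rule poly_bounded_mono) auto
  qed
qed

text \<open>A step function in polynomial time may still multiply the size of the accumulator each
  time, so a bound on every intermediate value is demanded, one for each prefix \<open>xs\<close> of
  the list. The loop state is \<open>Node rest (Node v accumulator)\<close>; carrying
  \<open>v\<close> along makes the body a function of the state alone.\<close>

lemma ptime_foldl:
  assumes F: "ptime (\<lambda>w. F (vleft (vleft w)) (vright (vleft w)) (vright w))"
    and i: "ptime i" and L: "ptime L" and g: "poly_bounded g"
    and size: "\<And>v xs ys. decode_list (L v) = xs @ ys \<Longrightarrow> val_size (foldl (F v) (i v) xs) \<le> g v"
  shows "ptime (\<lambda>v. foldl (F v) (i v) (decode_list (L v)))"
proof -
  define F' where "F' = (\<lambda>w. F (vleft (vleft w)) (vright (vleft w)) (vright w))"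
  have F': "ptime F'" using F unfolding F'_def .
  obtain eF tF where eF: "poly_bounded tF" "\<And>x v \<rho>. runs x (v # \<rho>) eF (F' v) (tF v)"
    by (rule ptimeE[OF F']) (rule that)
  obtain ei ti where ei: "poly_bounded ti" "\<And>x v \<rho>. runs x (v # \<rho>) ei (i v) (ti v)"
    by (rule ptimeE[OF i]) (rule that)
  obtain eL tL where eL: "poly_bounded tL" "\<And>x v \<rho>. runs x (v # \<rho>) eL (L v) (tL v)"
    by (rule ptimeE[OF L]) (rule that)
  obtain qF where qF: "\<And>v. tF v \<le> poly qF (val_size v)"
    using eF(1) unfolding poly_bounded_def by blast
  define c where "c = UnE IsNode (UnE Left (VarE 0))"
  define body where "body = BinE MkNode (UnE Right (UnE Left (VarE 0)))
     (BinE MkNode (UnE Left (UnE Right (VarE 0)))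
        (LetE (BinE MkNode (UnE Right (VarE 0)) (UnE Left (UnE Left (VarE 0)))) eF))"
  \<comment> \<open>One iteration takes 3 steps for the condition, at most 15 plus \<open>tF\<close>
    for the body and 1 for the loop itself; 20 covers the constants. The argument of
    \<open>qF\<close> bounds the size of \<open>Node (Node v accumulator) element\<close>.\<close>
  define K where "K v = 20 + poly qF (2 + val_size v + g v + val_size (L v))" for v
  have loop: "\<exists>r. runs x (Node l (Node v (foldl (F v) (i v) xs)) # \<rho>) (WhileE c body)
       (Node (Num r) (Node v (foldl (F v) (i v) (decode_list (L v)))))
       (length (decode_list l) * K v + 4)"
    if "decode_list (L v) = xs @ decode_list l" for x v xs l \<rho>
    using that
  proof (induction l arbitrary: xs)
    case (Num r)
    have "runs x (Node (Num r) (Node v (foldl (F v) (i v) xs)) # \<rho>) c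
        (unop_val IsNode (vleft (Node (Num r) (Node v (foldl (F v) (i v) xs))))) (1 + 1 + 1)"
      unfolding c_def by (intro runs_Un runs_Var0)
    then have "runs x (Node (Num r) (Node v (foldl (F v) (i v) xs)) # \<rho>) c (Num 0) (1 + 1 + 1)"
      by simp
    from runs_mono[OF runs_While_stop[OF this, of body], of 4] show ?case
      using Num by auto
  next
    case (Node y l)
    let ?a = "foldl (F v) (i v) xs"
    let ?s = "Node (Node y l) (Node v ?a)"
    have "runs x (?s # \<rho>) c (unop_val IsNode (vleft ?s)) (1 + 1 + 1)"
      unfolding c_def by (intro runs_Un runs_Var0)
    then have 1: "runs x (?s # \<rho>) c (Num 1) (1 + 1 + 1)" by simp
    have "runs x (?s # \<rho>) body
       (Node (vright (vleft ?s)) (Node (vleft (vright ?s)) (F' (Node (vright ?s) (vleft (vleft ?s))))))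
       ((1 + 1 + 1) + ((1 + 1 + 1) + (((1 + 1) + (1 + 1 + 1) + 1) +
         tF (Node (vright ?s) (vleft (vleft ?s))) + 1) + 1) + 1)"
      unfolding body_def by (rule runs_Node runs_Un runs_Var0 runs_Let eF)+
    then have "runs x (?s # \<rho>) body (Node l (Node v (F v ?a y))) (15 + tF (Node (Node v ?a) y))"
      by (simp add: F'_def eval_nat_numeral)
    moreover have "tF (Node (Node v ?a) y) \<le> poly qF (2 + val_size v + g v + val_size (L v))"
    proof (rule le_trans[OF qF poly_nat_mono])
      have "val_size ?a \<le> g v" using size Node.prems by blast
      moreover have "val_size y \<le> val_size (L v)"
        using Node.prems by (intro mem_decode_list_size) auto
      ultimately show "val_size (Node (Node v ?a) y) \<le> 2 + val_size v + g v + val_size (L v)"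
        by simp
    qed
    ultimately have 2: "runs x (?s # \<rho>) body (Node l (Node v (F v ?a y))) (K v - 4)"
      unfolding K_def by (auto intro: runs_mono)
    have "decode_list (L v) = (xs @ [y]) @ decode_list l" using Node.prems by simp
    from Node.IH(2)[OF this] obtain r where
      *: "runs x (Node l (Node v (F v ?a y)) # \<rho>) (WhileE c body)
       (Node (Num r) (Node v (foldl (F v) (i v) (decode_list (L v))))) (length (decode_list l) * K v + 4)"
      by auto
    have "runs x (?s # \<rho>) (WhileE c body) (Node (Num r) (Node v (foldl (F v) (i v) (decode_list (L v)))))
        (length (decode_list (Node y l)) * K v + 4)"
      by (rule runs_mono[OF runs_While_step[OF 1 _ 2 *]]) (auto simp: K_def)
    then show ?case by blast
  qed
  show ?thesis
  proof (rule ptimeI)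
    let ?e = "LetE (BinE MkNode eL (BinE MkNode (VarE 0) ei)) (UnE Right (UnE Right (WhileE c body)))"
    let ?t = "\<lambda>v. (tL v + (1 + ti v + 1) + 1) + ((length (decode_list (L v)) * K v + 4) + 1 + 1) + 1"
    show "runs x (v # \<rho>) ?e (foldl (F v) (i v) (decode_list (L v))) (?t v)" for x v \<rho>
    proof (rule runs_Let)
      show "runs x (v # \<rho>) (BinE MkNode eL (BinE MkNode (VarE 0) ei)) (Node (L v) (Node v (i v)))
          (tL v + (1 + ti v + 1) + 1)"
        by (intro runs_Node eL ei runs_Var0)
      obtain r where *: "runs x (Node (L v) (Node v (i v)) # v # \<rho>) (WhileE c body)
       (Node (Num r) (Node v (foldl (F v) (i v) (decode_list (L v)))))
       (length (decode_list (L v)) * K v + 4)"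
        using loop[of v "[]" "L v"] by auto
      show "runs x (Node (L v) (Node v (i v)) # v # \<rho>) (UnE Right (UnE Right (WhileE c body)))
          (foldl (F v) (i v) (decode_list (L v))) ((length (decode_list (L v)) * K v + 4) + 1 + 1)"
        using runs_Un[OF runs_Un[OF *, of Right], of Right] by simp
    qed
    have "poly_bounded (\<lambda>v. (tL v + (1 + ti v + 1) + 1) + ((val_size (L v) * K v + 4) + 1 + 1) + 1)"
      unfolding K_def by (intro pb_intros L g ei(1) eL(1))
    then show "poly_bounded ?t"
      by (rule poly_bounded_mono) (use length_decode_list_le in \<open>simp add: mult_le_mono1\<close>)
    show "poly_bounded (\<lambda>v. val_size (foldl (F v) (i v) (decode_list (L v))))"
      by (rule poly_bounded_mono[OF g]) (use size[of _ _ "[]"] in simp)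
  qed
qed

text \<open>Prepending in a left fold reverses the list. Mapping and filtering below therefore fold
  over the reversed input.\<close>

lemma foldl_Node_eq: "foldl (\<lambda>a y. Node (f y) a) (encode_list zs) xs = encode_list (rev (map f xs) @ zs)"
  by (induction xs arbitrary: zs) (auto simp flip: encode_list.simps)

lemma foldl_Node_eq_Num0: "foldl (\<lambda>a y. Node (f y) a) (Num 0) xs = encode_list (rev (map f xs))"
  using foldl_Node_eq[of f "[]" xs] by simp

lemma foldl_filter_Node_eq:
  "foldl (\<lambda>a y. if P y then Node y a else a) (encode_list zs) xs = encode_list (rev (filter P xs) @ zs)"
  by (induction xs arbitrary: zs) (auto simp flip: encode_list.simps)

lemma foldl_filter_Node_eq_Num0:
  "foldl (\<lambda>a y. if P y then Node y a else a) (Num 0) xs = encode_list (rev (filter P xs))"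
  using foldl_filter_Node_eq[of P "[]" xs] by simp

text \<open>The size of an encoded list depends only on the multiset of its elements, so neither
  reversing nor filtering enlarges it.\<close>

lemma val_size_encode_list_mono:
  "mset xs \<subseteq># mset ys \<Longrightarrow> val_size (encode_list xs) \<le> val_size (encode_list ys)"
proof -
  assume "mset xs \<subseteq># mset ys"
  then have "mset ys = mset xs + (mset ys - mset xs)" by simp
  then have "sum_mset (image_mset (\<lambda>x. val_size x + 1) (mset ys)) =
      sum_mset (image_mset (\<lambda>x. val_size x + 1) (mset xs)) +
      sum_mset (image_mset (\<lambda>x. val_size x + 1) (mset ys - mset xs))"
    by (metis image_mset_union sum_mset.union)
  then show ?thesis
    unfolding val_size_encode_list sum_mset_sum_list[symmetric] mset_map by simp
qed

lemma val_size_encode_decode_list_le: "val_size (encode_list (decode_list v)) \<le> 2 + val_size v"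
  using val_size_decode_list[of v] by (simp add: val_size_encode_list)

lemma ptime_rev:
  assumes "ptime L" shows "ptime (\<lambda>v. encode_list (rev (decode_list (L v))))"
proof -
  have "ptime (\<lambda>v. foldl (\<lambda>a y. Node y a) (Num 0) (decode_list (L v)))"
  proof (rule ptime_foldl)
    show "poly_bounded (\<lambda>v. 2 + val_size (L v))" by (intro pb_intros assms)
    show "val_size (foldl (\<lambda>a y. Node y a) (Num 0) xs) \<le> 2 + val_size (L v)"
      if "decode_list (L v) = xs @ ys" for v xs ys
      using foldl_Node_eq_Num0[of "\<lambda>y. y" xs] that
        val_size_encode_list_mono[of "rev xs" "decode_list (L v)"]
        val_size_encode_decode_list_le[of "L v"]
      by simp
  qed (intro ptime_intros assms)+
  then show ?thesis using foldl_Node_eq_Num0[of "\<lambda>y. y"] by simp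
qed

lemma ptime_map [ptime_intros]:
  assumes F: "ptime (\<lambda>w. F (vleft w) (vright w))" and L: "ptime L"
  shows "ptime (\<lambda>v. encode_list (map (F v) (decode_list (L v))))"
proof -
  obtain q where q: "\<And>w. val_size (F (vleft w) (vright w)) \<le> poly q (val_size w)"
    using ptime_size[OF F] unfolding poly_bounded_def by blast
  have "ptime (\<lambda>v. foldl (\<lambda>a y. Node (F v y) a) (Num 0)
      (decode_list (encode_list (rev (decode_list (L v))))))"
  proof (rule ptime_foldl)
    show "poly_bounded (\<lambda>v. 2 + val_size (L v) * (poly q (1 + val_size v + val_size (L v)) + 1))"
      by (intro pb_intros L)
    have "ptime (\<lambda>w. (\<lambda>u. F (vleft u) (vright u)) (Node (vleft (vleft w)) (vright w)))"
      by (rule ptime_compose[OF F]) (intro ptime_intros)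
    then show "ptime (\<lambda>w. Node (F (vleft (vleft w)) (vright w)) (vright (vleft w)))"
      by (intro ptime_intros) auto
    show "val_size (foldl (\<lambda>a y. Node (F v y) a) (Num 0) xs)
        \<le> 2 + val_size (L v) * (poly q (1 + val_size v + val_size (L v)) + 1)"
      if "decode_list (encode_list (rev (decode_list (L v)))) = xs @ ys" for v xs ys
    proof -
      have sz: "val_size y \<le> val_size (L v)" if "y \<in> set xs" for y
      proof (rule mem_decode_list_size)
        show "y \<in> set (decode_list (L v))"
          using that \<open>decode_list (encode_list _) = _\<close>
          by (metis Un_iff decode_encode_list set_append set_rev)
      qed
      have "length xs \<le> length (rev (decode_list (L v)))"
        using that by simp
      also have "\<dots> \<le> val_size (L v)"
        by (simp add: length_decode_list_le)
      finally have len: "length xs \<le> val_size (L v)" .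
      have "val_size (encode_list (rev (map (F v) xs)))
         \<le> 2 + length (rev (map (F v) xs)) * (poly q (1 + val_size v + val_size (L v)) + 1)"
      proof (rule val_size_encode_list_le)
        fix z assume "z \<in> set (rev (map (F v) xs))"
        then obtain y where y: "y \<in> set xs" "z = F v y" by auto
        have "val_size (F v y) \<le> poly q (val_size (Node v y))" using q[of "Node v y"] by simp
        also have "\<dots> \<le> poly q (1 + val_size v + val_size (L v))"
          using sz[OF y(1)] by (intro poly_nat_mono) simp
        finally show "val_size z \<le> poly q (1 + val_size v + val_size (L v))" using y(2) by simp
      qed
      also have "\<dots> \<le> 2 + val_size (L v) * (poly q (1 + val_size v + val_size (L v)) + 1)"
        using len by (intro add_left_mono mult_le_mono1) simp
      finally show ?thesis by (simp add: foldl_Node_eq_Num0)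
    qed
  qed (intro ptime_intros ptime_rev L)+
  then show ?thesis by (simp add: foldl_Node_eq_Num0 rev_map)
qed

lemma ptime_filter [ptime_intros]:
  assumes F: "ptime (\<lambda>w. F (vleft w) (vright w))" and L: "ptime L"
  shows "ptime (\<lambda>v. encode_list (filter (\<lambda>y. F v y \<noteq> Num 0) (decode_list (L v))))"
proof -
  have "ptime (\<lambda>v. foldl (\<lambda>a y. if F v y \<noteq> Num 0 then Node y a else a) (Num 0)
      (decode_list (encode_list (rev (decode_list (L v))))))"
  proof (rule ptime_foldl)
    show "poly_bounded (\<lambda>v. 2 + val_size (L v))" by (intro pb_intros L)
    have "ptime (\<lambda>w. (\<lambda>u. F (vleft u) (vright u)) (Node (vleft (vleft w)) (vright w)))"
      by (rule ptime_compose[OF F]) (intro ptime_intros)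
    then show "ptime (\<lambda>w. if F (vleft (vleft w)) (vright w) \<noteq> Num 0
        then Node (vright w) (vright (vleft w)) else vright (vleft w))"
      by (intro ptime_intros) auto
    show "val_size (foldl (\<lambda>a y. if F v y \<noteq> Num 0 then Node y a else a) (Num 0) xs) \<le> 2 + val_size (L v)"
      if "decode_list (encode_list (rev (decode_list (L v)))) = xs @ ys" for v xs ys
    proof -
      have "mset (rev (decode_list (L v))) = mset xs + mset ys" using that by simp
      then have "mset (decode_list (L v)) = mset xs + mset ys" by simp
      moreover have "mset (rev (filter (\<lambda>y. F v y \<noteq> Num 0) xs)) \<subseteq># mset xs"
        by (simp add: multiset_filter_subset)
      ultimately have "mset (rev (filter (\<lambda>y. F v y \<noteq> Num 0) xs)) \<subseteq># mset (decode_list (L v))"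
        by (metis mset_subset_eq_add_left subset_mset.order_trans)
      from val_size_encode_list_mono[OF this] show ?thesis
        unfolding foldl_filter_Node_eq_Num0
        using val_size_encode_decode_list_le[of "L v"] by linarith
    qed
  qed (intro ptime_intros ptime_rev L)+
  then show ?thesis by (simp add: foldl_filter_Node_eq_Num0 rev_filter)
qed

text \<open>The second list stays an encoded value, read off by \<open>vleft\<close> and
  \<open>vright\<close>. A second list that is too short is thus padded with \<open>Num 0\<close>,
  and no hypothesis on lengths is required.\<close>

fun zip_val :: "val list \<Rightarrow> val \<Rightarrow> val list" where
  "zip_val [] w = []"
| "zip_val (y # ys) w = Node y (vleft w) # zip_val ys (vright w)"

lemma zip_val_maps [simp]:
  "zip_val (map f xs) (encode_list (map g xs)) = map (\<lambda>i. Node (f i) (g i)) xs"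
  by (induction xs) auto

lemma foldl_zip_val:
  "foldl (\<lambda>a y. Node (vright (vleft a)) (Node (Node y (vleft (vleft a))) (vright a)))
     (Node w (encode_list zs)) xs =
   Node ((vright ^^ length xs) w) (encode_list (rev (zip_val xs w) @ zs))"
proof (induction xs arbitrary: w zs)
  case (Cons y xs)
  show ?case using Cons[of "vright w" "Node y (vleft w) # zs"] by (simp add: funpow_swap1)
qed simp

text \<open>Past the end of a list \<open>vright\<close> keeps returning \<open>Num 0\<close>, whose
  size 2 is the additive term.\<close>

lemma val_size_vright_pow: "val_size ((vright ^^ n) w) \<le> val_size w + 2"
proof (induction n arbitrary: w)
  case (Suc n)
  show ?case
  proof (cases w)
    case (Num r)
    have "(vright ^^ n) (Num 0) = Num 0" by (induction n) auto
    then show ?thesis using Num by (simp add: funpow_swap1 rat_bits_eq)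
  next
    case (Node u v)
    then show ?thesis using Suc[of v] by (simp add: funpow_swap1)
  qed
qed auto

lemma zip_val_mem_size:
  "z \<in> set (zip_val xs w) \<Longrightarrow> \<exists>y\<in>set xs. val_size z \<le> val_size y + val_size w + 3"
proof (induction xs arbitrary: w)
  case (Cons y xs)
  show ?case
  proof (cases "z = Node y (vleft w)")
    case True
    then show ?thesis by (cases w) (auto simp: rat_bits_eq)
  next
    case False
    then have "z \<in> set (zip_val xs (vright w))" using Cons.prems by simp
    then obtain y' where y': "y' \<in> set xs" "val_size z \<le> val_size y' + val_size (vright w) + 3"
      using Cons.IH by blast
    show ?thesis
    proof (cases w)
      case (Num r)
      then show ?thesis
        using y' val_size_ge_2[of w] by (intro bexI[of _ y']) (auto simp: rat_bits_eq)
    next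
      case (Node u v)
      then show ?thesis using y' by (intro bexI[of _ y']) auto
    qed
  qed
qed auto

lemma length_zip_val [simp]: "length (zip_val xs w) = length xs"
  by (induction xs arbitrary: w) auto

lemma ptime_zip [ptime_intros]:
  assumes "ptime L" "ptime M"
  shows "ptime (\<lambda>v. encode_list (zip_val (decode_list (L v)) (M v)))"
proof -
  let ?F = "\<lambda>a y. Node (vright (vleft a)) (Node (Node y (vleft (vleft a))) (vright a))"
  have eq: "foldl ?F (Node w (Num 0)) xs = Node ((vright ^^ length xs) w) (encode_list (rev (zip_val xs w)))"
    for w xs using foldl_zip_val[of w "[]" xs] by simp
  have "ptime (\<lambda>v. foldl ?F (Node (M v) (Num 0)) (decode_list (L v)))"
  proof (rule ptime_foldl)
    let ?B = "\<lambda>v. 5 + val_size (M v) + val_size (L v) * ((val_size (L v) + val_size (M v) + 3) + 1)"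
    show "poly_bounded ?B" by (intro pb_intros assms)
    show "val_size (foldl ?F (Node (M v) (Num 0)) xs) \<le> ?B v"
      if L: "decode_list (L v) = xs @ ys" for v xs ys
    proof -
      have "val_size (encode_list (rev (zip_val xs (M v))))
        \<le> 2 + length (rev (zip_val xs (M v))) * ((val_size (L v) + val_size (M v) + 3) + 1)"
      proof (rule val_size_encode_list_le)
        fix z assume "z \<in> set (rev (zip_val xs (M v)))"
        then obtain y where "y \<in> set xs" "val_size z \<le> val_size y + val_size (M v) + 3"
          using zip_val_mem_size by fastforce
        then show "val_size z \<le> val_size (L v) + val_size (M v) + 3"
          using mem_decode_list_size[of y "L v"] L by simp
      qed
      also have "\<dots> \<le> 2 + val_size (L v) * ((val_size (L v) + val_size (M v) + 3) + 1)"
        using length_decode_list_le[of "L v"] L by (intro add_left_mono mult_le_mono1) simp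
      finally show ?thesis
        using val_size_vright_pow[of "length xs" "M v"] unfolding eq by simp
    qed
  qed (intro ptime_intros assms)+
  then have "ptime (\<lambda>v. encode_list (rev (decode_list
      (vright (foldl ?F (Node (M v) (Num 0)) (decode_list (L v)))))))"
    by (intro ptime_rev ptime_unop)
  then show ?thesis unfolding eq by simp
qed

definition index_val :: "val \<Rightarrow> val" where
  "index_val l = encode_list (map (\<lambda>i. Num (of_nat i)) [0..<length (decode_list l)])"

lemma ptime_index [ptime_intros]:
  assumes "ptime L" shows "ptime (\<lambda>v. index_val (L v))"
proof -
  let ?F = "\<lambda>a y. Node (binop_val Add (vleft a) (Num 1)) (Node (vleft a) (vright a))"
  have eq: "foldl ?F (Node (Num 0) (Num 0)) xs =
      Node (Num (of_nat (length xs))) (encode_list (rev (map (\<lambda>i. Num (of_nat i)) [0..<length xs])))"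
    for xs :: "val list" by (induction xs rule: rev_induct) (auto simp: add.commute)
  have "ptime (\<lambda>v. foldl ?F (Node (Num 0) (Num 0)) (decode_list (L v)))"
  proof (rule ptime_foldl)
    let ?B = "\<lambda>v. 5 + val_size (L v) + val_size (L v) * ((val_size (L v) + 2) + 1)"
    show "poly_bounded ?B" by (intro pb_intros assms)
    show "val_size (foldl ?F (Node (Num 0) (Num 0)) xs) \<le> ?B v"
      if L: "decode_list (L v) = xs @ ys" for v xs ys
    proof -
      let ?l = "rev (map (\<lambda>i. Num (of_nat i)) [0..<length xs])"
      have len: "length xs \<le> val_size (L v)" using length_decode_list_le[of "L v"] L by simp
      have "val_size (encode_list ?l) \<le> 2 + length ?l * ((val_size (L v) + 2) + 1)"
      proof (rule val_size_encode_list_le)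
        fix z assume "z \<in> set ?l"
        then obtain i where "i < length xs" "z = Num (of_nat i)" by auto
        then show "val_size z \<le> val_size (L v) + 2" using rat_bits_of_nat[of i] len by simp
      qed
      also have "\<dots> \<le> 2 + val_size (L v) * ((val_size (L v) + 2) + 1)"
        using len by (intro add_left_mono mult_le_mono1) simp
      finally show ?thesis
        using rat_bits_of_nat[of "length xs"] len unfolding eq by simp
    qed
  qed (intro ptime_intros assms)+
  then have "ptime (\<lambda>v. encode_list (rev (decode_list
      (vright (foldl ?F (Node (Num 0) (Num 0)) (decode_list (L v)))))))"
    by (intro ptime_rev ptime_unop)
  then show ?thesis unfolding eq index_val_def by simp
qed

section \<open>Sums and minima of lists of rationals\<close>

definition sum_val :: "val \<Rightarrow> val" where
  "sum_val l = foldl (binop_val Add) (Num 0) (decode_list l)"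

lemma sum_val_map: "sum_val (encode_list (map (\<lambda>x. Num (f x)) xs)) = Num (\<Sum>x\<leftarrow>xs. f x)"
proof -
  have "foldl (binop_val Add) (Num r) (map (\<lambda>x. Num (f x)) xs) = Num (r + (\<Sum>x\<leftarrow>xs. f x))" for r
    by (induction xs arbitrary: r) auto
  then show ?thesis by (simp add: sum_val_def)
qed

text \<open>Both bounds go through the induction together, since the new numerator picks up the
  denominator length of the other summand. The carry bit is absorbed by the 1 in
  \<open>val_size\<close>, and \<open>denom_bits_pos\<close> pays for the extra 1 in the denominator
  bound. A \<open>Node\<close> among the summands resets the sum to \<open>Num 0\<close>.\<close>

lemma sum_val_bits:
  "\<exists>r. foldl (binop_val Add) (Num 0) xs = Num r \<and>
       numer_bits r \<le> (\<Sum>x\<leftarrow>xs. val_size x) \<and> denom_bits r \<le> 1 + (\<Sum>x\<leftarrow>xs. val_size x)"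
proof (induction xs rule: rev_induct)
  case (snoc y xs)
  then obtain r where r: "foldl (binop_val Add) (Num 0) xs = Num r"
    "numer_bits r \<le> (\<Sum>x\<leftarrow>xs. val_size x)" "denom_bits r \<le> 1 + (\<Sum>x\<leftarrow>xs. val_size x)" by blast
  show ?case
  proof (cases y)
    case (Num s)
    show ?thesis
      using r bits_add[of r s] denom_bits_pos[of s] by (auto simp: Num rat_bits_eq)
  next
    case (Node u w)
    then show ?thesis using r(1) by simp
  qed
qed simp

lemma ptime_sum [ptime_intros]:
  assumes "ptime L" shows "ptime (\<lambda>v. sum_val (L v))"
  unfolding sum_val_def
proof (rule ptime_foldl)
  show "poly_bounded (\<lambda>v. 2 + 2 * val_size (L v))" by (intro pb_intros assms)
  show "val_size (foldl (binop_val Add) (Num 0) xs) \<le> 2 + 2 * val_size (L v)"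
    if L: "decode_list (L v) = xs @ ys" for v xs ys
  proof -
    have "(\<Sum>x\<leftarrow>xs. val_size x) \<le> (\<Sum>x\<leftarrow>xs @ ys. val_size x + 1)"
      by (induction xs) auto
    also have "\<dots> \<le> val_size (L v)" using val_size_decode_list[of "L v"] unfolding L .
    finally show ?thesis using sum_val_bits[of xs] by (auto simp: rat_bits_eq)
  qed
qed (intro ptime_intros assms)+

definition argmin_val :: "val \<Rightarrow> val" where
  "argmin_val l = foldl (\<lambda>a y. if binop_val Less (vleft y) (vleft a) \<noteq> Num 0 then y else a)
     (vleft l) (decode_list l)"

lemma foldl_choose_mem: "foldl (\<lambda>a y. if P a y then y else a) z xs \<in> insert z (set xs)"
  by (induction xs arbitrary: z) auto

lemma ptime_argmin [ptime_intros]: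
  assumes "ptime L" shows "ptime (\<lambda>v. argmin_val (L v))"
  unfolding argmin_val_def
proof (rule ptime_foldl)
  show "poly_bounded (\<lambda>v. val_size (L v) + 3)" by (intro pb_intros assms)
  show "val_size (foldl (\<lambda>a y. if binop_val Less (vleft y) (vleft a) \<noteq> Num 0 then y else a)
      (vleft (L v)) xs) \<le> val_size (L v) + 3" if L: "decode_list (L v) = xs @ ys" for v xs ys
    using foldl_choose_mem[of "\<lambda>a y. binop_val Less (vleft y) (vleft a) \<noteq> Num 0" "vleft (L v)" xs]
      mem_decode_list_size[of _ "L v"] val_size_unop_le[of Left "L v"] L
    by (smt (verit) Un_iff insert_iff le_add1 le_trans set_append)
qed (intro ptime_intros assms)+

lemma argmin_val_map:
  assumes "js \<noteq> []"
  obtains j where "j \<in> set js" "\<And>i. i \<in> set js \<Longrightarrow> (k j :: rat) \<le> k i"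
    "argmin_val (encode_list (map (\<lambda>j. Node (Num (k j)) (f j)) js)) = Node (Num (k j)) (f j)"
proof -
  let ?g = "\<lambda>j. Node (Num (k j)) (f j)"
  have *: "\<exists>j\<in>insert z (set js). (\<forall>i\<in>insert z (set js). k j \<le> k i) \<and>
     foldl (\<lambda>a y. if binop_val Less (vleft y) (vleft a) \<noteq> Num 0 then y else a) (?g z) (map ?g js) = ?g j"
    for z js
  proof (induction js arbitrary: z)
    case (Cons i js)
    show ?case
    proof (cases "k i < k z")
      case True
      then show ?thesis using Cons[of i] by fastforce
    next
      case False
      then show ?thesis using Cons[of z] by fastforce
    qed
  qed simp
  obtain z js' where js: "js = z # js'" using assms by (cases js) auto
  show ?thesis
    using *[of z js] that unfolding argmin_val_def js by auto
qed

definition map_val :: "(val \<Rightarrow> val) \<Rightarrow> val \<Rightarrow> val" where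
  "map_val f l = encode_list (map f (decode_list l))"

definition filter_val :: "(val \<Rightarrow> val) \<Rightarrow> val \<Rightarrow> val" where
  "filter_val f l = encode_list (filter (\<lambda>y. f y \<noteq> Num 0) (decode_list l))"

definition zip_vals :: "val \<Rightarrow> val \<Rightarrow> val" where
  "zip_vals l m = encode_list (zip_val (decode_list l) m)"

lemma ptime_map_val [ptime_intros]:
  "ptime (\<lambda>w. F (vleft w) (vright w)) \<Longrightarrow> ptime L \<Longrightarrow> ptime (\<lambda>v. map_val (F v) (L v))"
  unfolding map_val_def by (rule ptime_map)

lemma ptime_filter_val [ptime_intros]:
  "ptime (\<lambda>w. F (vleft w) (vright w)) \<Longrightarrow> ptime L \<Longrightarrow> ptime (\<lambda>v. filter_val (F v) (L v))"
  unfolding filter_val_def by (rule ptime_filter)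

lemma ptime_zip_vals [ptime_intros]:
  "ptime L \<Longrightarrow> ptime M \<Longrightarrow> ptime (\<lambda>v. zip_vals (L v) (M v))"
  unfolding zip_vals_def by (rule ptime_zip)

lemma map_val_map [simp]:
  "map_val f (encode_list (map g xs)) = encode_list (map (\<lambda>i. f (g i)) xs)"
  by (simp add: map_val_def comp_def)

lemma filter_val_map [simp]:
  "filter_val f (encode_list (map g xs)) = encode_list (map g (filter (\<lambda>i. f (g i) \<noteq> Num 0) xs))"
  by (simp add: filter_val_def filter_map comp_def)

lemma zip_vals_map [simp]:
  "zip_vals (encode_list (map f xs)) (encode_list (map g xs)) = encode_list (map (\<lambda>i. Node (f i) (g i)) xs)"
  by (simp add: zip_vals_def)

lemma index_val_map [simp]:
  "index_val (encode_list (map f [0..<n])) = encode_list (map (\<lambda>i. Num (of_nat i)) [0..<n])"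
  by (simp add: index_val_def)

lemma sum_list_upt: "(\<Sum>i\<leftarrow>[0..<n]. f i) = (\<Sum>i<n. f i)" for f :: "nat \<Rightarrow> 'a::comm_monoid_add"
  by (simp add: sum_list_distinct_conv_sum_set atLeast0LessThan)

subsection \<open>The residual function\<close>

definition lo :: "ltf_instance \<Rightarrow> nat \<Rightarrow> (nat \<rightharpoonup> bool) \<Rightarrow> int" where
  "lo I k b = (\<Sum>i<nvars I. case b i of None \<Rightarrow> min (coef I k i) 0 | Some v \<Rightarrow> coef I k i * of_bool v)"

definition hi :: "ltf_instance \<Rightarrow> nat \<Rightarrow> (nat \<rightharpoonup> bool) \<Rightarrow> int" where
  "hi I k b = (\<Sum>i<nvars I. case b i of None \<Rightarrow> max (coef I k i) 0 | Some v \<Rightarrow> coef I k i * of_bool v)"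

text \<open>The factors are the distances to a certificate for 1 and to one for 0. Multiplying
  truncated distances expresses the goal of reaching either of them. The \<open>+ 1\<close> makes
  the second factor vanish exactly under the strict condition
  \<open>hi I k b < thr I k\<close>.\<close>

definition formula_residual :: "ltf_instance \<Rightarrow> nat \<Rightarrow> (nat \<rightharpoonup> bool) \<Rightarrow> int" where
  "formula_residual I k b = max 0 (thr I k - lo I k b) * max 0 (hi I k b - thr I k + 1)"

definition residual :: "ltf_instance \<Rightarrow> (nat \<rightharpoonup> bool) \<Rightarrow> int" where
  "residual I b = (\<Sum>k<nforms I. formula_residual I k b)"

definition decrease :: "ltf_instance \<Rightarrow> (nat \<rightharpoonup> bool) \<Rightarrow> nat \<Rightarrow> bool \<Rightarrow> int" where
  "decrease I b j v = residual I b - residual I (b(j \<mapsto> v))"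

abbreviation (input) total :: "(nat \<Rightarrow> bool) \<Rightarrow> nat \<rightharpoonup> bool" where
  "total x \<equiv> \<lambda>i. Some (x i)"

lemma formula_residual_nonneg: "formula_residual I k b \<ge> 0"
  by (simp add: formula_residual_def)

lemma residual_nonneg: "residual I b \<ge> 0"
  by (simp add: residual_def sum_nonneg formula_residual_nonneg)

section \<open>Certificates in terms of the bounds on the linear form\<close>

lemma map_leD: "b \<subseteq>\<^sub>m b' \<Longrightarrow> b i = Some v \<Longrightarrow> b' i = Some v"
  unfolding map_le_def by (metis domI)

lemma map_le_totalD: "b \<subseteq>\<^sub>m total x \<Longrightarrow> b i = None \<or> b i = Some (x i)"
  using map_leD[of b "total x" i] by (cases "b i") auto

lemma lo_hi_mono:
  assumes "b \<subseteq>\<^sub>m b'" shows "lo I k b \<le> lo I k b'" "hi I k b' \<le> hi I k b"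
  unfolding lo_def hi_def using map_leD[OF assms]
  by (auto intro!: sum_mono simp: min_def max_def split: option.split)

lemma lo_hi_le: "lo I k b \<le> hi I k b"
  unfolding lo_def hi_def by (auto intro!: sum_mono split: option.splits)

lemma lo_hi_total: "lo I k (total x) = (\<Sum>i<nvars I. coef I k i * of_bool (x i))"
  "hi I k (total x) = (\<Sum>i<nvars I. coef I k i * of_bool (x i))"
  by (simp_all add: lo_def hi_def)

lemma formula_value_bounds:
  assumes "b \<subseteq>\<^sub>m total x"
  shows "thr I k \<le> lo I k b \<Longrightarrow> formula_value I k x" "hi I k b < thr I k \<Longrightarrow> \<not> formula_value I k x"
  using lo_hi_mono[OF assms, of I k] unfolding formula_value_def lo_hi_total by linarith+

text \<open>The completion that sets an unknown variable to 1 exactly when its coefficient is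
  negative attains \<open>lo\<close>, so a certificate must hold for it in particular.\<close>

lemma certificate_True_iff: "certificate (formula_value I k) True b \<longleftrightarrow> thr I k \<le> lo I k b"
proof
  define a where "a i = (case b i of None \<Rightarrow> coef I k i < 0 | Some v \<Rightarrow> v)" for i
  have a: "b \<subseteq>\<^sub>m total a" by (auto simp: map_le_def a_def)
  have "(\<Sum>i<nvars I. coef I k i * of_bool (a i)) = lo I k b"
    unfolding lo_def by (intro sum.cong) (auto simp: a_def split: option.splits)
  moreover assume "certificate (formula_value I k) True b"
  ultimately show "thr I k \<le> lo I k b"
    using a unfolding certificate_def formula_value_def by metis
qed (auto simp: certificate_def formula_value_bounds)

lemma certificate_False_iff: "certificate (formula_value I k) False b \<longleftrightarrow> hi I k b < thr I k"
proof
  define a where "a i = (case b i of None \<Rightarrow> coef I k i > 0 | Some v \<Rightarrow> v)" for i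
  have a: "b \<subseteq>\<^sub>m total a" by (auto simp: map_le_def a_def)
  have "(\<Sum>i<nvars I. coef I k i * of_bool (a i)) = hi I k b"
    unfolding hi_def by (intro sum.cong) (auto simp: a_def split: option.splits)
  moreover assume "certificate (formula_value I k) False b"
  ultimately show "hi I k b < thr I k"
    using a unfolding certificate_def formula_value_def by (metis not_le)
qed (auto simp: certificate_def formula_value_bounds)

lemma formula_residual_eq_0_iff:
  "formula_residual I k b = 0 \<longleftrightarrow> thr I k \<le> lo I k b \<or> hi I k b < thr I k"
  by (auto simp: formula_residual_def max_def split: if_splits)

lemma all_determined_iff_formula_residual:
  "all_determined I b \<longleftrightarrow> (\<forall>k<nforms I. formula_residual I k b = 0)"
  unfolding all_determined_def certificate_True_iff certificate_False_iff formula_residual_eq_0_iff by blast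

lemma all_determined_iff: "all_determined I b \<longleftrightarrow> residual I b = 0"
  unfolding all_determined_iff_formula_residual residual_def
  by (subst sum_nonneg_eq_0_iff) (auto simp: formula_residual_nonneg)

section \<open>Monotonicity and diminishing decreases of the residual\<close>

lemma formula_residual_antimono:
  "b \<subseteq>\<^sub>m b' \<Longrightarrow> formula_residual I k b' \<le> formula_residual I k b"
  unfolding formula_residual_def using lo_hi_mono[of b b' I k] by (intro mult_mono) auto

lemma residual_antimono: "b \<subseteq>\<^sub>m b' \<Longrightarrow> residual I b' \<le> residual I b"
  unfolding residual_def by (intro sum_mono formula_residual_antimono)

lemma map_le_upd: "b j = None \<or> b j = Some v \<Longrightarrow> b \<subseteq>\<^sub>m b(j \<mapsto> v)"
  by (auto simp: map_le_def)

lemma decrease_nonneg: "b j = None \<or> b j = Some v \<Longrightarrow> decrease I b j v \<ge> 0"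
  unfolding decrease_def using residual_antimono[OF map_le_upd] by simp

lemma decrease_known: "b j = Some v \<Longrightarrow> decrease I b j v = 0"
  unfolding decrease_def by (simp add: fun_upd_idem)

lemma decrease_le_residual: "decrease I b j v \<le> residual I b"
  unfolding decrease_def using residual_nonneg by simp

lemma lo_hi_upd:
  assumes "b j = None" "j < nvars I"
  shows "lo I k (b(j \<mapsto> v)) = lo I k b + (coef I k j * of_bool v - min (coef I k j) 0)"
    "hi I k (b(j \<mapsto> v)) = hi I k b - (max (coef I k j) 0 - coef I k j * of_bool v)"
  using assms by (simp_all add: lo_def hi_def sum.remove[of "{..<nvars I}" j])

lemma lo_hi_irrelevant:
  assumes "j \<ge> nvars I \<or> coef I k j = 0"
  shows "lo I k (b(j \<mapsto> v)) = lo I k b" "hi I k (b(j \<mapsto> v)) = hi I k b"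
  using assms unfolding lo_def hi_def by (auto intro!: sum.cong split: option.splits)

text \<open>Writing the decrease of a product as \<open>(A - A\<^sub>1) B + A\<^sub>1 (B - B\<^sub>1)\<close>, each of the four factors
  decreases when \<open>l\<close> grows and \<open>u\<close> shrinks.\<close>

lemma truncated_product_supermodular:
  fixes l l' u u' t \<delta> \<epsilon> :: int
  assumes "l \<le> l'" "u' \<le> u" "\<delta> \<ge> 0" "\<epsilon> \<ge> 0"
  defines "A \<equiv> \<lambda>l. max 0 (t - l)" and "B \<equiv> \<lambda>u. max 0 (u - t + 1)"
  shows "A l' * B u' - A (l' + \<delta>) * B (u' - \<epsilon>) \<le> A l * B u - A (l + \<delta>) * B (u - \<epsilon>)"
proof -
  have "(A l' - A (l' + \<delta>)) * B u' \<le> (A l - A (l + \<delta>)) * B u"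
    using assms(1-4) unfolding A_def B_def by (intro mult_mono) auto
  moreover have "A (l' + \<delta>) * (B u' - B (u' - \<epsilon>)) \<le> A (l + \<delta>) * (B u - B (u - \<epsilon>))"
    using assms(1-4) unfolding A_def B_def by (intro mult_mono) auto
  ultimately show ?thesis by (simp add: algebra_simps)
qed

text \<open>Diminishing returns hold for each outcome \<open>v\<close> separately, not only in
  expectation. If \<open>j\<close> is unknown in both assignments, testing it shifts
  \<open>lo\<close> and \<open>hi\<close> by the same amounts from \<open>b\<close> as from
  \<open>b'\<close>, which is the situation of \<open>truncated_product_supermodular\<close>. If
  \<open>b'\<close> already knows \<open>j\<close>, its decrease is 0.\<close>

lemma decrease_antimono:
  assumes "b \<subseteq>\<^sub>m b'" "b' j = None \<or> b' j = Some v"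
  shows "decrease I b' j v \<le> decrease I b j v"
proof (cases "b' j = None")
  case False
  then have "decrease I b' j v = 0" using assms(2) by (intro decrease_known) auto
  moreover have "b j = None \<or> b j = Some v"
    using assms map_leD[OF assms(1), of j] by (cases "b j") auto
  ultimately show ?thesis using decrease_nonneg[of b j v I] by linarith
next
  case None: True
  then have None': "b j = None" using map_leD[OF assms(1), of j] by (cases "b j") auto
  have "formula_residual I k b' - formula_residual I k (b'(j \<mapsto> v))
      \<le> formula_residual I k b - formula_residual I k (b(j \<mapsto> v))" for k
  proof (cases "j < nvars I")
    case True
    show ?thesis
      unfolding formula_residual_def lo_hi_upd[of b, OF None' True] lo_hi_upd[of b', OF None True]
      by (rule truncated_product_supermodular)
        (use lo_hi_mono[OF assms(1), of I k] in \<open>auto simp: min_def max_def\<close>)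
  next
    case False
    then show ?thesis by (simp add: formula_residual_def lo_hi_irrelevant)
  qed
  then show ?thesis
    unfolding decrease_def residual_def sum_subtractf[symmetric] by (intro sum_mono)
qed

text \<open>Revealing the variables of \<open>F\<close> one at a time telescopes, and by diminishing
  returns each step achieves at most what it would achieve directly from \<open>b\<close>.\<close>

lemma residual_le_sum_decrease:
  assumes "finite F" "b \<subseteq>\<^sub>m total x"
  shows "residual I b - residual I (\<lambda>i. if i \<in> F then Some (x i) else b i) \<le> (\<Sum>j\<in>F. decrease I b j (x j))"
  using assms(1)
proof induction
  case (insert j F)
  let ?b = "\<lambda>i. if i \<in> F then Some (x i) else b i"
  have eq: "(\<lambda>i. if i \<in> insert j F then Some (x i) else b i) = ?b(j \<mapsto> x j)" by auto
  have "decrease I ?b j (x j) \<le> decrease I b j (x j)"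
  proof (rule decrease_antimono)
    show "b \<subseteq>\<^sub>m ?b" using map_leD[OF assms(2)] by (auto simp: map_le_def)
    show "?b j = None \<or> ?b j = Some (x j)"
      using map_le_totalD[OF assms(2), of j] by auto
  qed
  then have "residual I ?b - residual I (?b(j \<mapsto> x j)) \<le> decrease I b j (x j)"
    by (simp only: decrease_def)
  then show ?case
    unfolding eq sum.insert[OF insert.hyps] using insert.IH by linarith
qed simp

text \<open>This is the covering constraint satisfied by the tests of any correct strategy: added to
  \<open>b\<close> they leave no residual, so their individual decreases from \<open>b\<close> must
  account for all of it.\<close>

lemma residual_le_sum_decrease_certificate:
  assumes "finite F" "b \<subseteq>\<^sub>m total x" "all_determined I (\<lambda>i. if i \<in> F then Some (x i) else None)"
  shows "residual I b \<le> (\<Sum>j\<in>F. decrease I b j (x j))"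
proof -
  have "residual I (\<lambda>i. if i \<in> F then Some (x i) else b i)
      \<le> residual I (\<lambda>i. if i \<in> F then Some (x i) else None)"
    by (rule residual_antimono) (auto simp: map_le_def)
  also have "\<dots> = 0" using assms(3) by (simp only: all_determined_iff)
  finally show ?thesis
    using residual_le_sum_decrease[OF assms(1,2), of I] by linarith
qed

section \<open>Upper bounds on the residual and on the decrease by one test\<close>

lemma D_eq_hi_lo: "D I k = hi I k Map.empty - lo I k Map.empty"
  unfolding D_def hi_def lo_def sum_subtractf[symmetric] by (intro sum.cong) auto

lemma formula_residual_empty_le: "formula_residual I k Map.empty \<le> (D I k)\<^sup>2"
proof -
  \<comment> \<open>The two distances sum to \<open>hi - lo + 1\<close>, hence to one more than
    \<open>D I k\<close>. If both are at least 1, neither exceeds \<open>D I k\<close>.\<close>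
  have *: "max 0 A * max 0 B \<le> d\<^sup>2" if "d = A + B - 1" "d \<ge> 0" for A B d :: int
  proof (cases "A \<ge> 1 \<and> B \<ge> 1")
    case True
    then have "A \<le> d" "B \<le> d" using that by auto
    then show ?thesis unfolding power2_eq_square using True by (intro mult_mono) auto
  next
    case False
    then have "max 0 A = 0 \<or> max 0 B = 0" by linarith
    then show ?thesis by auto
  qed
  show ?thesis
    unfolding formula_residual_def
    by (rule *) (use lo_hi_le[of I k Map.empty] in \<open>auto simp: D_eq_hi_lo\<close>)
qed

lemma D_nonneg: "D I k \<ge> 0"
  by (simp add: D_def sum_nonneg)

lemma residual_le_sum_D: "residual I b \<le> (\<Sum>k<nforms I. D I k)\<^sup>2"
proof -
  have "residual I b \<le> residual I Map.empty"
    by (rule residual_antimono) simp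
  also have "\<dots> \<le> (\<Sum>k<nforms I. (D I k)\<^sup>2)"
    unfolding residual_def by (intro sum_mono formula_residual_empty_le)
  also have "\<dots> \<le> (\<Sum>k<nforms I. D I k * (\<Sum>k<nforms I. D I k))"
    unfolding power2_eq_square
    by (intro sum_mono mult_left_mono member_le_sum) (auto simp: D_nonneg)
  also have "\<dots> = (\<Sum>k<nforms I. D I k)\<^sup>2"
    by (simp add: power2_eq_square sum_distrib_right)
  finally show ?thesis .
qed

lemma finite_formula_vars [simp]: "finite (formula_vars I k)"
  by (simp add: formula_vars_def)

text \<open>Only the at most \<open>r\<close> formulas containing \<open>j\<close> react to its
  test. In an OR formula the distance to a 1-certificate starts at 1, so its residual starts at the
  number of its variables and never exceeds that.\<close>

lemma decrease_or_formulas_le: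
  assumes or: "\<forall>k<nforms I. or_formula I k" and occ: "\<forall>i<nvars I. occurrences I i \<le> r"
    and m: "nforms I \<ge> 1" and j: "j < nvars I"
  shows "decrease I b j v \<le> int (beta_max I * r)"
proof -
  let ?K = "{k. k < nforms I \<and> j \<in> formula_vars I k}"
  have beta: "formula_residual I k b \<le> int (beta_max I)" if "k < nforms I" for k
  proof -
    have k: "or_formula I k" using or that by blast
    have "hi I k Map.empty = (\<Sum>i<nvars I. of_bool (i \<in> formula_vars I k))"
      unfolding hi_def using k by (intro sum.cong) (auto simp: or_formula_def formula_vars_def)
    also have "\<dots> = int (card (formula_vars I k))"
      by (simp add: sum_of_bool_eq) (rule arg_cong[of _ _ card], auto simp: formula_vars_def)
    finally have "hi I k Map.empty = int (card (formula_vars I k))" .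
    moreover have "lo I k Map.empty = 0"
      unfolding lo_def using k by (intro sum.neutral) (auto simp: or_formula_def)
    ultimately have "formula_residual I k Map.empty = int (card (formula_vars I k))"
      using k by (simp add: formula_residual_def or_formula_def)
    moreover have "card (formula_vars I k) \<le> beta_max I"
      unfolding beta_max_def using that by (intro Max_ge) auto
    ultimately show ?thesis
      using formula_residual_antimono[of Map.empty b I k] by simp
  qed
  have "decrease I b j v = (\<Sum>k<nforms I. formula_residual I k b - formula_residual I k (b(j \<mapsto> v)))"
    by (simp add: decrease_def residual_def sum_subtractf)
  also have "\<dots> = (\<Sum>k\<in>?K. formula_residual I k b - formula_residual I k (b(j \<mapsto> v)))"
    using j by (intro sum.mono_neutral_right)
      (auto simp: formula_residual_def lo_hi_irrelevant formula_vars_def)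
  also have "\<dots> \<le> (\<Sum>k\<in>?K. int (beta_max I))"
  proof (intro sum_mono)
    fix k assume "k \<in> ?K"
    then show "formula_residual I k b - formula_residual I k (b(j \<mapsto> v)) \<le> int (beta_max I)"
      using beta[of k] formula_residual_nonneg[of I k "b(j \<mapsto> v)"] by simp
  qed
  also have "\<dots> = int (beta_max I * occurrences I j)"
    by (simp add: occurrences_def)
  also have "\<dots> \<le> int (beta_max I * r)"
    using occ j by (simp add: mult_left_mono)
  finally show ?thesis .
qed

subsection \<open>Expectations over the input distribution\<close>

abbreviation expect :: "ltf_instance \<Rightarrow> ((nat \<Rightarrow> bool) \<Rightarrow> real) \<Rightarrow> real" where
  "expect I \<equiv> measure_pmf.expectation (input_pmf I)"

definition prob_of :: "ltf_instance \<Rightarrow> nat \<Rightarrow> bool \<Rightarrow> real" where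
  "prob_of I i v = real_of_rat (if v then prob I i else 1 - prob I i)"

lemma wf_prob_of_pos:
  assumes "wf_instance I" "i < nvars I" shows "prob_of I i v > 0"
  using assms by (auto simp: prob_of_def wf_instance_def zero_less_of_rat_iff)

lemma prob_of_sum: "prob_of I i False + prob_of I i True = 1"
  by (simp add: prob_of_def of_rat_diff)

lemma finite_set_input_pmf [simp]: "finite (set_pmf (input_pmf I))"
  unfolding input_pmf_def by (rule finite_subset[OF set_Pi_pmf_subset']) (auto intro!: finite_PiE_dflt)

lemma expect_integrable [simp]: "integrable (measure_pmf (input_pmf I)) (f :: (nat \<Rightarrow> bool) \<Rightarrow> real)"
  by (rule integrable_measure_pmf_finite) simp

lemma expect_mono: "(\<And>x. f x \<le> g x) \<Longrightarrow> expect I f \<le> expect I g"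
  by (rule integral_mono) auto

text \<open>Conditioning on coordinate \<open>i\<close> is expressed by overwriting it under the
  full distribution, so no second distribution on the remaining coordinates appears in later
  arguments.\<close>

lemma expect_split:
  assumes "wf_instance I" "i < nvars I"
  shows "expect I f =
    prob_of I i False * expect I (\<lambda>x. f (x(i := False))) + prob_of I i True * expect I (\<lambda>x. f (x(i := True)))"
proof -
  let ?p = "\<lambda>i. bernoulli_pmf (real_of_rat (prob I i))"
  let ?R = "Pi_pmf ({..<nvars I} - {i}) False ?p"
  have p: "0 \<le> real_of_rat (prob I i)" "real_of_rat (prob I i) \<le> 1"
    using assms by (auto simp: wf_instance_def less_imp_le)
  have "input_pmf I = Pi_pmf (insert i ({..<nvars I} - {i})) False ?p"
    unfolding input_pmf_def using assms(2) by (simp add: insert_absorb)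
  also have "\<dots> = bind_pmf (?p i) (\<lambda>v. map_pmf (\<lambda>x. x(i := v)) ?R)"
    by (subst Pi_pmf_insert') (auto simp: map_pmf_def)
  finally have *: "input_pmf I = bind_pmf (?p i) (\<lambda>v. map_pmf (\<lambda>x. x(i := v)) ?R)" .
  have fin: "finite (set_pmf ?R)"
    by (rule finite_subset[OF set_Pi_pmf_subset']) (auto intro!: finite_PiE_dflt)
  have E: "expect I g = prob_of I i False * measure_pmf.expectation ?R (\<lambda>x. g (x(i := False)))
      + prob_of I i True * measure_pmf.expectation ?R (\<lambda>x. g (x(i := True)))" for g
    unfolding *
    by (subst pmf_expectation_bind[of UNIV]) (use p fin in \<open>auto simp: UNIV_bool prob_of_def of_rat_diff\<close>)
  have "expect I (\<lambda>x. f (x(i := v))) = measure_pmf.expectation ?R (\<lambda>x. f (x(i := v)))" for v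
    unfolding E using prob_of_sum[of I i] by (simp flip: distrib_right)
  then show ?thesis using E[of f] by simp
qed

subsection \<open>Runs of a strategy\<close>

definition test_cost :: "ltf_instance \<Rightarrow> strategy \<Rightarrow> (nat \<Rightarrow> bool) \<Rightarrow> real" where
  "test_cost I S x = (\<Sum>i\<leftarrow>tests S x. real_of_rat (cost I i))"

lemma expected_cost_eq: "expected_cost I S = expect I (test_cost I S)"
  by (simp add: expected_cost_def test_cost_def[abs_def])

lemma tests_properties:
  assumes "evaluates_from I b S"
  shows "distinct (tests S x)" "set (tests S x) \<subseteq> {i. i < nvars I \<and> b i = None}"
proof -
  have "distinct (tests S x) \<and> set (tests S x) \<subseteq> {i. i < nvars I \<and> b i = None}"
    using assms
  proof (induction S arbitrary: b)
    case (Test i S0 S1)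
    let ?S = "if x i then S1 else S0"
    have ev: "evaluates_from I (b(i \<mapsto> False)) S0" "evaluates_from I (b(i \<mapsto> True)) S1"
      using Test.prems by simp_all
    have "distinct (tests ?S x) \<and> set (tests ?S x) \<subseteq> {j. j < nvars I \<and> (b(i \<mapsto> x i)) j = None}"
      using Test.IH(1)[OF ev(1)] Test.IH(2)[OF ev(2)] by (cases "x i") (simp_all only: if_True if_False)
    then show ?case using Test.prems by (auto split: if_splits)
  qed simp
  then show "distinct (tests S x)" "set (tests S x) \<subseteq> {i. i < nvars I \<and> b i = None}" by auto
qed

lemma tests_known:
  assumes "evaluates_from I b S" "b i \<noteq> None"
  shows "tests S (x(i := v)) = tests S x"
  using assms
proof (induction S arbitrary: b)
  case (Test j S0 S1)
  then have neq: "i \<noteq> j" by auto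
  have ev: "evaluates_from I (b(j \<mapsto> False)) S0" "evaluates_from I (b(j \<mapsto> True)) S1"
    using Test.prems(1) by simp_all
  have known: "(b(j \<mapsto> u)) i \<noteq> None" for u using Test.prems(2) neq by simp
  have "(x(i := v)) j = x j" using neq by simp
  then show ?case
    using Test.IH(1)[OF ev(1) known] Test.IH(2)[OF ev(2) known]
    by (cases "x j") (simp_all only: tests.simps if_True if_False)
qed simp

text \<open>The runs on both inputs coincide until \<open>i\<close> is tested, and from then on
  \<open>i\<close> belongs to both lists.\<close>

lemma mem_tests_upd:
  assumes "evaluates_from I b S"
  shows "i \<in> set (tests S (x(i := v))) \<longleftrightarrow> i \<in> set (tests S x)"
  using assms
proof (induction S arbitrary: b)
  case (Test j S0 S1)
  have ev: "evaluates_from I (b(j \<mapsto> False)) S0" "evaluates_from I (b(j \<mapsto> True)) S1"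
    using Test.prems by simp_all
  have "i = j \<or> (x(i := v)) j = x j" by simp
  then show ?case
    using Test.IH(1)[OF ev(1)] Test.IH(2)[OF ev(2)]
    by (cases "x j") (auto simp del: fun_upd_apply)
qed simp

lemma tests_determine:
  assumes "evaluates_from I b S" "b \<subseteq>\<^sub>m total x"
  shows "all_determined I (\<lambda>i. if i \<in> set (tests S x) then Some (x i) else b i)"
  using assms
proof (induction S arbitrary: b)
  case (Test j S0 S1)
  let ?S = "if x j then S1 else S0"
  have b: "b(j \<mapsto> x j) \<subseteq>\<^sub>m total x" using map_leD[OF Test.prems(2)] by (auto simp: map_le_def)
  have ev: "evaluates_from I (b(j \<mapsto> False)) S0" "evaluates_from I (b(j \<mapsto> True)) S1"
    using Test.prems(1) by simp_all
  have "all_determined I (\<lambda>i. if i \<in> set (tests ?S x) then Some (x i) else (b(j \<mapsto> x j)) i)"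
    using ev b Test.IH(1)[of "b(j \<mapsto> False)"] Test.IH(2)[of "b(j \<mapsto> True)"]
    by (cases "x j") (simp_all only: if_True if_False)
  also have "(\<lambda>i. if i \<in> set (tests ?S x) then Some (x i) else (b(j \<mapsto> x j)) i) =
      (\<lambda>i. if i \<in> set (tests (Test j S0 S1) x) then Some (x i) else b i)"
    by auto
  finally show ?case .
qed simp

lemma test_cost_sum:
  assumes "evaluates_from I b S"
  shows "test_cost I S x = (\<Sum>i<nvars I. of_bool (i \<in> set (tests S x)) * real_of_rat (cost I i))"
proof -
  have "test_cost I S x = (\<Sum>i\<in>set (tests S x). real_of_rat (cost I i))"
    unfolding test_cost_def using tests_properties(1)[OF assms] by (rule sum_list_distinct_conv_sum_set)
  also have "\<dots> = (\<Sum>i<nvars I. of_bool (i \<in> set (tests S x)) * real_of_rat (cost I i))"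
    using tests_properties(2)[OF assms, of x] by (intro sum.mono_neutral_cong_left) auto
  finally show ?thesis .
qed

subsection \<open>The adaptive greedy strategy\<close>

definition expected_decrease :: "ltf_instance \<Rightarrow> (nat \<rightharpoonup> bool) \<Rightarrow> nat \<Rightarrow> rat" where
  "expected_decrease I b j =
     prob I j * of_int (decrease I b j True) + (1 - prob I j) * of_int (decrease I b j False)"

text \<open>Only positive expected decreases compete: division by zero yields 0, so a useless
  variable would otherwise look free.\<close>

definition greedy_choice :: "ltf_instance \<Rightarrow> (nat \<rightharpoonup> bool) \<Rightarrow> nat \<Rightarrow> bool" where
  "greedy_choice I b j \<longleftrightarrow> j < nvars I \<and> b j = None \<and> expected_decrease I b j > 0 \<and>
     (\<forall>i<nvars I. b i = None \<and> expected_decrease I b i > 0 \<longrightarrow>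
        cost I j / expected_decrease I b j \<le> cost I i / expected_decrease I b i)"

fun greedy_tree :: "ltf_instance \<Rightarrow> (nat \<rightharpoonup> bool) \<Rightarrow> strategy \<Rightarrow> bool" where
  "greedy_tree I b Stop \<longleftrightarrow> all_determined I b"
| "greedy_tree I b (Test j S0 S1) \<longleftrightarrow> \<not> all_determined I b \<and> greedy_choice I b j \<and>
     greedy_tree I (b(j \<mapsto> False)) S0 \<and> greedy_tree I (b(j \<mapsto> True)) S1"

lemma greedy_tree_evaluates: "greedy_tree I b S \<Longrightarrow> evaluates_from I b S"
  by (induction S arbitrary: b) (auto simp: greedy_choice_def)

section \<open>Prices along a greedy run\<close>

definition price :: "ltf_instance \<Rightarrow> (nat \<rightharpoonup> bool) \<Rightarrow> nat \<Rightarrow> real" where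
  "price I b j = real_of_rat (cost I j / expected_decrease I b j)"

lemma real_expected_decrease: "real_of_rat (expected_decrease I b j) =
    prob_of I j False * real_of_int (decrease I b j False) + prob_of I j True * real_of_int (decrease I b j True)"
  by (simp add: expected_decrease_def prob_of_def of_rat_add of_rat_mult of_rat_diff)

lemma price_expected_decrease:
  "greedy_choice I b j \<Longrightarrow> price I b j * real_of_rat (expected_decrease I b j) = real_of_rat (cost I j)"
  by (auto simp: price_def of_rat_divide greedy_choice_def)

lemma price_nonneg: "wf_instance I \<Longrightarrow> greedy_choice I b j \<Longrightarrow> price I b j \<ge> 0"
  by (auto simp: price_def greedy_choice_def wf_instance_def)

lemma expected_decrease_ge:
  assumes "wf_instance I" "j < nvars I" "b j = None"
  shows "prob_of I j v * real_of_int (decrease I b j v) \<le> real_of_rat (expected_decrease I b j)"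
proof -
  have "prob_of I j u * real_of_int (decrease I b j u) \<ge> 0" for u
    using wf_prob_of_pos[OF assms(1,2), of u] decrease_nonneg[of b j u I] assms(3) by simp
  from this[of True] this[of False] show ?thesis
    unfolding real_expected_decrease by (cases v) auto
qed

text \<open>The multiplied form of price minimality also covers variables with no expected decrease,
  to which no meaningful price is attached.\<close>

lemma price_mult_le:
  assumes "wf_instance I" "greedy_choice I b j" "i < nvars I" "b i = None"
  shows "price I b j * real_of_rat (expected_decrease I b i) \<le> real_of_rat (cost I i)"
proof (cases "expected_decrease I b i > 0")
  case True
  then have "cost I j / expected_decrease I b j \<le> cost I i / expected_decrease I b i"
    using assms by (auto simp: greedy_choice_def)
  then have "price I b j \<le> real_of_rat (cost I i) / real_of_rat (expected_decrease I b i)"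
    unfolding price_def by (metis of_rat_divide of_rat_less_eq)
  then show ?thesis using True by (simp add: field_simps)
next
  case False
  then have "real_of_rat (expected_decrease I b i) \<le> 0" by simp
  then have "price I b j * real_of_rat (expected_decrease I b i) \<le> 0"
    using price_nonneg[OF assms(1,2)] by (simp add: mult_nonneg_nonpos)
  also have "\<dots> \<le> real_of_rat (cost I i)" using assms by (auto simp: wf_instance_def)
  finally show ?thesis .
qed

lemma expected_decrease_antimono:
  assumes "wf_instance I" "i < nvars I" "b \<subseteq>\<^sub>m b'" "b' i = None"
  shows "real_of_rat (expected_decrease I b' i) \<le> real_of_rat (expected_decrease I b i)"
  unfolding real_expected_decrease
  using wf_prob_of_pos[OF assms(1,2)] decrease_antimono[OF assms(3), of i] assms(4)
  by (intro add_mono mult_left_mono) (auto intro: less_imp_le)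

text \<open>Along an arbitrary completion of \<open>b\<close> the positive residual is covered by
  single-test decreases, so one of them is positive. Its outcome has positive probability, hence the
  expected decrease is positive too.\<close>

lemma greedy_choice_exists:
  assumes "wf_instance I" "\<not> all_determined I b"
  shows "\<exists>j<nvars I. b j = None \<and> expected_decrease I b j > 0"
proof -
  define x where "x i = (case b i of None \<Rightarrow> False | Some v \<Rightarrow> v)" for i
  have x: "b \<subseteq>\<^sub>m total x" by (auto simp: map_le_def x_def)
  have "residual I b \<le> (\<Sum>j<nvars I. decrease I b j (x j))"
    using x by (intro residual_le_sum_decrease_certificate all_determined_total) auto
  moreover have "residual I b > 0"
    using residual_nonneg[of I b] assms(2) all_determined_iff[of I b] by simp
  ultimately obtain j where j: "j < nvars I" "decrease I b j (x j) > 0"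
    by (metis (no_types, lifting) lessThan_iff not_le order_less_le_trans sum_nonpos)
  have None: "b j = None"
    using map_le_totalD[OF x, of j] decrease_known[of b j "x j" I] j(2) by auto
  have "0 < prob_of I j (x j) * real_of_int (decrease I b j (x j))"
    using wf_prob_of_pos[OF assms(1) j(1), of "x j"] j(2) by simp
  also have "\<dots> \<le> real_of_rat (expected_decrease I b j)"
    using expected_decrease_ge[of I j b "x j"] assms(1) j(1) None by blast
  finally show ?thesis using j None by (intro exI[of _ j]) (simp add: zero_less_of_rat_iff)
qed

text \<open>The price of the greedy choice does not decrease along a run. \<open>potential\<close> adds up the price
  increases weighted with the residual; \<open>charge i\<close> weights them with the decrease of the residual
  that testing \<open>i\<close> would cause. They are the dual objective and the left-hand sides of the dual
  constraints of a linear program whose primal variables say which tests a strategy performs.\<close>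

fun potential :: "ltf_instance \<Rightarrow> (nat \<rightharpoonup> bool) \<Rightarrow> real \<Rightarrow> strategy \<Rightarrow> (nat \<Rightarrow> bool) \<Rightarrow> real" where
  "potential I b \<theta> Stop x = 0"
| "potential I b \<theta> (Test j S0 S1) x = (price I b j - \<theta>) * real_of_int (residual I b) +
     potential I (b(j \<mapsto> x j)) (price I b j) (if x j then S1 else S0) x"

fun charge :: "ltf_instance \<Rightarrow> nat \<Rightarrow> (nat \<rightharpoonup> bool) \<Rightarrow> real \<Rightarrow> strategy \<Rightarrow> (nat \<Rightarrow> bool) \<Rightarrow> real" where
  "charge I i b \<theta> Stop x = 0"
| "charge I i b \<theta> (Test j S0 S1) x = (price I b j - \<theta>) * real_of_int (decrease I b i (x i)) +
     charge I i (b(j \<mapsto> x j)) (price I b j) (if x j then S1 else S0) x"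

lemma potential_known:
  assumes "evaluates_from I b S" "b i \<noteq> None"
  shows "potential I b \<theta> S (x(i := v)) = potential I b \<theta> S x"
  using assms
proof (induction S arbitrary: b \<theta>)
  case (Test j S0 S1)
  then have neq: "i \<noteq> j" by auto
  have ev: "evaluates_from I (b(j \<mapsto> False)) S0" "evaluates_from I (b(j \<mapsto> True)) S1"
    using Test.prems(1) by simp_all
  have known: "(b(j \<mapsto> u)) i \<noteq> None" for u using Test.prems(2) neq by simp
  have "(x(i := v)) j = x j" using neq by simp
  then show ?case
    using Test.IH(1)[OF ev(1) known] Test.IH(2)[OF ev(2) known]
    by (cases "x j") (simp_all only: potential.simps if_True if_False)
qed simp

text \<open>Summation by parts: regrouping the weighted price increases multiplies each price by the
  decrease of the residual at its own test. In expectation this product is the cost of the tested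
  variable. Here \<open>\<theta>\<close> is the preceding price, which leaves the boundary term
  \<open>\<theta> * residual\<close>.\<close>

lemma expect_potential:
  assumes "wf_instance I" "greedy_tree I b S"
  shows "expect I (potential I b \<theta> S) = expect I (test_cost I S) - \<theta> * real_of_int (residual I b)"
  using assms(2)
proof (induction S arbitrary: b \<theta>)
  case Stop
  then show ?case by (simp add: test_cost_def[abs_def] all_determined_iff)
next
  case (Test j S0 S1)
  let ?\<theta> = "price I b j" and ?S = "\<lambda>v. if v then S1 else S0" and ?p = "prob_of I j"
  have j: "greedy_choice I b j" "j < nvars I" "b j = None"
    using Test.prems by (auto simp: greedy_choice_def)
  have tree: "greedy_tree I (b(j \<mapsto> v)) (?S v)" for v using Test.prems by (cases v) auto
  note ev = greedy_tree_evaluates[OF tree]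
  have IH: "expect I (potential I (b(j \<mapsto> v)) ?\<theta> (?S v)) =
      expect I (test_cost I (?S v)) - ?\<theta> * real_of_int (residual I (b(j \<mapsto> v)))" for v
    using Test.IH tree[of v] by (cases v) auto
  have pot: "expect I (\<lambda>x. potential I (b(j \<mapsto> x j)) ?\<theta> (?S (x j)) x) =
      ?p False * expect I (potential I (b(j \<mapsto> False)) ?\<theta> (?S False)) +
      ?p True * expect I (potential I (b(j \<mapsto> True)) ?\<theta> (?S True))"
    by (subst expect_split[OF assms(1) j(2)])
      (use potential_known[OF ev[of True], of j] potential_known[OF ev[of False], of j] in simp)
  have cost: "expect I (\<lambda>x. test_cost I (?S (x j)) x) =
      ?p False * expect I (test_cost I (?S False)) + ?p True * expect I (test_cost I (?S True))"
    by (subst expect_split[OF assms(1) j(2)])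
      (use tests_known[OF ev[of True], of j] tests_known[OF ev[of False], of j] in
        \<open>simp add: test_cost_def[abs_def]\<close>)
  have "expect I (potential I b \<theta> (Test j S0 S1)) = (?\<theta> - \<theta>) * real_of_int (residual I b) +
      expect I (\<lambda>x. potential I (b(j \<mapsto> x j)) ?\<theta> (?S (x j)) x)"
    unfolding potential.simps by (subst Bochner_Integration.integral_add) simp_all
  also have "\<dots> = expect I (\<lambda>x. test_cost I (?S (x j)) x) + ?\<theta> * (real_of_int (residual I b)
      - ?p False * real_of_int (residual I (b(j \<mapsto> False)))
      - ?p True * real_of_int (residual I (b(j \<mapsto> True)))) - \<theta> * real_of_int (residual I b)"
    unfolding pot cost IH by (simp add: algebra_simps)
  also have "real_of_int (residual I b) - ?p False * real_of_int (residual I (b(j \<mapsto> False)))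
      - ?p True * real_of_int (residual I (b(j \<mapsto> True))) = real_of_rat (expected_decrease I b j)"
  proof -
    have "?p False * real_of_int (residual I b) + ?p True * real_of_int (residual I b) = real_of_int (residual I b)"
      using prob_of_sum[of I j] by (simp flip: distrib_right)
    then show ?thesis unfolding real_expected_decrease decrease_def by (simp add: algebra_simps)
  qed
  also have "?\<theta> * real_of_rat (expected_decrease I b j) = real_of_rat (cost I j)"
    by (rule price_expected_decrease[OF j(1)])
  also have "expect I (\<lambda>x. test_cost I (?S (x j)) x) + real_of_rat (cost I j) =
      expect I (test_cost I (Test j S0 S1))"
    by (simp add: test_cost_def[abs_def])
  finally show ?case .
qed

text \<open>The last hypothesis is the invariant that no available variable is priced below
  \<open>\<theta>\<close>. It persists because the choice has minimal price and expected decreases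
  only shrink. Price increases are thus nonnegative and can multiply the covering inequality at
  every step.\<close>

lemma potential_le_charge:
  assumes "wf_instance I" "greedy_tree I b S" "b \<subseteq>\<^sub>m total x" "finite F"
    "all_determined I (\<lambda>i. if i \<in> F then Some (x i) else None)"
    "\<And>i. i < nvars I \<Longrightarrow> b i = None \<Longrightarrow> \<theta> * real_of_rat (expected_decrease I b i) \<le> real_of_rat (cost I i)"
  shows "potential I b \<theta> S x \<le> (\<Sum>i\<in>F. charge I i b \<theta> S x)"
  using assms(2,3,6)
proof (induction S arbitrary: b \<theta>)
  case (Test j S0 S1)
  let ?\<theta> = "price I b j" and ?S = "if x j then S1 else S0" and ?b = "b(j \<mapsto> x j)"
  have j: "greedy_choice I b j" "j < nvars I" "b j = None" "expected_decrease I b j > 0"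
    using Test.prems by (auto simp: greedy_choice_def)
  have tree: "greedy_tree I ?b ?S" using Test.prems(1) by (cases "x j") auto
  have b: "?b \<subseteq>\<^sub>m total x" using map_leD[OF Test.prems(2)] by (auto simp: map_le_def)
  have prices: "?\<theta> * real_of_rat (expected_decrease I ?b i) \<le> real_of_rat (cost I i)"
    if "i < nvars I" "?b i = None" for i
  proof -
    have "b i = None" using that by (auto split: if_splits)
    have "?\<theta> * real_of_rat (expected_decrease I ?b i) \<le> ?\<theta> * real_of_rat (expected_decrease I b i)"
      using that j(3) by (intro mult_left_mono price_nonneg expected_decrease_antimono assms(1) j(1)) (auto simp: map_le_def)
    also have "\<dots> \<le> real_of_rat (cost I i)"
      by (rule price_mult_le) fact+
    finally show ?thesis .
  qed
  have IH: "potential I ?b ?\<theta> ?S x \<le> (\<Sum>i\<in>F. charge I i ?b ?\<theta> ?S x)"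
    using Test.IH(1)[OF _ b prices] Test.IH(2)[OF _ b prices] tree
    by (cases "x j") (simp_all only: if_True if_False)
  have "\<theta> * real_of_rat (expected_decrease I b j) \<le> ?\<theta> * real_of_rat (expected_decrease I b j)"
    using Test.prems(3)[OF j(2,3)] price_expected_decrease[OF j(1)] by simp
  then have "\<theta> \<le> ?\<theta>" using j(4) by simp
  moreover have "real_of_int (residual I b) \<le> real_of_int (\<Sum>i\<in>F. decrease I b i (x i))"
    using residual_le_sum_decrease_certificate[OF assms(4) Test.prems(2) assms(5)] by linarith
  ultimately have "(?\<theta> - \<theta>) * real_of_int (residual I b) \<le> (?\<theta> - \<theta>) * real_of_int (\<Sum>i\<in>F. decrease I b i (x i))"
    by (intro mult_left_mono) auto
  then show ?case using IH by (simp add: sum.distrib sum_distrib_left)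
qed simp

text \<open>This bound on a single charge is where the logarithm comes from: the decrease \<open>d\<close> of the residual
  only shrinks along the run, and \<open>1 - d' / d \<le> ln d - ln d'\<close>.\<close>

lemma charge_le:
  assumes "wf_instance I" "greedy_tree I b S" "b \<subseteq>\<^sub>m total x" "i < nvars I"
  shows "if decrease I b i (x i) = 0 then charge I i b \<theta> S x = 0
    else prob_of I i (x i) * charge I i b \<theta> S x \<le> real_of_rat (cost I i) * (1 + ln (real_of_int (decrease I b i (x i))))
           - prob_of I i (x i) * \<theta> * real_of_int (decrease I b i (x i))"
  using assms(2,3)
proof (induction S arbitrary: b \<theta>)
  case Stop
  then have "decrease I b i (x i) = 0"
    using map_le_totalD[OF Stop.prems(2), of i] decrease_nonneg[of b i "x i" I] decrease_le_residual[of I b i "x i"]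
    by (simp add: all_determined_iff)
  then show ?case by simp
next
  case (Test j S0 S1)
  let ?\<theta> = "price I b j" and ?S = "if x j then S1 else S0" and ?b = "b(j \<mapsto> x j)"
  let ?p = "prob_of I i (x i)" and ?c = "real_of_rat (cost I i)"
  define d where "d = real_of_int (decrease I b i (x i))"
  define d' where "d' = real_of_int (decrease I ?b i (x i))"
  have j: "greedy_choice I b j" "b j = None"
    using Test.prems by (auto simp: greedy_choice_def)
  have tree: "greedy_tree I ?b ?S" using Test.prems(1) by (cases "x j") auto
  have b: "?b \<subseteq>\<^sub>m total x" using map_leD[OF Test.prems(2)] by (auto simp: map_le_def)
  have dd': "decrease I ?b i (x i) \<le> decrease I b i (x i)"
    using map_le_totalD[OF b, of i] j(2) by (intro decrease_antimono) (auto simp: map_le_def)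
  have d'0: "decrease I ?b i (x i) \<ge> 0"
    using map_le_totalD[OF b, of i] by (rule decrease_nonneg)
  have IH: "if d' = 0 then charge I i ?b ?\<theta> ?S x = 0
    else ?p * charge I i ?b ?\<theta> ?S x \<le> ?c * (1 + ln d') - ?p * ?\<theta> * d'"
    using Test.IH(1)[OF _ b, of ?\<theta>] Test.IH(2)[OF _ b, of ?\<theta>] tree unfolding d'_def of_int_eq_0_iff
    by (cases "x j") (simp_all only: if_True if_False True_implies_equals)
  have c0: "?c \<ge> 0" using assms(1,4) by (auto simp: wf_instance_def)
  show ?case
  proof (cases "decrease I b i (x i) = 0")
    case True
    then have "d' = 0" using dd' d'0 by (simp add: d'_def)
    then show ?thesis using True IH by simp
  next
    case False
    \<comment> \<open>A nonzero decrease is a positive integer, so \<open>ln d\<close> is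
      nonnegative.\<close>
    then have d1: "d \<ge> 1" using dd' d'0 by (simp add: d_def)
    have "b i = None"
      using False map_le_totalD[OF Test.prems(2), of i] decrease_known[of b i "x i" I] by auto
    then have "?p * d \<le> real_of_rat (expected_decrease I b i)"
      unfolding d_def by (rule expected_decrease_ge[OF assms(1,4)])
    then have "?\<theta> * (?p * d) \<le> ?\<theta> * real_of_rat (expected_decrease I b i)"
      by (intro mult_left_mono price_nonneg assms(1) j(1))
    also have "\<dots> \<le> ?c" by (rule price_mult_le) fact+
    finally have pd: "?p * ?\<theta> * d \<le> ?c" by (simp add: mult_ac)
    have "?p * ((?\<theta> - \<theta>) * d + charge I i ?b ?\<theta> ?S x) \<le> ?c * (1 + ln d) - ?p * \<theta> * d"
    proof (cases "d' = 0")
      case True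
      \<comment> \<open>This is the last step at which \<open>i\<close> is still useful; it is paid
        for by the summand 1 in \<open>1 + ln d\<close>.\<close>
      have "0 \<le> ?c * ln d" using c0 d1 by simp
      then show ?thesis using True IH pd by (simp add: algebra_simps)
    next
      case False
      then have d'1: "d' \<ge> 1" using d'0 by (simp add: d'_def)
      have le: "d' \<le> d" using dd' by (simp add: d_def d'_def)
      \<comment> \<open>The induction hypothesis already subtracts
        \<open>?p * ?\<theta> * d'\<close>, so only the fraction \<open>1 - d' / d\<close> of the
        cost remains to be charged at this step.\<close>
      have "?p * ?\<theta> * (d - d') = (?p * ?\<theta> * d) * (1 - d' / d)"
        using d1 by (simp add: field_simps)
      also have "\<dots> \<le> ?c * (1 - d' / d)"
        using pd le d1 by (intro mult_right_mono) (auto simp: field_simps)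
      also have "\<dots> \<le> ?c * (ln d - ln d')"
      proof (rule mult_left_mono[OF _ c0])
        have "ln (d' / d) \<le> d' / d - 1" using d1 d'1 by (intro ln_le_minus_one) simp
        then show "1 - d' / d \<le> ln d - ln d'" using d1 d'1 by (simp add: ln_div)
      qed
      finally show ?thesis using IH False by (simp add: algebra_simps)
    qed
    then show ?thesis using False by (simp add: d_def)
  qed
qed

theorem greedy_tree_cost_le:
  assumes wf: "wf_instance I" and greedy: "greedy_tree I Map.empty S" and S': "evaluates I S'"
    and P: "P \<ge> 1" "\<And>i v. i < nvars I \<Longrightarrow> real_of_int (decrease I Map.empty i v) \<le> P"
  shows "expected_cost I S \<le> 2 * (ln P + 1) * expected_cost I S'"
proof -
  let ?c = "\<lambda>i. real_of_rat (cost I i)" and ?t = "\<lambda>i x. of_bool (i \<in> set (tests S' x)) :: real"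
  let ?ch = "\<lambda>i. charge I i Map.empty 0 S"
  note ev = S'[unfolded evaluates_def]
  have ch: "?ch i x \<le> ?c i * (1 + ln P) / prob_of I i (x i)" if i: "i < nvars I" for i x
  proof (cases "decrease I Map.empty i (x i) = 0")
    case True
    have "0 \<le> ?c i * (1 + ln P) / prob_of I i (x i)"
      using wf i wf_prob_of_pos[OF wf i, of "x i"] P(1) by (auto simp: wf_instance_def)
    then show ?thesis using charge_le[OF wf greedy _ i, of x 0] True by simp
  next
    case False
    then have "decrease I Map.empty i (x i) \<ge> 1" using decrease_nonneg[of Map.empty i "x i" I] by simp
    then have "?c i * (1 + ln (real_of_int (decrease I Map.empty i (x i)))) \<le> ?c i * (1 + ln P)"
      using P(2)[OF i, of "x i"] wf i by (intro mult_left_mono) (auto simp: wf_instance_def)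
    then have "prob_of I i (x i) * ?ch i x \<le> ?c i * (1 + ln P)"
      using charge_le[OF wf greedy _ i, of x 0] False by simp
    then show ?thesis
      using wf_prob_of_pos[OF wf i, of "x i"] by (simp add: field_simps)
  qed
  have two: "expect I (\<lambda>x. ?t i x * (?c i * (1 + ln P) / prob_of I i (x i))) =
      2 * (ln P + 1) * expect I (\<lambda>x. ?t i x * ?c i)" if i: "i < nvars I" for i
  proof -
    have "expect I (\<lambda>x. ?t i x * (?c i * (1 + ln P) / prob_of I i (x i))) =
        (\<Sum>v\<in>{False, True}. prob_of I i v * expect I (\<lambda>x. ?t i x * (?c i * (1 + ln P) / prob_of I i v)))"
      by (subst expect_split[OF wf i]) (simp add: mem_tests_upd[OF ev])
    also have "\<dots> = (\<Sum>v\<in>{False, True}. (1 + ln P) * expect I (\<lambda>x. ?t i x * ?c i))"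
    proof (rule sum.cong)
      fix v
      have "expect I (\<lambda>x. ?t i x * (?c i * (1 + ln P) / prob_of I i v)) =
          expect I (\<lambda>x. (1 + ln P) / prob_of I i v * (?t i x * ?c i))"
        by (simp add: mult_ac)
      also have "\<dots> = (1 + ln P) / prob_of I i v * expect I (\<lambda>x. ?t i x * ?c i)"
        by (rule integral_mult_right_zero)
      finally show "prob_of I i v * expect I (\<lambda>x. ?t i x * (?c i * (1 + ln P) / prob_of I i v)) =
          (1 + ln P) * expect I (\<lambda>x. ?t i x * ?c i)"
        using wf_prob_of_pos[OF wf i, of v] by simp
    qed simp
    finally show ?thesis by simp
  qed
  have "expected_cost I S = expect I (potential I Map.empty 0 S)"
    by (simp add: expected_cost_eq expect_potential[OF wf greedy])
  also have "\<dots> \<le> expect I (\<lambda>x. \<Sum>i<nvars I. ?t i x * ?ch i x)"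
  proof (rule expect_mono)
    fix x
    \<comment> \<open>The competing strategy enters only through the set of variables it tests on
      \<open>x\<close>, which together determine all formulas.\<close>
    have "potential I Map.empty 0 S x \<le> (\<Sum>i\<in>set (tests S' x). ?ch i x)"
      using wf tests_determine[OF ev, of x]
      by (intro potential_le_charge[OF wf greedy]) (auto simp: wf_instance_def)
    also have "\<dots> = (\<Sum>i<nvars I. ?t i x * ?ch i x)"
      using tests_properties(2)[OF ev, of x] by (intro sum.mono_neutral_cong_left) auto
    finally show "potential I Map.empty 0 S x \<le> (\<Sum>i<nvars I. ?t i x * ?ch i x)" .
  qed
  also have "\<dots> \<le> expect I (\<lambda>x. \<Sum>i<nvars I. ?t i x * (?c i * (1 + ln P) / prob_of I i (x i)))"
    by (intro expect_mono sum_mono mult_left_mono ch) auto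
  also have "\<dots> = (\<Sum>i<nvars I. expect I (\<lambda>x. ?t i x * (?c i * (1 + ln P) / prob_of I i (x i))))"
    by (intro Bochner_Integration.integral_sum) simp
  also have "\<dots> = (\<Sum>i<nvars I. 2 * (ln P + 1) * expect I (\<lambda>x. ?t i x * ?c i))"
    using two by (intro sum.cong) auto
  also have "\<dots> = 2 * (ln P + 1) * expect I (\<lambda>x. \<Sum>i<nvars I. ?t i x * ?c i)"
    by (subst Bochner_Integration.integral_sum) (auto simp: sum_distrib_left)
  also have "\<dots> = 2 * (ln P + 1) * expected_cost I S'"
    unfolding expected_cost_eq test_cost_sum[OF ev, abs_def] ..
  finally show ?thesis .
qed

subsection \<open>The local ratio strategy\<close>

definition live_vars :: "ltf_instance \<Rightarrow> (nat \<rightharpoonup> bool) \<Rightarrow> nat \<Rightarrow> nat set" where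
  "live_vars I b k = {i. i < nvars I \<and> b i = None \<and> coef I k i \<noteq> 0}"

text \<open>\<open>R\<close> holds the reduced costs. Both subtrees must use the same formula \<open>k\<close>.\<close>

fun local_ratio_tree :: "ltf_instance \<Rightarrow> (nat \<rightharpoonup> bool) \<Rightarrow> (nat \<Rightarrow> rat) \<Rightarrow> strategy \<Rightarrow> bool" where
  "local_ratio_tree I b R Stop \<longleftrightarrow> all_determined I b"
| "local_ratio_tree I b R (Test j S0 S1) \<longleftrightarrow> \<not> all_determined I b \<and>
     (\<exists>k<nforms I. formula_residual I k b \<noteq> 0 \<and> j \<in> live_vars I b k \<and> (\<forall>i\<in>live_vars I b k. R j \<le> R i) \<and>
       local_ratio_tree I (b(j \<mapsto> False)) (\<lambda>i. if i \<in> live_vars I b k then R i - R j else R i) S0 \<and>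
       local_ratio_tree I (b(j \<mapsto> True)) (\<lambda>i. if i \<in> live_vars I b k then R i - R j else R i) S1)"

lemma local_ratio_tree_evaluates: "local_ratio_tree I b R S \<Longrightarrow> evaluates_from I b S"
  by (induction S arbitrary: b R) (auto simp: live_vars_def)

lemma finite_live_vars [simp]: "finite (live_vars I b k)"
  by (simp add: live_vars_def)

lemma card_live_vars_le:
  assumes "k < nforms I" shows "int (card (live_vars I b k)) \<le> D_max I"
proof -
  have "int (card (live_vars I b k)) = (\<Sum>i\<in>live_vars I b k. 1)" by simp
  also have "\<dots> \<le> (\<Sum>i\<in>live_vars I b k. \<bar>coef I k i\<bar>)"
    by (intro sum_mono) (auto simp: live_vars_def)
  also have "\<dots> \<le> D I k"
    unfolding D_def by (intro sum_mono2) (auto simp: live_vars_def)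
  also have "\<dots> \<le> D_max I"
    unfolding D_max_def using assms by (intro Max_ge) auto
  finally show ?thesis .
qed

text \<open>If \<open>F\<close> contained no live variable of \<open>k\<close>, then whatever
  \<open>F\<close> knows about the variables of formula \<open>k\<close> would be known to
  \<open>b\<close>, and \<open>b\<close> would decide the formula as well.\<close>

lemma certificate_meets_live_vars:
  assumes "b \<subseteq>\<^sub>m total x" "all_determined I (\<lambda>i. if i \<in> F then Some (x i) else None)"
    "k < nforms I" "formula_residual I k b \<noteq> 0"
  shows "F \<inter> live_vars I b k \<noteq> {}"
proof
  assume empty: "F \<inter> live_vars I b k = {}"
  let ?G = "\<lambda>i. if i \<in> F then Some (x i) else None"
  \<comment> \<open>Variables without influence on formula \<open>k\<close> are dropped, because
    \<open>F\<close> may contain some that \<open>b\<close> does not know.\<close>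
  let ?H = "\<lambda>i. if i < nvars I \<and> coef I k i \<noteq> 0 then ?G i else None"
  have "?H \<subseteq>\<^sub>m b"
    unfolding map_le_def
  proof
    fix i assume "i \<in> dom ?H"
    then have i: "i < nvars I" "coef I k i \<noteq> 0" "i \<in> F" by (auto split: if_splits)
    then have "b i \<noteq> None" using empty by (auto simp: live_vars_def)
    then show "?H i = b i" using map_le_totalD[OF assms(1), of i] i by auto
  qed
  then have "formula_residual I k b \<le> formula_residual I k ?H"
    by (rule formula_residual_antimono)
  also have "lo I k ?H = lo I k ?G" "hi I k ?H = hi I k ?G"
    unfolding lo_def hi_def by (auto intro!: sum.cong split: option.splits)
  then have "formula_residual I k ?H = formula_residual I k ?G"
    by (simp only: formula_residual_def)
  also have "formula_residual I k ?G = 0"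
    using assms(2,3) by (simp only: all_determined_iff_formula_residual)
  finally show False using assms(4) formula_residual_nonneg[of I k b] by simp
qed

text \<open>The costs split into \<open>R'\<close> and \<open>R j\<close> times the indicator of the
  live variables \<open>U\<close>. Under the indicator any set of tests costs at most
  \<open>card U\<close>, hence at most \<open>D_max\<close>, while \<open>F\<close> costs at least 1
  because it meets \<open>U\<close>. The rest is the induction hypothesis for \<open>R'\<close>, and
  factors survive addition of cost functions.\<close>

lemma local_ratio_tree_cost:
  assumes "local_ratio_tree I b R S" "b \<subseteq>\<^sub>m total x" "finite F"
    "all_determined I (\<lambda>i. if i \<in> F then Some (x i) else None)"
    "\<And>i. i < nvars I \<Longrightarrow> b i = None \<Longrightarrow> R i \<ge> 0" "F \<subseteq> {..<nvars I}" "nforms I \<ge> 1"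
  shows "(\<Sum>i\<in>set (tests S x). R i) \<le> of_int (D_max I) * (\<Sum>i\<in>{i\<in>F. b i = None}. R i)"
  using assms(1,2,5)
proof (induction S arbitrary: b R)
  case Stop
  have "(\<Sum>i\<in>{i\<in>F. b i = None}. R i) \<ge> 0"
    using Stop.prems(3) assms(6) by (intro sum_nonneg) auto
  moreover have "D_max I \<ge> 0"
    using card_live_vars_le[of 0 I b] assms(7) by simp
  ultimately show ?case by simp
next
  case (Test j S0 S1)
  let ?b = "b(j \<mapsto> x j)" and ?S = "if x j then S1 else S0"
  obtain k where k: "k < nforms I" "formula_residual I k b \<noteq> 0" "j \<in> live_vars I b k"
    "\<And>i. i \<in> live_vars I b k \<Longrightarrow> R j \<le> R i" and
    trees: "local_ratio_tree I (b(j \<mapsto> False)) (\<lambda>i. if i \<in> live_vars I b k then R i - R j else R i) S0"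
      "local_ratio_tree I (b(j \<mapsto> True)) (\<lambda>i. if i \<in> live_vars I b k then R i - R j else R i) S1"
    using Test.prems(1) unfolding local_ratio_tree.simps by blast
  define U where "U = live_vars I b k"
  define R' where "R' i = (if i \<in> U then R i - R j else R i)" for i
  have tree: "local_ratio_tree I ?b R' ?S"
    using trees unfolding R'_def U_def by (cases "x j") (simp_all only: if_True if_False)
  have b: "?b \<subseteq>\<^sub>m total x" using map_leD[OF Test.prems(2)] by (auto simp: map_le_def)
  have R': "R' i \<ge> 0" if "i < nvars I" "?b i = None" for i
    using that k(4)[of i] Test.prems(3)[of i] by (auto simp: R'_def U_def split: if_splits)
  have IH: "(\<Sum>i\<in>set (tests ?S x). R' i) \<le> of_int (D_max I) * (\<Sum>i\<in>{i\<in>F. ?b i = None}. R' i)"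
    using Test.IH(1)[OF _ b R'] Test.IH(2)[OF _ b R'] tree
    by (cases "x j") (simp_all only: if_True if_False True_implies_equals)
  have R_eq: "(\<Sum>i\<in>A. R i) = (\<Sum>i\<in>A. R' i) + R j * of_nat (card (A \<inter> U))" if "finite A" for A
  proof -
    have "(\<Sum>i\<in>A. R i) = (\<Sum>i\<in>A. R' i + (if i \<in> U then R j else 0))"
      by (intro sum.cong) (auto simp: R'_def)
    also have "\<dots> = (\<Sum>i\<in>A. R' i) + R j * of_nat (card (A \<inter> U))"
      using that by (simp add: sum.distrib sum.If_cases Int_def)
    finally show ?thesis .
  qed
  have jU: "j \<in> U" "j < nvars I" "b j = None" using k(3) by (auto simp: U_def live_vars_def)
  have Rj: "R j \<ge> 0" using Test.prems(3) jU by blast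
  \<comment> \<open>Under the reduced costs \<open>j\<close> is free. Hence its test adds nothing to
    the left-hand sum, and its disappearance from the unknown part of \<open>F\<close> changes
    nothing on the right.\<close>
  have R'j: "R' j = 0" using jU by (simp add: R'_def)
  have notin: "j \<notin> set (tests ?S x)"
    using tests_properties(2)[OF local_ratio_tree_evaluates[OF tree], of x] by auto
  have "card (set (tests (Test j S0 S1) x) \<inter> U) \<le> card U"
    by (intro card_mono) (auto simp: U_def)
  then have U: "rat_of_nat (card (set (tests (Test j S0 S1) x) \<inter> U)) \<le> of_int (D_max I)"
    using card_live_vars_le[OF k(1), of b] unfolding U_def
    by (metis (no_types, lifting) of_int_le_iff of_int_of_nat_eq of_nat_mono order_trans)
  have "F \<inter> U \<noteq> {}"
    unfolding U_def using certificate_meets_live_vars[OF Test.prems(2) assms(4) k(1,2)] .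
  then have "{i\<in>F. b i = None} \<inter> U \<noteq> {}"
    by (auto simp: U_def live_vars_def)
  then have F: "card ({i\<in>F. b i = None} \<inter> U) \<ge> 1"
    using assms(3) by (simp add: Suc_le_eq card_gt_0_iff)
  have "(\<Sum>i\<in>set (tests (Test j S0 S1) x). R i) =
      (\<Sum>i\<in>insert j (set (tests ?S x)). R' i) + R j * of_nat (card (set (tests (Test j S0 S1) x) \<inter> U))"
    by (subst R_eq) simp_all
  also have "(\<Sum>i\<in>insert j (set (tests ?S x)). R' i) = (\<Sum>i\<in>set (tests ?S x). R' i)"
    using notin R'j by simp
  also have "(\<Sum>i\<in>set (tests ?S x). R' i) + R j * of_nat (card (set (tests (Test j S0 S1) x) \<inter> U))
      \<le> of_int (D_max I) * (\<Sum>i\<in>{i\<in>F. ?b i = None}. R' i) + R j * of_int (D_max I)"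
    by (intro add_mono IH mult_left_mono U Rj)
  also have "(\<Sum>i\<in>{i\<in>F. ?b i = None}. R' i) = (\<Sum>i\<in>{i\<in>F. b i = None}. R' i)"
    using assms(3) R'j by (intro sum.mono_neutral_left) auto
  also have "of_int (D_max I) * (\<Sum>i\<in>{i\<in>F. b i = None}. R' i) + R j * of_int (D_max I) =
      of_int (D_max I) * ((\<Sum>i\<in>{i\<in>F. b i = None}. R' i) + R j * 1)"
    by (simp add: algebra_simps)
  also have "\<dots> \<le> of_int (D_max I) * ((\<Sum>i\<in>{i\<in>F. b i = None}. R' i)
      + R j * of_nat (card ({i\<in>F. b i = None} \<inter> U)))"
  proof (intro mult_left_mono add_left_mono Rj)
    show "0 \<le> rat_of_int (D_max I)" using card_live_vars_le[OF k(1), of b] by simp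
    show "1 \<le> rat_of_nat (card ({i\<in>F. b i = None} \<inter> U))" using F by linarith
  qed
  also have "\<dots> = of_int (D_max I) * (\<Sum>i\<in>{i\<in>F. b i = None}. R i)"
    using assms(3) by (subst R_eq[of "{i\<in>F. b i = None}"]) simp_all
  finally show ?case .
qed

theorem local_ratio_tree_cost_le:
  assumes wf: "wf_instance I" and tree: "local_ratio_tree I Map.empty (cost I) S" and S': "evaluates I S'"
  shows "expected_cost I S \<le> real_of_int (D_max I) * expected_cost I S'"
proof -
  note ev = local_ratio_tree_evaluates[OF tree] and ev' = S'[unfolded evaluates_def]
  have cost: "test_cost I S x = real_of_rat (\<Sum>i\<in>set (tests S x). cost I i)"
    if "evaluates_from I b S" for S b x
    unfolding test_cost_def using tests_properties(1)[OF that]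
    by (simp add: sum_list_distinct_conv_sum_set of_rat_sum)
  have "test_cost I S x \<le> real_of_int (D_max I) * test_cost I S' x" for x
  proof -
    have "(\<Sum>i\<in>set (tests S x). cost I i) \<le>
        of_int (D_max I) * (\<Sum>i\<in>set (tests S' x). cost I i)"
      using wf tests_determine[OF ev', of x] tests_properties(2)[OF ev', of x]
        local_ratio_tree_cost[OF tree, of x "set (tests S' x)"]
      by (auto simp: wf_instance_def)
    then have "real_of_rat (\<Sum>i\<in>set (tests S x). cost I i) \<le>
        real_of_rat (of_int (D_max I) * (\<Sum>i\<in>set (tests S' x). cost I i))"
      by (subst of_rat_less_eq) simp
    then show ?thesis by (simp add: cost[OF ev] cost[OF ev'] of_rat_mult)
  qed
  then have "expect I (test_cost I S) \<le> expect I (\<lambda>x. real_of_int (D_max I) * test_cost I S' x)"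
    by (rule expect_mono)
  then show ?thesis by (simp add: expected_cost_eq)
qed

subsection \<open>Programs that test variables in a loop\<close>

fun val_nat :: "val \<Rightarrow> nat" where
  "val_nat (Num r) = nat \<lfloor>r\<rfloor>"
| "val_nat (Node u v) = 0"

text \<open>\<open>n\<close> is fuel that makes the recursion total. Each iteration reveals one
  variable, so fuel equal to the number of unknown variables is never exhausted before all formulas
  are determined.\<close>

fun loop_tree :: "(val \<Rightarrow> val) \<Rightarrow> (val \<Rightarrow> val) \<Rightarrow> (val \<Rightarrow> val) \<Rightarrow> nat \<Rightarrow> val \<Rightarrow> strategy" where
  "loop_tree c h u 0 s = Stop"
| "loop_tree c h u (Suc n) s = (if c s = Num 0 then Stop else
     Test (val_nat (h s)) (loop_tree c h u n (u (Node s (Num 0)))) (loop_tree c h u n (u (Node s (Num 1)))))"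

text \<open>The encoding lists one cost per variable. This bounds both the number of iterations and
  the bit length of a tested index.\<close>

lemma nvars_le_size: "nvars I \<le> val_size (encode_instance I)"
proof -
  have "nvars I \<le> val_size (encode_list (map (\<lambda>i. Num (cost I i)) [0..<nvars I]))"
    using length_decode_list_le[of "encode_list (map (\<lambda>i. Num (cost I i)) [0..<nvars I])"] by simp
  then show ?thesis by (simp add: encode_instance_def)
qed

definition unknowns :: "ltf_instance \<Rightarrow> (nat \<rightharpoonup> bool) \<Rightarrow> nat set" where
  "unknowns I b = {i. i < nvars I \<and> b i = None}"

lemma card_unknowns_upd:
  assumes "j < nvars I" "b j = None"
  shows "card (unknowns I b) = Suc (card (unknowns I (b(j \<mapsto> v))))"
proof -
  have "unknowns I b = insert j (unknowns I (b(j \<mapsto> v)))" "j \<notin> unknowns I (b(j \<mapsto> v))"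
    using assms by (auto simp: unknowns_def)
  moreover have "finite (unknowns I (b(j \<mapsto> v)))" by (simp add: unknowns_def)
  ultimately show ?thesis by simp
qed

lemma all_determined_no_unknowns: "card (unknowns I b) = 0 \<Longrightarrow> all_determined I b"
proof (rule all_determined_total)
  assume "card (unknowns I b) = 0"
  moreover have "finite (unknowns I b)" by (simp add: unknowns_def)
  ultimately show "\<forall>i<nvars I. b i \<noteq> None" by (auto simp: unknowns_def)
qed

text \<open>\<open>c\<close> is the loop condition, \<open>h\<close> the index of the variable to be tested, and \<open>u\<close> maps
  \<open>Node state outcome\<close> to the next state. \<open>inv I b s\<close> says that the state \<open>s\<close> represents the partial
  assignment \<open>b\<close>, and \<open>B\<close> bounds the size of such states.\<close>

locale testing_loop =
  fixes init c h u ans :: "val \<Rightarrow> val" and B :: "val \<Rightarrow> nat"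
    and inv :: "ltf_instance \<Rightarrow> (nat \<rightharpoonup> bool) \<Rightarrow> val \<Rightarrow> bool"
  assumes ptimes: "ptime init" "ptime c" "ptime h" "ptime u" "ptime ans" "poly_bounded B"
    and inv_init: "\<And>I. wf_instance I \<Longrightarrow> inv I Map.empty (init (encode_instance I))"
    and inv_size: "\<And>I b s. wf_instance I \<Longrightarrow> inv I b s \<Longrightarrow> val_size s \<le> B (encode_instance I)"
    and inv_stop: "\<And>I b s. wf_instance I \<Longrightarrow> inv I b s \<Longrightarrow> c s = Num 0 \<longleftrightarrow> all_determined I b"
    and inv_step: "\<And>I b s. wf_instance I \<Longrightarrow> inv I b s \<Longrightarrow> \<not> all_determined I b \<Longrightarrow>
      \<exists>j<nvars I. b j = None \<and> h s = Num (of_nat j) \<and> (\<forall>v. inv I (b(j \<mapsto> v)) (u (Node s (Num (of_bool v)))))"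
    and inv_ans: "\<And>I b s x. wf_instance I \<Longrightarrow> inv I b s \<Longrightarrow> all_determined I b \<Longrightarrow> b \<subseteq>\<^sub>m total x \<Longrightarrow>
      ans s = encode_answer I x"
begin

definition algorithm :: "ltf_instance \<Rightarrow> strategy" where
  "algorithm I = loop_tree c h u (nvars I) (init (encode_instance I))"

lemma loop_tree_evaluates:
  assumes "wf_instance I" "inv I b s" "card (unknowns I b) \<le> n"
  shows "evaluates_from I b (loop_tree c h u n s)"
  using assms(2,3)
proof (induction n arbitrary: b s)
  case 0
  then show ?case by (simp add: all_determined_no_unknowns)
next
  case (Suc n)
  show ?case
  proof (cases "all_determined I b")
    case True
    then show ?thesis using inv_stop[OF assms(1) Suc.prems(1)] by simp
  next
    case False
    obtain j where j: "j < nvars I" "b j = None" "h s = Num (of_nat j)"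
      "\<And>v. inv I (b(j \<mapsto> v)) (u (Node s (Num (of_bool v))))"
      using inv_step[OF assms(1) Suc.prems(1) False] by blast
    have le: "card (unknowns I (b(j \<mapsto> v))) \<le> n" for v
      using card_unknowns_upd[of j I b v, OF j(1,2)] Suc.prems(2) by simp
    show ?thesis
      using Suc.IH[OF j(4) le, of True] Suc.IH[OF j(4) le, of False]
        inv_stop[OF assms(1) Suc.prems(1)] False j(1-3) by (simp del: fun_upd_apply)
  qed
qed

lemma poly_time_algorithm: "poly_time_algorithm algorithm"
proof -
  obtain ei ti where ei: "poly_bounded ti" "\<And>x v \<rho>. runs x (v # \<rho>) ei (init v) (ti v)"
    by (rule ptimeE[OF ptimes(1)]) (rule that)
  obtain ec tc where ec: "poly_bounded tc" "\<And>x v \<rho>. runs x (v # \<rho>) ec (c v) (tc v)"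
    by (rule ptimeE[OF ptimes(2)]) (rule that)
  obtain eh th where eh: "poly_bounded th" "\<And>x v \<rho>. runs x (v # \<rho>) eh (h v) (th v)"
    by (rule ptimeE[OF ptimes(3)]) (rule that)
  obtain eu tu where eu: "poly_bounded tu" "\<And>x v \<rho>. runs x (v # \<rho>) eu (u v) (tu v)"
    by (rule ptimeE[OF ptimes(4)]) (rule that)
  obtain ea ta where ea: "poly_bounded ta" "\<And>x v \<rho>. runs x (v # \<rho>) ea (ans v) (ta v)"
    by (rule ptimeE[OF ptimes(5)]) (rule that)
  obtain qc where qc: "\<And>v. tc v \<le> poly qc (val_size v)" using ec(1) unfolding poly_bounded_def by blast
  obtain qh where qh: "\<And>v. th v \<le> poly qh (val_size v)" using eh(1) unfolding poly_bounded_def by blast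
  obtain qu where qu: "\<And>v. tu v \<le> poly qu (val_size v)" using eu(1) unfolding poly_bounded_def by blast
  obtain qa where qa: "\<And>v. ta v \<le> poly qa (val_size v)" using ea(1) unfolding poly_bounded_def by blast
  define body where "body = LetE (TestE eh) (LetE (BinE MkNode (VarE 1) (VarE 0)) eu)"
  \<comment> \<open>\<open>K\<close> bounds one iteration. The state has size at most
    \<open>B v\<close>, pairing it with the outcome bit adds at most 4, and
    \<open>val_size v\<close> pays for the index handed to \<open>TestE\<close>.\<close>
  define K where "K v = 10 + poly qc (B v) + poly qh (B v) + poly qu (B v + 4) + val_size v" for v
  have loop: "\<exists>s' b' t. run x (s # \<rho>) (WhileE ec body) s' (tests (loop_tree c h u n s) x) t \<and>
      inv I b' s' \<and> b' \<subseteq>\<^sub>m total x \<and> all_determined I b' \<and> t \<le> (n + 1) * K (encode_instance I)"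
    if wf: "wf_instance I" and "inv I b s" "b \<subseteq>\<^sub>m total x" "card (unknowns I b) \<le> n" for I b s x n \<rho>
    using that(2-)
  proof (induction n arbitrary: b s)
    case 0
    then have det: "all_determined I b" by (simp add: all_determined_no_unknowns)
    then have "c s = Num 0" using inv_stop[OF wf 0(1)] by simp
    then obtain t where t: "run x (s # \<rho>) ec (Num 0) [] t" "t \<le> tc s"
      using ec(2)[of x s \<rho>] by (auto elim: runsE)
    have "tc s \<le> poly qc (B (encode_instance I))"
      using qc[of s] poly_nat_mono[OF inv_size[OF wf 0(1)], of qc] by linarith
    then show ?case
      using run.WhileFalse[OF t(1), of body] det 0 t(2)
      by (intro exI[of _ s] exI[of _ b] exI[of _ "t + 1"]) (simp add: K_def)
  next
    case (Suc n)
    have size: "val_size s \<le> B (encode_instance I)" by (rule inv_size[OF wf Suc.prems(1)])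
    obtain t1 where t1: "run x (s # \<rho>) ec (c s) [] t1" "t1 \<le> tc s"
      using ec(2)[of x s \<rho>] by (auto elim: runsE)
    have tc: "tc s \<le> poly qc (B (encode_instance I))"
      using qc[of s] poly_nat_mono[OF size, of qc] by linarith
    show ?case
    proof (cases "all_determined I b")
      case True
      then have c0: "c s = Num 0" using inv_stop[OF wf Suc.prems(1)] by simp
      show ?thesis
        using run.WhileFalse[OF t1(1)[unfolded c0], of body] True Suc.prems t1(2) tc c0
        by (intro exI[of _ s] exI[of _ b] exI[of _ "t1 + 1"]) (simp add: K_def)
    next
      case False
      then have c0: "c s \<noteq> Num 0" using inv_stop[OF wf Suc.prems(1)] by simp
      obtain j where j: "j < nvars I" "b j = None" "h s = Num (of_nat j)"
        "\<And>v. inv I (b(j \<mapsto> v)) (u (Node s (Num (of_bool v))))"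
        using inv_step[OF wf Suc.prems(1) False] by blast
      let ?w = "Node s (Num (of_bool (x j)))"
      obtain t2 where t2: "run x (s # \<rho>) eh (Num (of_nat j)) [] t2" "t2 \<le> th s"
        using eh(2)[of x s \<rho>] unfolding j(3) by (auto elim: runsE)
      have th: "th s \<le> poly qh (B (encode_instance I))"
        using qh[of s] poly_nat_mono[OF size, of qh] by linarith
      have test: "run x (s # \<rho>) (TestE eh) (Num (of_bool (x j))) [j] (t2 + rat_bits (of_nat j) + 1)"
        using run.TestE[OF t2(1)] by simp
      have "runs x (Num (of_bool (x j)) # s # \<rho>) (LetE (BinE MkNode (VarE 1) (VarE 0)) eu) (u ?w)
          ((1 + 1 + 1) + tu ?w + 1)"
        using runs_Var[of 1 "Num (of_bool (x j)) # s # \<rho>" x]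
        by (intro runs_Let[OF runs_Node[OF _ runs_Var0] eu(2)]) simp
      then obtain t3 where t3: "run x (Num (of_bool (x j)) # s # \<rho>)
          (LetE (BinE MkNode (VarE 1) (VarE 0)) eu) (u ?w) [] t3" "t3 \<le> tu ?w + 4"
        by (elim runsE) simp
      have "val_size ?w \<le> B (encode_instance I) + 4"
        using size rat_bits_arith(5)[of "x j"] by simp
      then have tu: "tu ?w \<le> poly qu (B (encode_instance I) + 4)"
        using qu[of ?w] poly_nat_mono[of "val_size ?w" "B (encode_instance I) + 4" qu] by linarith
      have body: "run x (s # \<rho>) body (u ?w) [j] (t2 + rat_bits (of_nat j) + 1 + t3 + 1)"
        using run.LetE[OF test t3(1)] unfolding body_def by simp
      have b': "b(j \<mapsto> x j) \<subseteq>\<^sub>m total x"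
        using map_leD[OF Suc.prems(2)] by (auto simp: map_le_def)
      have "card (unknowns I (b(j \<mapsto> x j))) \<le> n"
        using card_unknowns_upd[of j I b "x j", OF j(1,2)] Suc.prems(3) by simp
      from Suc.IH[OF j(4) b' this] obtain s' b'' t where
        IH: "run x (u ?w # \<rho>) (WhileE ec body) s' (tests (loop_tree c h u n (u ?w)) x) t"
        "inv I b'' s'" "b'' \<subseteq>\<^sub>m total x" "all_determined I b''" "t \<le> (n + 1) * K (encode_instance I)"
        by blast
      have tests: "tests (loop_tree c h u (Suc n) s) x = [] @ [j] @ tests (loop_tree c h u n (u ?w)) x"
        using c0 j(3) by (cases "x j") simp_all
      have "rat_bits (of_nat j) \<le> val_size (encode_instance I)"
        using rat_bits_of_nat[of j] j(1) nvars_le_size[of I] by linarith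
      then have "t1 + (t2 + rat_bits (of_nat j) + 1 + t3 + 1) + t + 1 \<le> (Suc n + 1) * K (encode_instance I)"
        using t1(2) tc t2(2) th t3(2) tu IH(5) by (simp add: K_def)
      then show ?thesis
        using run.WhileTrue[OF t1(1) c0 body IH(1)] IH(2-4) unfolding tests by blast
    qed
  qed
  define g where "g v = ti v + ((val_size v + 1) * K v + poly qa (B v) + 1) + 1" for v
  have "poly_bounded g"
    unfolding g_def K_def using ei(1) ptimes(6) by (intro pb_intros)
  then obtain q where q: "\<And>v. g v \<le> poly q (val_size v)" unfolding poly_bounded_def by blast
  have "\<exists>t\<le>poly q (val_size (encode_instance I)). run x [encode_instance I]
      (LetE ei (LetE (WhileE ec body) ea)) (encode_answer I x) (tests (algorithm I) x) t"
    if wf: "wf_instance I" for I x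
  proof -
    let ?v = "encode_instance I"
    obtain t1 where t1: "run x [?v] ei (init ?v) [] t1" "t1 \<le> ti ?v"
      using ei(2)[of x ?v "[]"] by (auto elim: runsE)
    have "card (unknowns I Map.empty) \<le> nvars I" by (simp add: unknowns_def)
    from loop[OF wf inv_init[OF wf] _ this, of x "[?v]"] obtain s b t2 where
      t2: "run x [init ?v, ?v] (WhileE ec body) s (tests (algorithm I) x) t2"
      "inv I b s" "b \<subseteq>\<^sub>m total x" "all_determined I b" "t2 \<le> (nvars I + 1) * K ?v"
      by (auto simp: algorithm_def)
    have "ans s = encode_answer I x" by (rule inv_ans[OF wf t2(2,4,3)])
    then obtain t3 where t3: "run x (s # [init ?v, ?v]) ea (encode_answer I x) [] t3" "t3 \<le> ta s"
      using ea(2)[of x s "[init ?v, ?v]"] by (auto elim: runsE)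
    have "ta s \<le> poly qa (B ?v)"
      using qa[of s] poly_nat_mono[OF inv_size[OF wf t2(2)], of qa] by linarith
    moreover have "(nvars I + 1) * K ?v \<le> (val_size ?v + 1) * K ?v"
      using nvars_le_size[of I] by (intro mult_le_mono1) simp
    ultimately have "t1 + (t2 + t3 + 1) + 1 \<le> g ?v"
      using t1(2) t2(5) t3(2) unfolding g_def by linarith
    then have "t1 + (t2 + t3 + 1) + 1 \<le> poly q (val_size ?v)" using q[of ?v] by linarith
    then show ?thesis
      using run.LetE[OF t1(1) run.LetE[OF t2(1) t3(1)]] by auto
  qed
  moreover have "evaluates I (algorithm I)" if "wf_instance I" for I
    unfolding evaluates_def algorithm_def
    by (rule loop_tree_evaluates[OF that inv_init[OF that]]) (simp add: unknowns_def)
  ultimately show ?thesis unfolding poly_time_algorithm_def by blast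
qed

end

subsection \<open>Computing the residual\<close>

text \<open>A partial assignment is a list of the numbers 0, 1 and, for untested variables, 2.\<close>

definition entry :: "bool option \<Rightarrow> rat" where
  "entry o' = (case o' of None \<Rightarrow> 2 | Some v \<Rightarrow> of_bool v)"

definition enc_assignment :: "ltf_instance \<Rightarrow> (nat \<rightharpoonup> bool) \<Rightarrow> val" where
  "enc_assignment I b = encode_list (map (\<lambda>i. Num (entry (b i))) [0..<nvars I])"

definition enc_row :: "ltf_instance \<Rightarrow> nat \<Rightarrow> val" where
  "enc_row I k = encode_list (map (\<lambda>i. Num (of_int (coef I k i))) [0..<nvars I])"

text \<open>The argument is \<open>Node coefficient entry\<close>; an entry above 1 is the mark of
  an untested variable.\<close>

definition low_term :: "val \<Rightarrow> val" where
  "low_term w = (if binop_val Less (Num 1) (vright w) \<noteq> Num 0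
     then (if binop_val Less (vleft w) (Num 0) \<noteq> Num 0 then vleft w else Num 0)
     else binop_val Mul (vleft w) (vright w))"

definition high_term :: "val \<Rightarrow> val" where
  "high_term w = (if binop_val Less (Num 1) (vright w) \<noteq> Num 0
     then (if binop_val Less (Num 0) (vleft w) \<noteq> Num 0 then vleft w else Num 0)
     else binop_val Mul (vleft w) (vright w))"

definition low_val :: "val \<Rightarrow> val" where
  "low_val w = sum_val (map_val low_term (zip_vals (vleft w) (vright w)))"

definition high_val :: "val \<Rightarrow> val" where
  "high_val w = sum_val (map_val high_term (zip_vals (vleft w) (vright w)))"

definition pos_part :: "val \<Rightarrow> val" where
  "pos_part v = (if binop_val Less (Num 0) v \<noteq> Num 0 then v else Num 0)"

text \<open>Argument: \<open>Node (Node row threshold) assignment\<close>.\<close>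

definition formula_residual_val :: "val \<Rightarrow> val" where
  "formula_residual_val w = binop_val Mul
     (pos_part (binop_val Sub (vright (vleft w)) (low_val (Node (vleft (vleft w)) (vright w)))))
     (pos_part (binop_val Add (binop_val Sub (high_val (Node (vleft (vleft w)) (vright w))) (vright (vleft w))) (Num 1)))"

definition formulas_val :: "val \<Rightarrow> val" where
  "formulas_val v = zip_vals (vleft (vright (vright v))) (vleft (vright (vright (vright v))))"

text \<open>Argument: \<open>Node instance assignment\<close>.\<close>

definition residual_val :: "val \<Rightarrow> val" where
  "residual_val w = sum_val (map_val (\<lambda>f. formula_residual_val (Node f (vright w))) (formulas_val (vleft w)))"

text \<open>Argument: \<open>Node assignment (Node index bit)\<close>.\<close>

definition set_val :: "val \<Rightarrow> val" where
  "set_val w = map_val (\<lambda>y. if binop_val Less (vleft y) (vleft (vright w)) \<noteq> Num 0 then vright y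
       else if binop_val Less (vleft (vright w)) (vleft y) \<noteq> Num 0 then vright y else vright (vright w))
     (zip_vals (index_val (vleft w)) (vleft w))"

text \<open>For a determined formula the comparison of \<open>lo\<close> with the threshold is its
  value: if there is no certificate for \<open>True\<close>, there must be one for
  \<open>False\<close>.\<close>

definition answer_val :: "val \<Rightarrow> val" where
  "answer_val w = map_val (\<lambda>f. if binop_val Less (low_val (Node (vleft f) (vright w))) (vright f) \<noteq> Num 0
       then Num 0 else Num 1) (formulas_val (vleft w))"

lemma ptime_low_term [ptime_intros]: "ptime f \<Longrightarrow> ptime (\<lambda>v. low_term (f v))"
  by (erule ptime_compose[rotated]) (unfold low_term_def, intro ptime_intros)

lemma ptime_high_term [ptime_intros]: "ptime f \<Longrightarrow> ptime (\<lambda>v. high_term (f v))"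
  by (erule ptime_compose[rotated]) (unfold high_term_def, intro ptime_intros)

lemma ptime_low_val [ptime_intros]: "ptime f \<Longrightarrow> ptime (\<lambda>v. low_val (f v))"
  by (erule ptime_compose[rotated]) (unfold low_val_def, intro ptime_intros)

lemma ptime_high_val [ptime_intros]: "ptime f \<Longrightarrow> ptime (\<lambda>v. high_val (f v))"
  by (erule ptime_compose[rotated]) (unfold high_val_def, intro ptime_intros)

lemma ptime_pos_part [ptime_intros]: "ptime f \<Longrightarrow> ptime (\<lambda>v. pos_part (f v))"
  by (erule ptime_compose[rotated]) (unfold pos_part_def, intro ptime_intros)

lemma ptime_formula_residual_val [ptime_intros]: "ptime f \<Longrightarrow> ptime (\<lambda>v. formula_residual_val (f v))"
  by (erule ptime_compose[rotated]) (unfold formula_residual_val_def, intro ptime_intros)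

lemma ptime_formulas_val [ptime_intros]: "ptime f \<Longrightarrow> ptime (\<lambda>v. formulas_val (f v))"
  by (erule ptime_compose[rotated]) (unfold formulas_val_def, intro ptime_intros)

lemma ptime_residual_val [ptime_intros]: "ptime f \<Longrightarrow> ptime (\<lambda>v. residual_val (f v))"
  by (erule ptime_compose[rotated]) (unfold residual_val_def, intro ptime_intros)

lemma ptime_set_val [ptime_intros]: "ptime f \<Longrightarrow> ptime (\<lambda>v. set_val (f v))"
  by (erule ptime_compose[rotated]) (unfold set_val_def, intro ptime_intros)

lemma ptime_answer_val [ptime_intros]: "ptime f \<Longrightarrow> ptime (\<lambda>v. answer_val (f v))"
  by (erule ptime_compose[rotated]) (unfold answer_val_def, intro ptime_intros)

lemma low_term_eq: "low_term (Node (Num (of_int a)) (Num (entry o'))) =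
    Num (of_int (case o' of None \<Rightarrow> min a 0 | Some v \<Rightarrow> a * of_bool v))"
  by (auto simp: low_term_def entry_def split: option.split)

lemma high_term_eq: "high_term (Node (Num (of_int a)) (Num (entry o'))) =
    Num (of_int (case o' of None \<Rightarrow> max a 0 | Some v \<Rightarrow> a * of_bool v))"
  by (auto simp: high_term_def entry_def split: option.split)

lemma low_val_eq: "low_val (Node (enc_row I k) (enc_assignment I b)) = Num (of_int (lo I k b))"
  by (simp add: low_val_def enc_row_def enc_assignment_def low_term_eq sum_val_map sum_list_upt lo_def
      del: of_int_sum) simp

lemma high_val_eq: "high_val (Node (enc_row I k) (enc_assignment I b)) = Num (of_int (hi I k b))"
  by (simp add: high_val_def enc_row_def enc_assignment_def high_term_eq sum_val_map sum_list_upt hi_def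
      del: of_int_sum) simp

lemma pos_part_eq: "pos_part (Num (of_int a)) = Num (of_int (max 0 a))"
  by (simp add: pos_part_def)

lemma formula_residual_val_eq:
  "formula_residual_val (Node (Node (enc_row I k) (Num (of_int (thr I k)))) (enc_assignment I b)) =
    Num (of_int (formula_residual I k b))"
  using pos_part_eq[of "thr I k - lo I k b"] pos_part_eq[of "hi I k b - thr I k + 1"]
  by (simp add: formula_residual_val_def low_val_eq high_val_eq formula_residual_def)

lemma formulas_val_eq:
  "formulas_val (encode_instance I) = encode_list (map (\<lambda>k. Node (enc_row I k) (Num (of_int (thr I k)))) [0..<nforms I])"
  by (simp add: formulas_val_def encode_instance_def enc_row_def)

lemma residual_val_eq:
  "residual_val (Node (encode_instance I) (enc_assignment I b)) = Num (of_int (residual I b))"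
  by (simp add: residual_val_def formulas_val_eq formula_residual_val_eq sum_val_map sum_list_upt residual_def)

lemma set_val_eq:
  "set_val (Node (enc_assignment I b) (Node (Num (of_nat j)) (Num (of_bool v)))) = enc_assignment I (b(j \<mapsto> v))"
  unfolding set_val_def enc_assignment_def unop_val.simps index_val_map zip_vals_map map_val_map
  by (intro arg_cong[of _ _ encode_list] map_cong refl) (auto simp: entry_def)

lemma answer_val_eq:
  assumes "all_determined I b" "b \<subseteq>\<^sub>m total x"
  shows "answer_val (Node (encode_instance I) (enc_assignment I b)) = encode_answer I x"
proof -
  have "formula_value I k x \<longleftrightarrow> thr I k \<le> lo I k b" if "k < nforms I" for k
    using assms(1) that formula_value_bounds[OF assms(2), of I k]
    unfolding all_determined_def certificate_True_iff certificate_False_iff by auto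
  then show ?thesis
    by (simp add: answer_val_def encode_answer_def formulas_val_eq low_val_eq)
      (intro arg_cong[of _ _ encode_list] map_cong, auto)
qed

lemma val_size_enc_assignment_le: "val_size (enc_assignment I b) \<le> 2 + nvars I * (5 + 1)"
proof -
  have "rat_bits 2 \<le> 3" using rat_bits_of_nat[of 2] by simp
  then have "val_size (Num (entry o')) \<le> 5" for o'
    using rat_bits_arith(5)[of "the o'"] by (auto simp: entry_def split: option.split)
  then have "val_size (enc_assignment I b) \<le> 2 + length (map (\<lambda>i. Num (entry (b i))) [0..<nvars I]) * (5 + 1)"
    unfolding enc_assignment_def by (intro val_size_encode_list_le) auto
  then show ?thesis by simp
qed

text \<open>The selected field is the cost list; it merely supplies a list with one entry per
  variable.\<close>

definition initial_assignment_val :: "val \<Rightarrow> val" where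
  "initial_assignment_val v = map_val (\<lambda>_. Num 2) (vleft (vright (vright (vright (vright (vright v))))))"

lemma ptime_initial_assignment_val [ptime_intros]:
  "ptime f \<Longrightarrow> ptime (\<lambda>v. initial_assignment_val (f v))"
  by (erule ptime_compose[rotated]) (unfold initial_assignment_val_def, intro ptime_intros)

lemma initial_assignment_val_eq:
  "initial_assignment_val (encode_instance I) = enc_assignment I Map.empty"
  by (simp add: initial_assignment_val_def encode_instance_def enc_assignment_def entry_def)

subsection \<open>The greedy program\<close>

text \<open>The loop state is \<open>Node instance assignment\<close>. Argument of \<open>decrease_val\<close>: \<open>Node state (Node index bit)\<close>.
  Argument of \<open>expected_decrease_val\<close>: \<open>Node state (Node (Node index entry) (Node probability cost))\<close>.\<close>

definition decrease_val :: "val \<Rightarrow> val" where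
  "decrease_val w = binop_val Sub (residual_val (vleft w))
     (residual_val (Node (vleft (vleft w)) (set_val (Node (vright (vleft w)) (vright w)))))"

definition expected_decrease_val :: "val \<Rightarrow> val" where
  "expected_decrease_val w = (if binop_val Less (Num 1) (vright (vleft (vright w))) \<noteq> Num 0
     then binop_val Add
       (binop_val Mul (vleft (vright (vright w)))
          (decrease_val (Node (vleft w) (Node (vleft (vleft (vright w))) (Num 1)))))
       (binop_val Mul (binop_val Sub (Num 1) (vleft (vright (vright w))))
          (decrease_val (Node (vleft w) (Node (vleft (vleft (vright w))) (Num 0)))))
     else Num 0)"

text \<open>Tested variables are assigned expected decrease 0, so a single filter removes them along
  with the useless ones. The key for \<open>argmin_val\<close> is the price, the payload the
  index.\<close>

definition greedy_val :: "val \<Rightarrow> val" where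
  "greedy_val s = vright (argmin_val
     (map_val (\<lambda>y. Node (binop_val Div (vright (vleft y)) (vleft (vleft y))) (vright y))
       (filter_val (\<lambda>y. binop_val Less (Num 0) (vleft (vleft y)))
         (map_val (\<lambda>y. Node (Node (expected_decrease_val (Node s y)) (vright (vright y))) (vleft (vleft y)))
           (zip_vals (zip_vals (index_val (vright s)) (vright s))
              (zip_vals (vleft (vright (vright (vright (vright (vleft s))))))
                 (vleft (vright (vright (vright (vright (vright (vleft s)))))))))))))"

lemma ptime_decrease_val [ptime_intros]: "ptime f \<Longrightarrow> ptime (\<lambda>v. decrease_val (f v))"
  by (erule ptime_compose[rotated]) (unfold decrease_val_def, intro ptime_intros)

lemma ptime_expected_decrease_val [ptime_intros]: "ptime f \<Longrightarrow> ptime (\<lambda>v. expected_decrease_val (f v))"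
  by (erule ptime_compose[rotated]) (unfold expected_decrease_val_def, intro ptime_intros)

lemma ptime_greedy_val [ptime_intros]: "ptime f \<Longrightarrow> ptime (\<lambda>v. greedy_val (f v))"
  by (erule ptime_compose[rotated]) (unfold greedy_val_def, intro ptime_intros)

abbreviation greedy_state :: "ltf_instance \<Rightarrow> (nat \<rightharpoonup> bool) \<Rightarrow> val" where
  "greedy_state I b \<equiv> Node (encode_instance I) (enc_assignment I b)"

lemma decrease_val_eq:
  "decrease_val (Node (greedy_state I b) (Node (Num (of_nat j)) (Num (of_bool v)))) = Num (of_int (decrease I b j v))"
  by (simp add: decrease_val_def residual_val_eq set_val_eq decrease_def)

lemma expected_decrease_val_eq:
  "expected_decrease_val (Node (greedy_state I b) (Node (Node (Num (of_nat j)) (Num (entry (b j)))) (Node (Num (prob I j)) (Num c)))) =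
     Num (if b j = None then expected_decrease I b j else 0)"
  using decrease_val_eq[of I b j True] decrease_val_eq[of I b j False]
  by (auto simp: expected_decrease_val_def expected_decrease_def entry_def split: option.split)

lemma greedy_val_eq:
  assumes "wf_instance I" "\<not> all_determined I b"
  obtains j where "greedy_choice I b j" "greedy_val (greedy_state I b) = Num (of_nat j)"
proof -
  let ?e = "\<lambda>j. if b j = None then expected_decrease I b j else 0"
  let ?js = "filter (\<lambda>j. 0 < ?e j) [0..<nvars I]"
  have eq: "greedy_val (greedy_state I b) =
      vright (argmin_val (encode_list (map (\<lambda>j. Node (Num (cost I j / ?e j)) (Num (of_nat j))) ?js)))"
    using expected_decrease_val_eq[of I b]
    by (simp add: greedy_val_def encode_instance_def[of I] enc_assignment_def[of I b] cong: filter_cong)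
  have "?js \<noteq> []"
    using greedy_choice_exists[OF assms] by (auto simp: filter_empty_conv)
  then obtain j where j: "j \<in> set ?js" "\<And>i. i \<in> set ?js \<Longrightarrow> cost I j / ?e j \<le> cost I i / ?e i"
    "argmin_val (encode_list (map (\<lambda>j. Node (Num (cost I j / ?e j)) (Num (of_nat j))) ?js)) =
       Node (Num (cost I j / ?e j)) (Num (of_nat j))"
    using argmin_val_map[of ?js "\<lambda>j. cost I j / ?e j" "\<lambda>j. Num (of_nat j)"] by blast
  show ?thesis
  proof
    show "greedy_val (greedy_state I b) = Num (of_nat j)" unfolding eq j(3) by simp
    have "cost I j / expected_decrease I b j \<le> cost I i / expected_decrease I b i"
      if "i < nvars I" "b i = None" "expected_decrease I b i > 0" for i
      using j(1) j(2)[of i] that by (auto split: if_splits)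
    then show "greedy_choice I b j"
      using j(1) unfolding greedy_choice_def by (auto split: if_splits)
  qed
qed

definition greedy_init :: "val \<Rightarrow> val" where
  "greedy_init v = Node v (initial_assignment_val v)"

definition greedy_update :: "val \<Rightarrow> val" where
  "greedy_update w = Node (vleft (vleft w))
     (set_val (Node (vright (vleft w)) (Node (greedy_val (vleft w)) (vright w))))"

interpretation greedy: testing_loop greedy_init residual_val greedy_val greedy_update answer_val
  "\<lambda>v. val_size v + 3 + val_size v * 6" "\<lambda>I b s. s = greedy_state I b"
proof
  show "ptime greedy_init" "ptime residual_val" "ptime greedy_val" "ptime greedy_update" "ptime answer_val"
    unfolding greedy_init_def greedy_update_def by (intro ptime_intros)+
  show "poly_bounded (\<lambda>v. val_size v + 3 + val_size v * 6)" by (intro pb_intros)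
  fix I b s x
  assume wf: "wf_instance I"
  show "greedy_init (encode_instance I) = greedy_state I Map.empty"
    by (simp add: greedy_init_def initial_assignment_val_eq)
  assume s: "s = greedy_state I b"
  show "val_size s \<le> val_size (encode_instance I) + 3 + val_size (encode_instance I) * 6"
    using val_size_enc_assignment_le[of I b] nvars_le_size[of I] by (simp add: s)
  show "(residual_val s = Num 0) = all_determined I b"
    by (simp add: s residual_val_eq all_determined_iff)
  show "answer_val s = encode_answer I x" if "all_determined I b" "b \<subseteq>\<^sub>m total x"
    unfolding s by (rule answer_val_eq[OF that])
  assume nd: "\<not> all_determined I b"
  obtain j where j: "greedy_choice I b j" "greedy_val (greedy_state I b) = Num (of_nat j)"
    using greedy_val_eq[OF wf nd] .
  then show "\<exists>j<nvars I. b j = None \<and> greedy_val s = Num (of_nat j) \<and>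
      (\<forall>v. greedy_update (Node s (Num (of_bool v))) = greedy_state I (b(j \<mapsto> v)))"
    unfolding s by (intro exI[of _ j]) (auto simp: greedy_choice_def greedy_update_def set_val_eq simp del: fun_upd_apply)
qed

lemma greedy_tree_loop_tree:
  assumes "wf_instance I" "card (unknowns I b) \<le> n"
  shows "greedy_tree I b (loop_tree residual_val greedy_val greedy_update n (greedy_state I b))"
  using assms(2)
proof (induction n arbitrary: b)
  case 0
  then show ?case by (simp add: all_determined_no_unknowns)
next
  case (Suc n)
  show ?case
  proof (cases "all_determined I b")
    case True
    then show ?thesis by (simp add: residual_val_eq all_determined_iff)
  next
    case False
    obtain j where j: "greedy_choice I b j" "greedy_val (greedy_state I b) = Num (of_nat j)"
      using greedy_val_eq[OF assms(1) False] .
    have j': "j < nvars I" "b j = None" using j(1) by (auto simp: greedy_choice_def)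
    have upd: "greedy_update (Node (greedy_state I b) (Num (of_bool v))) = greedy_state I (b(j \<mapsto> v))" for v
      by (simp add: greedy_update_def j(2) set_val_eq)
    have le: "card (unknowns I (b(j \<mapsto> v))) \<le> n" for v
      using card_unknowns_upd[of j I b v, OF j'] Suc.prems by simp
    show ?thesis
      using False j Suc.IH[OF le[of True]] Suc.IH[OF le[of False]] upd[of True] upd[of False]
      by (simp add: residual_val_eq all_determined_iff del: fun_upd_apply)
  qed
qed

lemma greedy_tree_algorithm: "wf_instance I \<Longrightarrow> greedy_tree I Map.empty (greedy.algorithm I)"
  unfolding greedy.algorithm_def greedy.inv_init
  by (rule greedy_tree_loop_tree) (simp_all add: unknowns_def)

subsection \<open>The local ratio program\<close>

text \<open>The loop state is \<open>Node instance (Node reduced_costs assignment)\<close>; the elements of \<open>columns_val\<close>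
  are \<open>Node (Node index entry) (Node reduced_cost coefficient)\<close>.\<close>

definition formula_val :: "val \<Rightarrow> val" where
  "formula_val s = vleft (filter_val (\<lambda>f. formula_residual_val (Node f (vright (vright s)))) (formulas_val (vleft s)))"

text \<open>Applied to one column. \<open>Less\<close> is the only comparison of the language, so a
  nonzero coefficient is recognised as negative or positive.\<close>

definition live_val :: "val \<Rightarrow> val" where
  "live_val y = (if binop_val Less (Num 1) (vright (vleft y)) \<noteq> Num 0
     then (if binop_val Less (vright (vright y)) (Num 0) \<noteq> Num 0 then Num 1
       else binop_val Less (Num 0) (vright (vright y)))
     else Num 0)"

definition columns_val :: "val \<Rightarrow> val" where
  "columns_val s = zip_vals (zip_vals (index_val (vright (vright s))) (vright (vright s)))
     (zip_vals (vleft (vright s)) (vleft (formula_val s)))"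

definition cheapest_val :: "val \<Rightarrow> val" where
  "cheapest_val s = argmin_val (map_val (\<lambda>y. Node (vleft (vright y)) (vleft (vleft y)))
     (filter_val live_val (columns_val s)))"

definition local_ratio_choice :: "val \<Rightarrow> val" where
  "local_ratio_choice s = vright (cheapest_val s)"

definition local_ratio_update :: "val \<Rightarrow> val" where
  "local_ratio_update w = Node (vleft (vleft w)) (Node
     (map_val (\<lambda>y. if live_val y \<noteq> Num 0 then binop_val Sub (vleft (vright y)) (vleft (cheapest_val (vleft w)))
        else vleft (vright y)) (columns_val (vleft w)))
     (set_val (Node (vright (vright (vleft w))) (Node (local_ratio_choice (vleft w)) (vright w)))))"

definition local_ratio_init :: "val \<Rightarrow> val" where
  "local_ratio_init v = Node v (Node (vleft (vright (vright (vright (vright (vright v)))))) (initial_assignment_val v))"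

definition local_ratio_residual :: "val \<Rightarrow> val" where
  "local_ratio_residual s = residual_val (Node (vleft s) (vright (vright s)))"

definition local_ratio_answer :: "val \<Rightarrow> val" where
  "local_ratio_answer s = answer_val (Node (vleft s) (vright (vright s)))"

lemma ptime_formula_val [ptime_intros]: "ptime f \<Longrightarrow> ptime (\<lambda>v. formula_val (f v))"
  by (erule ptime_compose[rotated]) (unfold formula_val_def, intro ptime_intros)

lemma ptime_live_val [ptime_intros]: "ptime f \<Longrightarrow> ptime (\<lambda>v. live_val (f v))"
  by (erule ptime_compose[rotated]) (unfold live_val_def, intro ptime_intros)

lemma ptime_columns_val [ptime_intros]: "ptime f \<Longrightarrow> ptime (\<lambda>v. columns_val (f v))"
  by (erule ptime_compose[rotated]) (unfold columns_val_def, intro ptime_intros)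

lemma ptime_cheapest_val [ptime_intros]: "ptime f \<Longrightarrow> ptime (\<lambda>v. cheapest_val (f v))"
  by (erule ptime_compose[rotated]) (unfold cheapest_val_def, intro ptime_intros)

lemma ptime_local_ratio_choice [ptime_intros]: "ptime f \<Longrightarrow> ptime (\<lambda>v. local_ratio_choice (f v))"
  by (erule ptime_compose[rotated]) (unfold local_ratio_choice_def, intro ptime_intros)

definition local_ratio_state :: "ltf_instance \<Rightarrow> (nat \<rightharpoonup> bool) \<Rightarrow> (nat \<Rightarrow> rat) \<Rightarrow> val" where
  "local_ratio_state I b R = Node (encode_instance I)
     (Node (encode_list (map (\<lambda>i. Num (R i)) [0..<nvars I])) (enc_assignment I b))"

text \<open>\<open>k\<close> is the first undecided formula and \<open>j\<close> the cheapest of its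
  live variables. Both are functions of the state alone, fixed before the outcome \<open>v\<close>,
  as the common formula of the two subtrees requires.\<close>

lemma local_ratio_state_step:
  assumes "\<not> all_determined I b"
  obtains k j where "k < nforms I" "formula_residual I k b \<noteq> 0" "j \<in> live_vars I b k"
    "\<And>i. i \<in> live_vars I b k \<Longrightarrow> R j \<le> R i"
    "local_ratio_choice (local_ratio_state I b R) = Num (of_nat j)"
    "\<And>v. local_ratio_update (Node (local_ratio_state I b R) (Num (of_bool v))) =
       local_ratio_state I (b(j \<mapsto> v)) (\<lambda>i. if i \<in> live_vars I b k then R i - R j else R i)"
proof -
  let ?s = "local_ratio_state I b R"
  let ?ks = "filter (\<lambda>k. formula_residual I k b \<noteq> 0) [0..<nforms I]"
  define k where "k = hd ?ks"
  have ne: "?ks \<noteq> []"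
    using assms by (auto simp: all_determined_iff_formula_residual filter_empty_conv)
  have ks: "k \<in> set ?ks" unfolding k_def by (rule hd_in_set[OF ne])
  have ks': "?ks = k # tl ?ks" unfolding k_def by (rule list.collapse[OF ne, symmetric])
  from ks have k: "k < nforms I" "formula_residual I k b \<noteq> 0" by simp_all
  have "formula_val ?s = vleft (encode_list (map (\<lambda>k. Node (enc_row I k) (Num (of_int (thr I k)))) ?ks))"
    by (simp add: formula_val_def local_ratio_state_def formulas_val_eq formula_residual_val_eq)
  also have "\<dots> = Node (enc_row I k) (Num (of_int (thr I k)))"
    by (subst ks') simp
  finally have form: "formula_val ?s = Node (enc_row I k) (Num (of_int (thr I k)))" .
  let ?col = "\<lambda>i. Node (Node (Num (of_nat i)) (Num (entry (b i)))) (Node (Num (R i)) (Num (of_int (coef I k i))))"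
  have col: "columns_val ?s = encode_list (map ?col [0..<nvars I])"
    by (simp add: columns_val_def form) (simp add: local_ratio_state_def enc_assignment_def enc_row_def)
  have live: "live_val (?col i) \<noteq> Num 0 \<longleftrightarrow> i \<in> live_vars I b k" if "i < nvars I" for i
    using that by (auto simp: live_val_def live_vars_def entry_def split: option.split)
  let ?js = "filter (\<lambda>i. i \<in> live_vars I b k) [0..<nvars I]"
  have "filter (\<lambda>i. live_val (?col i) \<noteq> Num 0) [0..<nvars I] = ?js"
    using live by (intro filter_cong) auto
  then have cheapest: "cheapest_val ?s = argmin_val (encode_list (map (\<lambda>i. Node (Num (R i)) (Num (of_nat i))) ?js))"
    unfolding cheapest_val_def col filter_val_map map_val_map by simp
  \<comment> \<open>Any completion of \<open>b\<close> serves: knowing all variables decides every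
    formula, so formula \<open>k\<close> has a live variable and the list of candidates is
    nonempty.\<close>
  define x where "x i = (case b i of None \<Rightarrow> False | Some v \<Rightarrow> v)" for i
  have "b \<subseteq>\<^sub>m total x" by (auto simp: map_le_def x_def)
  moreover have "all_determined I (\<lambda>i. if i \<in> {..<nvars I} then Some (x i) else None)"
    by (rule all_determined_total) auto
  ultimately have "{..<nvars I} \<inter> live_vars I b k \<noteq> {}"
    by (rule certificate_meets_live_vars[OF _ _ k])
  then have "?js \<noteq> []" by (auto simp: filter_empty_conv)
  then obtain j where j: "j \<in> set ?js" "\<And>i. i \<in> set ?js \<Longrightarrow> R j \<le> R i"
    "argmin_val (encode_list (map (\<lambda>i. Node (Num (R i)) (Num (of_nat i))) ?js)) = Node (Num (R j)) (Num (of_nat j))"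
    using argmin_val_map[of ?js R "\<lambda>i. Num (of_nat i)"] by blast
  have choice: "local_ratio_choice ?s = Num (of_nat j)"
    by (simp add: local_ratio_choice_def cheapest j(3))
  show ?thesis
  proof (rule that[OF k _ _ choice])
    show "j \<in> live_vars I b k" using j(1) by simp
    show "R j \<le> R i" if "i \<in> live_vars I b k" for i
      using j(2)[of i] that by (auto simp: live_vars_def)
    show "local_ratio_update (Node ?s (Num (of_bool v))) =
       local_ratio_state I (b(j \<mapsto> v)) (\<lambda>i. if i \<in> live_vars I b k then R i - R j else R i)" for v
    proof -
      have "map_val (\<lambda>y. if live_val y \<noteq> Num 0 then binop_val Sub (vleft (vright y)) (vleft (cheapest_val ?s))
          else vleft (vright y)) (columns_val ?s) =
          encode_list (map (\<lambda>i. Num (if i \<in> live_vars I b k then R i - R j else R i)) [0..<nvars I])"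
        unfolding col map_val_map cheapest j(3)
        by (intro arg_cong[of _ _ encode_list] map_cong refl) (use live in auto)
      then show ?thesis
        unfolding local_ratio_update_def unop_val.simps choice
        by (simp add: local_ratio_state_def set_val_eq del: fun_upd_apply of_bool_eq)
    qed
  qed
qed

text \<open>The plain product is short enough: its length is at most 1 plus the sum of the
  denominator lengths.\<close>

definition cost_denominator :: "ltf_instance \<Rightarrow> int" where
  "cost_denominator I = (\<Prod>i<nvars I. snd (quotient_of (cost I i)))"

text \<open>The reduced costs are differences of costs, hence have a common denominator of polynomial
  bit length.\<close>

definition reduced_costs :: "ltf_instance \<Rightarrow> (nat \<Rightarrow> rat) \<Rightarrow> bool" where
  "reduced_costs I R \<longleftrightarrow> (\<forall>i<nvars I. 0 \<le> R i \<and> R i \<le> cost I i \<and> R i * of_int (cost_denominator I) \<in> \<int>)"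

lemma reduced_costs_cost:
  assumes "wf_instance I" shows "reduced_costs I (cost I)"
proof -
  have "cost I i * of_int (cost_denominator I) \<in> \<int>" if "i < nvars I" for i
  proof -
    obtain a d where q: "quotient_of (cost I i) = (a, d)" by fastforce
    have "cost I i * of_int d = of_int a"
      using quotient_of_div[OF q] quotient_of_denom_pos[OF q] by simp
    moreover have "cost_denominator I = d * (\<Prod>i\<in>{..<nvars I} - {i}. snd (quotient_of (cost I i)))"
      unfolding cost_denominator_def using that q by (subst prod.remove[of _ i]) auto
    ultimately have "cost I i * of_int (cost_denominator I) =
        of_int (a * (\<Prod>i\<in>{..<nvars I} - {i}. snd (quotient_of (cost I i))))"
      by (simp flip: mult.assoc del: of_int_prod)
    then show ?thesis by (simp only: Ints_of_int)
  qed
  then show ?thesis using assms by (auto simp: reduced_costs_def wf_instance_def)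
qed

lemma reduced_costs_step:
  assumes "reduced_costs I R" "j \<in> live_vars I b k" "\<And>i. i \<in> live_vars I b k \<Longrightarrow> R j \<le> R i"
  shows "reduced_costs I (\<lambda>i. if i \<in> live_vars I b k then R i - R j else R i)"
proof -
  have "j < nvars I" using assms(2) by (simp add: live_vars_def)
  then have j: "0 \<le> R j" "R j * of_int (cost_denominator I) \<in> \<int>"
    using assms(1) by (auto simp: reduced_costs_def)
  have "0 \<le> R i - R j \<and> R i - R j \<le> cost I i \<and> (R i - R j) * of_int (cost_denominator I) \<in> \<int>"
    if "i < nvars I" "i \<in> live_vars I b k" for i
    using assms(1) assms(3)[OF that(2)] that(1) j
    by (auto simp: reduced_costs_def left_diff_distrib intro: Ints_diff order_trans[of _ "R i"])
  then show ?thesis using assms(1) by (auto simp: reduced_costs_def)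
qed

lemma floorlog_cost_denominator:
  "cost_denominator I > 0"
  "floorlog 2 (nat (cost_denominator I)) \<le> 1 + (\<Sum>i<nvars I. denom_bits (cost I i))"
proof -
  have pos: "snd (quotient_of r) > 0" for r
    using quotient_of_denom_pos[of r] by (metis prod.collapse)
  have "0 < (\<Prod>i<n. snd (quotient_of (cost I i))) \<and>
    floorlog 2 (nat (\<Prod>i<n. snd (quotient_of (cost I i)))) \<le> 1 + (\<Sum>i<n. denom_bits (cost I i))" for n
  proof (induction n)
    case (Suc n)
    let ?P = "\<Prod>i<n. snd (quotient_of (cost I i))"
    have "nat (?P * snd (quotient_of (cost I n))) = nat ?P * nat (snd (quotient_of (cost I n)))"
      using Suc by (simp add: nat_mult_distrib)
    then show ?case
      using Suc pos[of "cost I n"] floorlog2_mult_le[of "nat ?P" "nat (snd (quotient_of (cost I n)))"]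
      by (simp add: denom_bits_def)
  qed (simp add: floorlog_def)
  then show "cost_denominator I > 0"
    "floorlog 2 (nat (cost_denominator I)) \<le> 1 + (\<Sum>i<nvars I. denom_bits (cost I i))"
    unfolding cost_denominator_def by blast+
qed

text \<open>Iterating the general bound for subtraction could double the length in every round.
  Instead \<open>R i\<close> is written as \<open>z\<close> over the common denominator, where
  \<open>0 \<le> R i \<le> cost I i\<close> confines \<open>z\<close> between 0 and the numerator of
  the cost times that denominator.\<close>

lemma reduced_costs_bits:
  assumes "reduced_costs I R" "i < nvars I"
  shows "rat_bits (R i) \<le> 3 * val_size (encode_instance I) + 2"
proof -
  let ?M = "cost_denominator I" and ?N = "val_size (encode_instance I)"
  have R: "0 \<le> R i" "R i \<le> cost I i" using assms by (auto simp: reduced_costs_def)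
  have M: "?M > 0" by (rule floorlog_cost_denominator)
  obtain z where z: "R i * of_int ?M = of_int z"
    using assms by (auto simp: reduced_costs_def elim: Ints_cases)
  have "R i = of_int z / of_int ?M" using z M by (simp add: field_simps)
  note bits = quotient_bits_le[OF this]
  obtain a d where q: "cost I i = of_int a / of_int d" "d > 0" "numer_bits (cost I i) = floorlog 2 (nat \<bar>a\<bar>)"
    by (rule rat_eq_quotient)
  have z0: "z \<ge> 0"
    using z R(1) M by (metis mult_nonneg_nonneg of_int_0_le_iff less_imp_le)
  have a0: "a \<ge> 0"
    using R q(1,2) by (metis order_trans of_int_0_le_iff of_int_0_less_iff zero_le_divide_iff not_le)
  have "rat_of_int z \<le> of_int a / of_int d * of_int ?M"
    unfolding z[symmetric] q(1)[symmetric] using R(2) M by (intro mult_right_mono) auto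
  also have "\<dots> \<le> of_int a * of_int ?M"
    using q(2) a0 M by (intro mult_right_mono) (auto simp: field_simps mult_le_cancel_left1)
  finally have "z \<le> a * ?M" by (metis of_int_le_iff of_int_mult)
  then have "floorlog 2 (nat \<bar>z\<bar>) \<le> floorlog 2 (nat \<bar>a\<bar> * nat ?M)"
    using z0 a0 M by (intro floorlog_mono) (simp add: nat_mult_distrib[symmetric])
  also have "\<dots> \<le> numer_bits (cost I i) + floorlog 2 (nat ?M)"
    unfolding q(3) by (rule floorlog2_mult_le)
  finally have *: "rat_bits (R i) \<le> numer_bits (cost I i) + 2 * floorlog 2 (nat ?M)"
    using bits M by (simp add: rat_bits_eq)
  let ?C = "encode_list (map (\<lambda>i. Num (cost I i)) [0..<nvars I])"
  have C: "val_size ?C \<le> ?N" by (simp add: encode_instance_def)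
  have "Num (cost I i) \<in> set (decode_list ?C)" using assms(2) by simp
  then have "numer_bits (cost I i) \<le> ?N"
    using mem_decode_list_size[of "Num (cost I i)" ?C] C by (simp add: rat_bits_eq)
  moreover have "(\<Sum>i<nvars I. denom_bits (cost I i)) \<le> ?N"
  proof -
    have "(\<Sum>i<nvars I. denom_bits (cost I i)) \<le> (\<Sum>i<nvars I. val_size (Num (cost I i)) + 1)"
      by (intro sum_mono) (simp add: rat_bits_eq)
    also have "\<dots> \<le> val_size ?C"
      by (simp add: val_size_encode_list sum_list_upt comp_def)
    finally show ?thesis using C by simp
  qed
  ultimately show ?thesis using * floorlog_cost_denominator(2)[of I] by linarith
qed

lemma val_size_local_ratio_state:
  assumes "reduced_costs I R"
  defines "N \<equiv> val_size (encode_instance I)"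
  shows "val_size (local_ratio_state I b R) \<le> N + 6 + N * (3 * N + 4) + N * 6"
proof -
  have n: "nvars I \<le> N" unfolding N_def by (rule nvars_le_size)
  have "val_size (encode_list (map (\<lambda>i. Num (R i)) [0..<nvars I]))
      \<le> 2 + length (map (\<lambda>i. Num (R i)) [0..<nvars I]) * (3 * N + 3 + 1)"
    using reduced_costs_bits[OF assms(1)] unfolding N_def by (intro val_size_encode_list_le) auto
  also have "\<dots> \<le> 2 + N * (3 * N + 4)"
    using n by (intro add_left_mono mult_le_mono) auto
  finally show ?thesis
    using val_size_enc_assignment_le[of I b] n unfolding N_def by (simp add: local_ratio_state_def)
qed

text \<open>Reduced costs depend on the run, so the invariant quantifies over \<open>R\<close> and
  retains just the property that bounds its size.\<close>

interpretation local_ratio: testing_loop local_ratio_init local_ratio_residual local_ratio_choice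
  local_ratio_update local_ratio_answer
  "\<lambda>v. val_size v + 6 + val_size v * (3 * val_size v + 4) + val_size v * 6"
  "\<lambda>I b s. \<exists>R. reduced_costs I R \<and> s = local_ratio_state I b R"
proof
  show "ptime local_ratio_init" "ptime local_ratio_residual" "ptime local_ratio_choice"
    "ptime local_ratio_update" "ptime local_ratio_answer"
    unfolding local_ratio_init_def local_ratio_residual_def local_ratio_update_def local_ratio_answer_def
    by (intro ptime_intros)+
  show "poly_bounded (\<lambda>v. val_size v + 6 + val_size v * (3 * val_size v + 4) + val_size v * 6)"
    by (intro pb_intros)
  fix I b s x
  assume wf: "wf_instance I"
  have "local_ratio_init (encode_instance I) = local_ratio_state I Map.empty (cost I)"
    by (simp add: local_ratio_init_def local_ratio_state_def initial_assignment_val_eq)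
      (simp add: encode_instance_def)
  then show "\<exists>R. reduced_costs I R \<and> local_ratio_init (encode_instance I) = local_ratio_state I Map.empty R"
    using reduced_costs_cost[OF wf] by blast
  assume "\<exists>R. reduced_costs I R \<and> s = local_ratio_state I b R"
  then obtain R where R: "reduced_costs I R" and s: "s = local_ratio_state I b R" by blast
  show "val_size s \<le> val_size (encode_instance I) + 6 +
      val_size (encode_instance I) * (3 * val_size (encode_instance I) + 4) + val_size (encode_instance I) * 6"
    unfolding s by (rule val_size_local_ratio_state[OF R])
  show "(local_ratio_residual s = Num 0) = all_determined I b"
    by (simp add: s local_ratio_residual_def local_ratio_state_def residual_val_eq all_determined_iff)
  show "local_ratio_answer s = encode_answer I x" if "all_determined I b" "b \<subseteq>\<^sub>m total x"
    using answer_val_eq[OF that] by (simp add: s local_ratio_answer_def local_ratio_state_def)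
  assume nd: "\<not> all_determined I b"
  obtain k j where "k < nforms I" "formula_residual I k b \<noteq> 0" and
    j: "j \<in> live_vars I b k" "\<And>i. i \<in> live_vars I b k \<Longrightarrow> R j \<le> R i"
    "local_ratio_choice (local_ratio_state I b R) = Num (of_nat j)"
    "\<And>v. local_ratio_update (Node (local_ratio_state I b R) (Num (of_bool v))) =
       local_ratio_state I (b(j \<mapsto> v)) (\<lambda>i. if i \<in> live_vars I b k then R i - R j else R i)"
    by (rule local_ratio_state_step[OF nd, of R]) (rule that)
  have "\<exists>R. reduced_costs I R \<and> local_ratio_update (Node s (Num (of_bool v))) = local_ratio_state I (b(j \<mapsto> v)) R" for v
    using reduced_costs_step[OF R j(1,2)] j(4)[of v] unfolding s by blast
  moreover have "j < nvars I" "b j = None" using j(1) by (auto simp: live_vars_def)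
  ultimately show "\<exists>j<nvars I. b j = None \<and> local_ratio_choice s = Num (of_nat j) \<and>
      (\<forall>v. \<exists>R. reduced_costs I R \<and> local_ratio_update (Node s (Num (of_bool v))) = local_ratio_state I (b(j \<mapsto> v)) R)"
    using j(3) unfolding s by blast
qed

lemma local_ratio_tree_loop_tree:
  assumes "card (unknowns I b) \<le> n"
  shows "local_ratio_tree I b R
    (loop_tree local_ratio_residual local_ratio_choice local_ratio_update n (local_ratio_state I b R))"
  using assms
proof (induction n arbitrary: b R)
  case 0
  then show ?case by (simp add: all_determined_no_unknowns)
next
  case (Suc n)
  have stop: "local_ratio_residual (local_ratio_state I b R) = Num 0 \<longleftrightarrow> all_determined I b"
    by (simp add: local_ratio_residual_def local_ratio_state_def residual_val_eq all_determined_iff)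
  show ?case
  proof (cases "all_determined I b")
    case True
    then show ?thesis by (simp add: stop)
  next
    case False
    let ?R = "\<lambda>j k i. if i \<in> live_vars I b k then R i - R j else R i"
    obtain k j where k: "k < nforms I" "formula_residual I k b \<noteq> 0" "j \<in> live_vars I b k"
      "\<And>i. i \<in> live_vars I b k \<Longrightarrow> R j \<le> R i"
      and choice: "local_ratio_choice (local_ratio_state I b R) = Num (of_nat j)"
      and upd: "\<And>v. local_ratio_update (Node (local_ratio_state I b R) (Num (of_bool v))) =
         local_ratio_state I (b(j \<mapsto> v)) (?R j k)"
      by (rule local_ratio_state_step[OF False, of R]) (rule that)
    have j: "j < nvars I" "b j = None" using k(3) by (auto simp: live_vars_def)
    have le: "card (unknowns I (b(j \<mapsto> v))) \<le> n" for v
      using card_unknowns_upd[of j I b v, OF j] Suc.prems by simp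
    have "loop_tree local_ratio_residual local_ratio_choice local_ratio_update (Suc n) (local_ratio_state I b R) =
      Test j (loop_tree local_ratio_residual local_ratio_choice local_ratio_update n (local_ratio_state I (b(j \<mapsto> False)) (?R j k)))
        (loop_tree local_ratio_residual local_ratio_choice local_ratio_update n (local_ratio_state I (b(j \<mapsto> True)) (?R j k)))"
      using upd[of True] upd[of False] False by (simp add: stop choice del: fun_upd_apply)
    moreover have "local_ratio_tree I b R (Test j
        (loop_tree local_ratio_residual local_ratio_choice local_ratio_update n (local_ratio_state I (b(j \<mapsto> False)) (?R j k)))
        (loop_tree local_ratio_residual local_ratio_choice local_ratio_update n (local_ratio_state I (b(j \<mapsto> True)) (?R j k))))"
      unfolding local_ratio_tree.simps
      using False k Suc.IH[OF le] by blast
    ultimately show ?thesis by (simp only:)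
  qed
qed

lemma local_ratio_tree_algorithm: "local_ratio_tree I Map.empty (cost I) (local_ratio.algorithm I)"
proof -
  have "local_ratio_init (encode_instance I) = local_ratio_state I Map.empty (cost I)"
    by (simp add: local_ratio_init_def local_ratio_state_def initial_assignment_val_eq)
      (simp add: encode_instance_def)
  then show ?thesis
    unfolding local_ratio.algorithm_def by (simp add: local_ratio_tree_loop_tree unknowns_def)
qed

subsection \<open>Approximation factors\<close>

lemma opt_cost_attained:
  obtains S where "evaluates I S" "expected_cost I S = opt_cost I"
  using optimal_strategy_exists by blast

text \<open>With \<open>P\<close> the square of the sum \<open>T\<close> of all
  \<open>D I k\<close>, the factor \<open>2 * (ln P + 1)\<close> becomes
  \<open>4 * ln T + 2\<close>. For \<open>T = 0\<close> this \<open>P\<close> is below 1, but then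
  all formulas are constant and no strategy tests anything.\<close>

lemma greedy_cost_le_log_sum_D:
  assumes wf: "wf_instance I"
  shows "expected_cost I (greedy.algorithm I) \<le>
    (4 * ln (real (nforms I) * D_avg I) + 2) * opt_cost I"
proof -
  obtain S where S: "evaluates I S" "expected_cost I S = opt_cost I" by (rule opt_cost_attained)
  note tree = greedy_tree_algorithm[OF wf]
  define T where "T = (\<Sum>k<nforms I. D I k)"
  have T: "real (nforms I) * D_avg I = real_of_int T"
    using wf by (simp add: D_avg_def T_def wf_instance_def)
  have "T \<ge> 0" by (simp add: T_def sum_nonneg D_nonneg)
  then consider "T = 0" | "T \<ge> 1" by linarith
  then show ?thesis
  proof cases
    case 1
    then have "all_determined I Map.empty"
      using residual_le_sum_D[of I Map.empty] residual_nonneg[of I Map.empty]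
      by (simp add: all_determined_iff T_def)
    moreover have "evaluates_from I Map.empty S" using S(1) by (simp add: evaluates_def)
    ultimately have "S = Stop" "greedy.algorithm I = Stop"
      using tree by (cases S; cases "greedy.algorithm I"; simp)+
    then show ?thesis using S(2) by (simp add: expected_cost_def)
  next
    case 2
    have "expected_cost I (greedy.algorithm I) \<le> 2 * (ln ((real_of_int T)\<^sup>2) + 1) * expected_cost I S"
    proof (rule greedy_tree_cost_le[OF wf tree S(1)])
      show "(real_of_int T)\<^sup>2 \<ge> 1" using 2 by (simp add: one_le_power)
      fix i v
      have "decrease I Map.empty i v \<le> T\<^sup>2"
        using decrease_le_residual[of I Map.empty i v] residual_le_sum_D[of I Map.empty] by (simp add: T_def)
      then show "real_of_int (decrease I Map.empty i v) \<le> (real_of_int T)\<^sup>2"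
        by (metis of_int_le_iff of_int_power)
    qed
    then show ?thesis unfolding T S(2) using 2 by (simp add: ln_realpow algebra_simps)
  qed
qed

lemma greedy_cost_le_or_formulas:
  assumes wf: "wf_instance I" and or: "\<forall>k<nforms I. or_formula I k"
    and occ: "\<forall>i<nvars I. occurrences I i \<le> r"
  shows "expected_cost I (greedy.algorithm I) \<le> 2 * (ln (real (beta_max I) * real r) + 1) * opt_cost I"
proof -
  obtain S where S: "evaluates I S" "expected_cost I S = opt_cost I" by (rule opt_cost_attained)
  have m: "0 < nforms I" using wf by (simp add: wf_instance_def)
  \<comment> \<open>An instance has a formula and an OR formula has a variable; this secures the
    bound \<open>P \<ge> 1\<close>.\<close>
  then obtain i where i: "i \<in> formula_vars I 0" using or by (auto simp: or_formula_def)
  then have "card (formula_vars I 0) \<ge> 1" by (simp add: Suc_le_eq card_gt_0_iff) auto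
  moreover have "card (formula_vars I 0) \<le> beta_max I"
    unfolding beta_max_def using m by (intro Max_ge) auto
  moreover have "occurrences I i \<ge> 1"
    unfolding occurrences_def using i m by (simp add: Suc_le_eq card_gt_0_iff) auto
  moreover have "occurrences I i \<le> r" using occ i by (simp add: formula_vars_def)
  ultimately have "beta_max I * r \<ge> 1" by (simp add: Suc_le_eq)
  then have 1: "real (beta_max I * r) \<ge> 1" by linarith
  have "expected_cost I (greedy.algorithm I) \<le> 2 * (ln (real (beta_max I * r)) + 1) * expected_cost I S"
  proof (rule greedy_tree_cost_le[OF wf greedy_tree_algorithm[OF wf] S(1) 1])
    fix i v assume "i < nvars I"
    then have "decrease I Map.empty i v \<le> int (beta_max I * r)"
      using m by (intro decrease_or_formulas_le or occ) auto
    then show "real_of_int (decrease I Map.empty i v) \<le> real (beta_max I * r)" by linarith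
  qed
  then show ?thesis by (simp add: S(2))
qed

lemma log_factor_bigo: "(\<lambda>t. 4 * ln t + 2) \<in> O(\<lambda>t :: real. ln t)"
\<comment> \<open>For \<open>t \<ge> exp 1\<close> the logarithm is at least 1 and absorbs the
  additive 2, hence \<open>6 = 4 + 2\<close>.\<close>
proof (rule bigoI[of _ 6])
  show "\<forall>\<^sub>F t :: real in at_top. norm (4 * ln t + 2) \<le> 6 * norm (ln t)"
    using eventually_ge_at_top[of "exp 1"]
  proof eventually_elim
    case (elim t)
    then have "t > 0" using exp_gt_zero[of "1::real"] by linarith
    then have "ln t \<ge> 1" using elim by (simp add: ln_ge_iff)
    then show ?case by simp
  qed
qed

text \<open>In (a) both guarantees concern one and the same algorithm, and \<open>\<alpha>\<close>
  is chosen before the instance, so its bound also holds for small arguments, on which the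
  asymptotic condition is silent.\<close>

theorem theorem7:
  shows "(\<exists>A. poly_time_algorithm A \<and>
           (\<exists>\<alpha> :: real \<Rightarrow> real. \<alpha> \<in> O(\<lambda>t. ln t) \<and>
              (\<forall>I. wf_instance I \<longrightarrow>
                 expected_cost I (A I) \<le> \<alpha> (real (nforms I) * D_avg I) * opt_cost I)) \<and>
           (\<forall>I (r :: nat). wf_instance I \<and>
                 (\<forall>k<nforms I. or_formula I k) \<and> (\<forall>i<nvars I. occurrences I i \<le> r) \<longrightarrow>
                 expected_cost I (A I) \<le> 2 * (ln (real (beta_max I) * real r) + 1) * opt_cost I)) \<and>
         (\<exists>A. poly_time_algorithm A \<and>
           (\<forall>I. wf_instance I \<longrightarrow>
              expected_cost I (A I) \<le> real_of_int (D_max I) * opt_cost I))"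
proof -
  have "\<exists>\<alpha> :: real \<Rightarrow> real. \<alpha> \<in> O(\<lambda>t. ln t) \<and> (\<forall>I. wf_instance I \<longrightarrow>
      expected_cost I (greedy.algorithm I) \<le> \<alpha> (real (nforms I) * D_avg I) * opt_cost I)"
    using log_factor_bigo greedy_cost_le_log_sum_D by blast
  moreover have "\<forall>I (r :: nat). wf_instance I \<and>
      (\<forall>k<nforms I. or_formula I k) \<and> (\<forall>i<nvars I. occurrences I i \<le> r) \<longrightarrow>
      expected_cost I (greedy.algorithm I) \<le> 2 * (ln (real (beta_max I) * real r) + 1) * opt_cost I"
    using greedy_cost_le_or_formulas by blast
  moreover have "\<forall>I. wf_instance I \<longrightarrow>
      expected_cost I (local_ratio.algorithm I) \<le> real_of_int (D_max I) * opt_cost I"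
    using local_ratio_tree_cost_le[OF _ local_ratio_tree_algorithm] opt_cost_attained by metis
  ultimately show ?thesis
    using greedy.poly_time_algorithm local_ratio.poly_time_algorithm by blast
qed

end
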